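(* Let $Q\in\mathcal{D}'(\mathbb{R}^1)$. Then the following statements are equivalent. (i) $Q$ is infinitesimally form bounded with respect to $-\frac{d^2}{dx^2}$. (ii) $Q$ is form bounded with respect to $-\frac{d^2}{dx^2}$, i.e., $$|\langle Qu,u\rangle|\le\mathrm{const}\,\|u\|^2_{W^{1,2}(\mathbb{R}^1)},\qquad\forall u\in C_0^\infty(\mathbb{R}^1).$$ (iii) $Q$ can be represented in the form $Q=\frac{d\Gamma}{dx}+\gamma$, where $$\sup_{x\in\mathbb{R}^1}\int_x^{x+1}\left(|\Gamma(t)|^2+|\gamma(t)|\right)dt<+\infty. \qquad ( * )$$ (iv) Condition $( * )$ holds where $$\Gamma(x)=\int_{\mathbb{R}^1}\operatorname{sign}(x-t)\,e^{-|x-t|}\,Q(t)\,dt,\qquad\gamma(x)=\int_{\mathbb{R}^1}e^{-|x-t|}\,Q(t)\,dt$$ are understood in the distributional sense.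
   Context: $Q$ is an arbitrary real- or complex-valued distribution on $\mathbb{R}$, $\langle Qu,u\rangle=\langle Q,|u|^2\rangle$. $Q$ is infinitesimally form bounded with respect to $-\frac{d^2}{dx^2}$ if for every $\epsilon>0$ there exists $C(\epsilon)>0$ such that $|\langle Qu,u\rangle|\le\epsilon\|u'\|^2_{L^2(\mathbb{R}^1)}+C(\epsilon)\|u\|^2_{L^2(\mathbb{R}^1)}$ for all $u\in C_0^\infty(\mathbb{R}^1)$. $\|u\|_{W^{1,2}(\mathbb{R}^1)}=\|u\|_{L^2(\mathbb{R}^1)}+\|u'\|_{L^2(\mathbb{R}^1)}$. In (iii) the derivative is in the sense of distributions and $\Gamma,\gamma$ are (complex-valued) functions. *)

theory Defs
  imports "HOL-Analysis.Analysis"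
begin

definition vderiv :: "(real \<Rightarrow> complex) \<Rightarrow> real \<Rightarrow> complex"
  where "vderiv f = (\<lambda>x. vector_derivative f (at x))"

definition smooth :: "(real \<Rightarrow> complex) \<Rightarrow> bool"
  where "smooth f \<longleftrightarrow> (\<forall>k x. (vderiv ^^ k) f differentiable (at x))"

definition tsupport :: "(real \<Rightarrow> complex) \<Rightarrow> real set"
  where "tsupport f = closure (support_on UNIV f)"

definition test_functions :: "(real \<Rightarrow> complex) set"
  where "test_functions = {\<phi>. smooth \<phi> \<and> compact (tsupport \<phi>)}"

(* A distribution is represented by a functional on all functions, but only its values on
   test_functions are meaningful.  Continuity is the usual seminorm estimate on each compact set. *)
definition distribution :: "((real \<Rightarrow> complex) \<Rightarrow> complex) \<Rightarrow> bool"
  where "distribution Q \<longleftrightarrow>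
    (\<forall>\<phi>\<in>test_functions. \<forall>\<psi>\<in>test_functions. Q (\<lambda>x. \<phi> x + \<psi> x) = Q \<phi> + Q \<psi>) \<and>
    (\<forall>c. \<forall>\<phi>\<in>test_functions. Q (\<lambda>x. c * \<phi> x) = c * Q \<phi>) \<and>
    (\<forall>K. compact K \<longrightarrow> (\<exists>C N. \<forall>\<phi>\<in>test_functions. tsupport \<phi> \<subseteq> K \<longrightarrow>
        cmod (Q \<phi>) \<le> C * (\<Sum>k\<le>N. SUP x. cmod ((vderiv ^^ k) \<phi> x))))"

definition dist_of_fun :: "(real \<Rightarrow> complex) \<Rightarrow> (real \<Rightarrow> complex) \<Rightarrow> complex"
  where "dist_of_fun f \<phi> = (LINT x|lebesgue. f x * \<phi> x)"

definition dist_deriv :: "((real \<Rightarrow> complex) \<Rightarrow> complex) \<Rightarrow> (real \<Rightarrow> complex) \<Rightarrow> complex"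
  where "dist_deriv T \<phi> = - T (vderiv \<phi>)"

definition L2_norm :: "(real \<Rightarrow> complex) \<Rightarrow> real"
  where "L2_norm u = sqrt (LINT x|lebesgue. (cmod (u x))\<^sup>2)"

definition W12_norm :: "(real \<Rightarrow> complex) \<Rightarrow> real"
  where "W12_norm u = L2_norm u + L2_norm (vderiv u)"

definition quad_form :: "((real \<Rightarrow> complex) \<Rightarrow> complex) \<Rightarrow> (real \<Rightarrow> complex) \<Rightarrow> complex"
  where "quad_form Q u = Q (\<lambda>x. complex_of_real ((cmod (u x))\<^sup>2))"

definition inf_form_bounded :: "((real \<Rightarrow> complex) \<Rightarrow> complex) \<Rightarrow> bool"
  where "inf_form_bounded Q \<longleftrightarrow>
    (\<forall>\<epsilon>>0. \<exists>C>0. \<forall>u\<in>test_functions.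
        cmod (quad_form Q u) \<le> \<epsilon> * (L2_norm (vderiv u))\<^sup>2 + C * (L2_norm u)\<^sup>2)"

definition form_bounded :: "((real \<Rightarrow> complex) \<Rightarrow> complex) \<Rightarrow> bool"
  where "form_bounded Q \<longleftrightarrow>
    (\<exists>C. \<forall>u\<in>test_functions. cmod (quad_form Q u) \<le> C * (W12_norm u)\<^sup>2)"

(* The nonnegative integral makes finiteness of the supremum include local integrability. *)
definition unif_loc_bound :: "(real \<Rightarrow> complex) \<Rightarrow> (real \<Rightarrow> complex) \<Rightarrow> bool"
  where "unif_loc_bound \<Gamma> \<gamma> \<longleftrightarrow>
    \<Gamma> \<in> borel_measurable lebesgue \<and> \<gamma> \<in> borel_measurable lebesgue \<and>
    (SUP x::real. \<integral>\<^sup>+t\<in>{x..x+1}. ennreal ((cmod (\<Gamma> t))\<^sup>2 + cmod (\<gamma> t)) \<partial>lebesgue) < \<infinity>"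

(* Sequences of test functions converging to 1 on the line, as used (Vladimirov) to pair a
   distribution with a smooth function that need not have compact support. *)
definition approx_unit :: "(nat \<Rightarrow> real \<Rightarrow> complex) \<Rightarrow> bool"
  where "approx_unit \<eta> \<longleftrightarrow>
    (\<forall>n. \<eta> n \<in> test_functions) \<and>
    (\<forall>K. compact K \<longrightarrow> (\<forall>\<^sub>F n in sequentially. \<forall>x\<in>K. \<eta> n x = 1)) \<and>
    (\<forall>k. \<exists>B. \<forall>n x. cmod ((vderiv ^^ k) (\<eta> n) x) \<le> B)"

definition has_pairing :: "((real \<Rightarrow> complex) \<Rightarrow> complex) \<Rightarrow> (real \<Rightarrow> complex) \<Rightarrow> complex \<Rightarrow> bool"
  where "has_pairing Q \<psi> c \<longleftrightarrow>
    (\<forall>\<eta>. approx_unit \<eta> \<longrightarrow> (\<lambda>n. Q (\<lambda>t. \<eta> n t * \<psi> t)) \<longlonglongrightarrow> c)"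

(* T is the distribution  x |-> integral of k(x - t) Q(t) dt,  i.e.
   T(phi) = < Q(t), integral of k(x - t) phi(x) dx >  for every test function phi.  The inner
   function of t is smooth for integrable k but in general not compactly supported; existence of
   its pairing with Q is part of the assertion. *)
definition has_convolution ::
    "(real \<Rightarrow> real) \<Rightarrow> ((real \<Rightarrow> complex) \<Rightarrow> complex) \<Rightarrow> ((real \<Rightarrow> complex) \<Rightarrow> complex) \<Rightarrow> bool"
  where "has_convolution k Q T \<longleftrightarrow>
    (\<forall>\<phi>\<in>test_functions.
        has_pairing Q (\<lambda>t. LINT x|lebesgue. complex_of_real (k (x - t)) * \<phi> x) (T \<phi>))"

end

theory Submission
  imports Defs
begin

text \<open>(iii) implies (i) by a local trace inequality: averaging
  \<open>\<bar>u x\<bar>\<^sup>2 \<le> \<bar>u y\<bar>\<^sup>2 + \<integral> (\<epsilon> \<bar>u'\<bar>\<^sup>2 + \<bar>u\<bar>\<^sup>2 / \<epsilon>)\<close> over \<open>y \<in> {x..x+1}\<close> and integrating against a uniformly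
  locally integrable weight costs only the uniform bound of the weight, by Tonelli.

  (ii) implies (iii): polarization against a cutoff function turns the form bound into a bound for \<open>Q \<phi>\<close> by
  the energy of \<open>\<phi>'\<close>, uniformly over all windows of length 2. Minimizing \<open>\<parallel>\<phi>'\<parallel>\<^sup>2 - 2 Re (Q \<phi>)\<close> on each window
  yields \<open>Q \<phi> = \<integral> h \<phi>'\<close> with a uniform bound for the norm of \<open>h\<close> in \<open>L\<^sup>2\<close>, and a smooth partition of unity glues
  these representations.

  (iii) and (iv) are linked by \<open>E'' = E - 2 \<delta>\<close> for \<open>E s = exp (- \<bar>s\<bar>)\<close>: the functions in (iv) satisfy
  \<open>Q = (\<Gamma>' + \<gamma>) / 2\<close>, and conversely convolving \<open>Q = \<Gamma>' + \<gamma>\<close> with \<open>- E'\<close> and \<open>E\<close> reproduces \<open>2 \<Gamma>\<close> up to bounded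
  functions.\<close>

section \<open>Smooth functions and test functions\<close>

text \<open>The obstacle in (ii) is that the form evaluates \<open>Q\<close> only at squared moduli,
  and that the polarizing cutoff must equal 1 on the support of \<phi> while its W12 norm enters the
  bound. That norm grows with the length of the support, so a uniform bound is available only on
  windows of fixed length. On such a window a Poincare inequality absorbs the L2 norm of \<phi> into
  that of its derivative; hence the Riesz argument can run on derivatives alone, and
  \<open>Q\<close> is locally a pure derivative. The zero-order term \<gamma> comes solely from the
  derivatives of the partition of unity.

  Form boundedness improves itself to the infinitesimal version because, on the line, every
  uniformly locally integrable weight is infinitesimally form bounded: the term with \<Gamma> costs
  a small multiple of |u'|^2 plus a large multiple of |\<Gamma>|^2 |u|^2, and the latter is such a
  weight. This is why (ii) reaches (i) by way of (iii).

  In (iv) the functions paired with \<open>Q\<close> have no compact support. Existence of the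
  pairing is a dominated convergence statement, and the representation in (iii) supplies the
  majorant.\<close>

primrec times_diff :: "nat \<Rightarrow> (real \<Rightarrow> complex) \<Rightarrow> bool" where
  "times_diff 0 f \<longleftrightarrow> True"
| "times_diff (Suc n) f \<longleftrightarrow> (\<forall>x. f differentiable (at x)) \<and> times_diff n (vderiv f)"

text \<open>The recursion in \<open>times_diff\<close> differentiates first and then asks about the
  derivative, so closure properties go by induction on the order with the functions generalized.
  \<open>funpow_swap1\<close> reconciles this with the iterates in \<open>smooth\<close>.\<close>

lemma times_diff_iff: "times_diff n f \<longleftrightarrow> (\<forall>k<n. \<forall>x. (vderiv ^^ k) f differentiable (at x))"
proof (induction n arbitrary: f)
  case (Suc n)
  have "(\<forall>k<Suc n. P k) \<longleftrightarrow> P 0 \<and> (\<forall>k<n. P (Suc k))" for P :: "nat \<Rightarrow> bool"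
    by (metis less_Suc_eq_0_disj)
  then show ?case
    by (auto simp: Suc funpow_swap1)
qed simp

lemma smooth_iff_times_diff: "smooth f \<longleftrightarrow> (\<forall>n. times_diff n f)"
  unfolding smooth_def times_diff_iff by blast

lemma vderivI: "(\<And>x. (f has_vector_derivative f' x) (at x)) \<Longrightarrow> vderiv f = f'"
  unfolding vderiv_def by (auto intro!: ext vector_derivative_at)

lemma times_diff_SucI:
  assumes "\<And>x. (f has_vector_derivative f' x) (at x)" "times_diff n f'"
  shows "times_diff (Suc n) f"
  using assms vderivI[of f f'] by (auto intro: differentiableI_vector[of f])

lemma times_diff_SucD: "times_diff (Suc n) f \<Longrightarrow> (f has_vector_derivative vderiv f x) (at x)"
  by (auto simp: vderiv_def vector_derivative_works)

lemma times_diff_Suc_imp: "times_diff (Suc n) f \<Longrightarrow> times_diff n f"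
  by (simp add: times_diff_iff)

lemma smooth_has_vderiv: "smooth f \<Longrightarrow> (f has_vector_derivative vderiv f x) (at x)"
  using times_diff_SucD[of 0 f] smooth_iff_times_diff by blast

lemma smooth_vderiv: "smooth f \<Longrightarrow> smooth (vderiv f)"
  unfolding smooth_iff_times_diff by (metis times_diff.simps(2))

lemma smooth_funpow_vderiv: "smooth f \<Longrightarrow> smooth ((vderiv ^^ k) f)"
  by (induction k) (auto simp: smooth_vderiv)

lemma smooth_continuous: "smooth f \<Longrightarrow> continuous_on S f"
  by (meson continuous_at_imp_continuous_on has_vector_derivative_continuous smooth_has_vderiv)

lemma smooth_measurable [measurable_dest]: "smooth f \<Longrightarrow> f \<in> borel_measurable borel"
  by (simp add: borel_measurable_continuous_onI smooth_continuous)

lemma smooth_vderiv_measurable: "smooth f \<Longrightarrow> vderiv f \<in> borel_measurable borel"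
  by (simp add: smooth_measurable smooth_vderiv)

lemma smoothI: 
  assumes "\<And>x. (f has_vector_derivative f' x) (at x)" "smooth f'"
  shows "smooth f"
  unfolding smooth_iff_times_diff
proof
  show "times_diff n f" for n
    using times_diff_SucI[OF assms(1), of n] assms(2) times_diff_Suc_imp
    by (auto simp: smooth_iff_times_diff)
qed

lemma times_diff_const: "times_diff n (\<lambda>x. c)"
  by (induction n arbitrary: c) (auto intro!: times_diff_SucI derivative_eq_intros simp del: times_diff.simps(2))

lemma times_diff_add: "times_diff n f \<Longrightarrow> times_diff n g \<Longrightarrow> times_diff n (\<lambda>x. f x + g x)"
proof (induction n arbitrary: f g)
  case (Suc n)
  show ?case
    by (rule times_diff_SucI[OF has_vector_derivative_add[OF times_diff_SucD[OF Suc.prems(1)] times_diff_SucD[OF Suc.prems(2)]]])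
       (use Suc in auto)
qed simp

text \<open>The Leibniz derivative is again a sum of products, each with one factor left
  undifferentiated; that factor enters the induction hypothesis at the lower order through
  \<open>times_diff_Suc_imp\<close>.\<close>

lemma times_diff_mult: "times_diff n f \<Longrightarrow> times_diff n g \<Longrightarrow> times_diff n (\<lambda>x. f x * g x)"
proof (induction n arbitrary: f g)
  case (Suc n)
  show ?case
    by (rule times_diff_SucI[OF has_vector_derivative_mult[OF times_diff_SucD[OF Suc.prems(1)] times_diff_SucD[OF Suc.prems(2)]]])
       (use Suc in \<open>auto intro!: times_diff_add Suc.IH times_diff_Suc_imp[of n f] times_diff_Suc_imp[of n g]\<close>)
qed simp

lemma times_diff_affine: "times_diff n f \<Longrightarrow> times_diff n (\<lambda>x. f (a * x + b))"
proof (induction n arbitrary: f)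
  case (Suc n)
  have "((\<lambda>x. f (a * x + b)) has_vector_derivative of_real a * vderiv f (a * x + b)) (at x)" for x
  proof -
    have "((\<lambda>x. a * x + b) has_vector_derivative a) (at x)"
      by (auto intro!: derivative_eq_intros)
    from vector_diff_chain_at[OF this times_diff_SucD[OF Suc.prems]] show ?thesis
      by (simp add: o_def scaleR_conv_of_real)
  qed
  then show ?case
    by (rule times_diff_SucI) (use Suc in \<open>auto intro!: times_diff_mult times_diff_const\<close>)
qed simp

lemma smooth_const: "smooth (\<lambda>x. c)"
  by (simp add: smooth_iff_times_diff times_diff_const)

lemma smooth_add: "smooth f \<Longrightarrow> smooth g \<Longrightarrow> smooth (\<lambda>x. f x + g x)"
  by (simp add: smooth_iff_times_diff times_diff_add)

lemma smooth_mult: "smooth f \<Longrightarrow> smooth g \<Longrightarrow> smooth (\<lambda>x. f x * g x)"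
  by (simp add: smooth_iff_times_diff times_diff_mult)

lemma smooth_affine: "smooth f \<Longrightarrow> smooth (\<lambda>x. f (a * x + b))"
  by (simp add: smooth_iff_times_diff times_diff_affine)

lemma smooth_cmult: "smooth f \<Longrightarrow> smooth (\<lambda>x. c * f x)"
  by (intro smooth_mult smooth_const)

lemma smooth_diff: "smooth f \<Longrightarrow> smooth g \<Longrightarrow> smooth (\<lambda>x. f x - g x)"
  using smooth_add[of f "\<lambda>x. (-1) * g x"] smooth_cmult[of g "-1"] by simp

lemma smooth_cnj:
  assumes "smooth f"
  shows "smooth (\<lambda>x. cnj (f x))"
proof -
  have *: "smooth f \<longrightarrow> times_diff n (\<lambda>x. cnj (f x))" for n
  proof (induction n arbitrary: f)
    case (Suc n)
    show ?case
    proof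
      assume f: "smooth f"
      show "times_diff (Suc n) (\<lambda>x. cnj (f x))"
        by (rule times_diff_SucI[OF has_vector_derivative_cnj[OF smooth_has_vderiv[OF f]]])
           (use Suc f smooth_vderiv in auto)
    qed
  qed simp
  show ?thesis
    using * assms by (simp add: smooth_iff_times_diff)
qed

lemma vderiv_add: "smooth f \<Longrightarrow> smooth g \<Longrightarrow> vderiv (\<lambda>x. f x + g x) = (\<lambda>x. vderiv f x + vderiv g x)"
  by (rule vderivI) (intro has_vector_derivative_add smooth_has_vderiv)

lemma vderiv_mult:
  "smooth f \<Longrightarrow> smooth g \<Longrightarrow> vderiv (\<lambda>x. f x * g x) = (\<lambda>x. f x * vderiv g x + vderiv f x * g x)"
  by (rule vderivI) (intro has_vector_derivative_mult smooth_has_vderiv)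

lemma vderiv_cmult: "smooth f \<Longrightarrow> vderiv (\<lambda>x. c * f x) = (\<lambda>x. c * vderiv f x)"
  by (rule vderivI) (auto intro!: derivative_eq_intros smooth_has_vderiv)

lemma vderiv_diff: "smooth f \<Longrightarrow> smooth g \<Longrightarrow> vderiv (\<lambda>x. f x - g x) = (\<lambda>x. vderiv f x - vderiv g x)"
  by (rule vderivI) (intro has_vector_derivative_diff smooth_has_vderiv)

lemma vderiv_cnj: "smooth f \<Longrightarrow> vderiv (\<lambda>x. cnj (f x)) = (\<lambda>x. cnj (vderiv f x))"
  by (rule vderivI) (intro has_vector_derivative_cnj smooth_has_vderiv)

lemma vderiv_shift: "smooth f \<Longrightarrow> vderiv (\<lambda>x. f (x + b)) = (\<lambda>x. vderiv f (x + b))"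
proof (rule vderivI)
  fix x assume f: "smooth f"
  have "((\<lambda>x. x + b) has_vector_derivative 1) (at x)"
    by (auto intro!: derivative_eq_intros)
  from vector_diff_chain_at[OF this smooth_has_vderiv[OF f]]
  show "((\<lambda>x. f (x + b)) has_vector_derivative vderiv f (x + b)) (at x)"
    by (simp add: o_def)
qed

lemma smooth_shift: "smooth f \<Longrightarrow> smooth (\<lambda>x. f (x + b))"
  using smooth_affine[of f 1 b] by simp

lemma funpow_vderiv_shift: "smooth f \<Longrightarrow> (vderiv ^^ k) (\<lambda>x. f (x + b)) = (\<lambda>x. (vderiv ^^ k) f (x + b))"
  by (induction k) (auto simp: vderiv_shift smooth_funpow_vderiv)

lemma funpow_vderiv_diff:
  "smooth f \<Longrightarrow> smooth g \<Longrightarrow> (vderiv ^^ k) (\<lambda>x. f x - g x) = (\<lambda>x. (vderiv ^^ k) f x - (vderiv ^^ k) g x)"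
  by (induction k) (auto simp: vderiv_diff smooth_funpow_vderiv)

lemma vderiv_eq_0:
  assumes "open S" "x \<in> S" "\<And>y. y \<in> S \<Longrightarrow> f y = c"
  shows "vderiv f x = 0"
proof -
  have "(f has_vector_derivative 0) (at x)"
    by (rule has_vector_derivative_transform_within_open[of "\<lambda>_. c" _ _ S]) (use assms in auto)
  then show ?thesis
    unfolding vderiv_def by (rule vector_derivative_at)
qed

section \<open>Compact support and closure properties of test functions\<close>

lemma test_functions_iff:
  "\<phi> \<in> test_functions \<longleftrightarrow> smooth \<phi> \<and> (\<exists>R. \<forall>x. R < \<bar>x\<bar> \<longrightarrow> \<phi> x = 0)"
proof -
  have "compact (tsupport \<phi>) \<longleftrightarrow> (\<exists>R. \<forall>x. R < \<bar>x\<bar> \<longrightarrow> \<phi> x = 0)"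
    unfolding tsupport_def compact_closure bounded_iff support_on_def
    by simp (meson linorder_not_le)
  then show ?thesis
    by (simp add: test_functions_def)
qed

lemma test_functionE:
  assumes "\<phi> \<in> test_functions"
  obtains R where "R > 0" "\<And>x. R < \<bar>x\<bar> \<Longrightarrow> \<phi> x = 0"
proof -
  from assms obtain R where "\<And>x. R < \<bar>x\<bar> \<Longrightarrow> \<phi> x = 0"
    by (auto simp: test_functions_iff)
  then show thesis
    by (intro that[of "\<bar>R\<bar> + 1"]) auto
qed

lemma test_smooth: "\<phi> \<in> test_functions \<Longrightarrow> smooth \<phi>"
  by (simp add: test_functions_iff)

lemma test_vderiv: 
  assumes "\<phi> \<in> test_functions"
  shows "vderiv \<phi> \<in> test_functions"
proof -
  obtain R where R: "\<And>x. R < \<bar>x\<bar> \<Longrightarrow> \<phi> x = 0"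
    using test_functionE[OF assms] by blast
  have "vderiv \<phi> x = 0" if "R < \<bar>x\<bar>" for x
    by (rule vderiv_eq_0[of "{x. R < \<bar>x\<bar>}" _ _ 0])
       (use that R in \<open>auto intro!: open_Collect_less continuous_intros\<close>)
  then show ?thesis
    using assms by (auto simp: test_functions_iff smooth_vderiv)
qed

lemma test_mult_left: "\<phi> \<in> test_functions \<Longrightarrow> smooth g \<Longrightarrow> (\<lambda>x. g x * \<phi> x) \<in> test_functions"
  by (auto simp: test_functions_iff intro!: smooth_mult)

lemma test_mult_right: "\<phi> \<in> test_functions \<Longrightarrow> smooth g \<Longrightarrow> (\<lambda>x. \<phi> x * g x) \<in> test_functions"
  by (auto simp: test_functions_iff intro!: smooth_mult)

lemma test_add: 
  assumes "\<phi> \<in> test_functions" "\<psi> \<in> test_functions"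
  shows "(\<lambda>x. \<phi> x + \<psi> x) \<in> test_functions"
proof -
  obtain R R' where "\<And>x. R < \<bar>x\<bar> \<Longrightarrow> \<phi> x = 0" "\<And>x. R' < \<bar>x\<bar> \<Longrightarrow> \<psi> x = 0"
    using assms test_functionE by metis
  then have "\<forall>x. max R R' < \<bar>x\<bar> \<longrightarrow> \<phi> x + \<psi> x = 0"
    by simp
  then have "\<exists>R. \<forall>x. R < \<bar>x\<bar> \<longrightarrow> \<phi> x + \<psi> x = 0"
    by blast
  then show ?thesis
    using assms unfolding test_functions_iff by (blast intro: smooth_add)
qed

lemma test_cmult: "\<phi> \<in> test_functions \<Longrightarrow> (\<lambda>x. c * \<phi> x) \<in> test_functions"
  by (intro test_mult_left smooth_const)

lemma test_diff: 
  "\<phi> \<in> test_functions \<Longrightarrow> \<psi> \<in> test_functions \<Longrightarrow> (\<lambda>x. \<phi> x - \<psi> x) \<in> test_functions"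
  using test_add[of \<phi> "\<lambda>x. (-1) * \<psi> x"] test_cmult[of \<psi> "-1"] by simp

lemma test_zero: "(\<lambda>x. 0) \<in> test_functions"
  by (auto simp: test_functions_iff smooth_const)

lemma test_bounded:
  assumes "\<phi> \<in> test_functions"
  obtains B where "B > 0" "\<And>x. cmod (\<phi> x) \<le> B"
proof -
  obtain R where R: "R > 0" "\<And>x. R < \<bar>x\<bar> \<Longrightarrow> \<phi> x = 0"
    using test_functionE[OF assms] by blast
  have "compact (\<phi> ` {-R..R})"
    by (intro compact_continuous_image smooth_continuous test_smooth assms) auto
  then obtain B where B: "B > 0" "\<And>y. y \<in> \<phi> ` {-R..R} \<Longrightarrow> cmod y \<le> B"
    using compact_imp_bounded bounded_pos by metis
  have "cmod (\<phi> x) \<le> B" for x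
    by (cases "R < \<bar>x\<bar>") (use B R in \<open>auto simp: not_less abs_le_iff\<close>)
  then show thesis
    using that B by blast
qed

lemma test_integrable:
  assumes "\<phi> \<in> test_functions"
  shows "integrable lborel \<phi>"
proof -
  obtain R where R: "R > 0" "\<And>x. R < \<bar>x\<bar> \<Longrightarrow> \<phi> x = 0"
    using test_functionE[OF assms] by blast
  have "integrable lborel (\<lambda>x. indicator {-R..R} x *\<^sub>R \<phi> x)"
    by (intro borel_integrable_compact smooth_continuous test_smooth assms) auto
  moreover have "(\<lambda>x. indicator {-R..R} x *\<^sub>R \<phi> x) = \<phi>"
    using R by (auto simp: fun_eq_iff indicator_def abs_le_iff not_le abs_if split: if_splits)
  ultimately show ?thesis by simp
qed

text \<open>The modulus need not be smooth at zeros of \<open>u\<close>, but its square is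
  \<open>u\<close> times its conjugate. Hence \<open>quad_form\<close> really evaluates the
  distribution at a test function.\<close>

lemma test_norm_sq:
  assumes "u \<in> test_functions"
  shows "(\<lambda>x. complex_of_real ((cmod (u x))\<^sup>2)) \<in> test_functions"
    and "vderiv (\<lambda>x. complex_of_real ((cmod (u x))\<^sup>2)) = (\<lambda>x. complex_of_real (2 * Re (cnj (u x) * vderiv u x)))"
proof -
  have eq: "(\<lambda>x. complex_of_real ((cmod (u x))\<^sup>2)) = (\<lambda>x. u x * cnj (u x))"
    by (simp add: complex_mult_cnj cmod_power2)
  show "(\<lambda>x. complex_of_real ((cmod (u x))\<^sup>2)) \<in> test_functions"
    unfolding eq using assms by (intro test_mult_right smooth_cnj test_smooth)
  have *: "u x * cnj (vderiv u x) + vderiv u x * cnj (u x) = complex_of_real (2 * Re (cnj (u x) * vderiv u x))" for x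
    by (auto simp: complex_eq_iff)
  show "vderiv (\<lambda>x. complex_of_real ((cmod (u x))\<^sup>2)) = (\<lambda>x. complex_of_real (2 * Re (cnj (u x) * vderiv u x)))"
    unfolding eq using test_smooth[OF assms]
    by (subst vderiv_mult) (auto simp: vderiv_cnj smooth_cnj *)
qed

section \<open>Smooth cutoff functions\<close>

text \<open>The classical flat function exp(-1/x), divided by powers of x. The powers make the
  family closed under differentiation up to linear combinations, so one derivative formula yields
  smoothness of every member.\<close>

definition flat_exp :: "nat \<Rightarrow> real \<Rightarrow> real" where
  "flat_exp k x = (if x > 0 then exp (- (1 / x)) / x ^ k else 0)"

lemma has_field_derivative_flat_exp:
  "(flat_exp k has_field_derivative (flat_exp (k + 2) x - real k * flat_exp (Suc k) x)) (at x)"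
proof (cases x "0::real" rule: linorder_cases)
  case less
  have "((\<lambda>_. 0) has_field_derivative 0) (at x)"
    by simp
  then have "(flat_exp k has_field_derivative 0) (at x)"
    by (rule has_field_derivative_transform_within_open[of _ _ _ "{..<0}"])
       (use less in \<open>auto simp: flat_exp_def\<close>)
  then show ?thesis
    using less by (simp add: flat_exp_def)
next
  case equal
  have 1: "((\<lambda>h. (flat_exp k (0 + h) - flat_exp k 0) / h) \<longlongrightarrow> 0) (at_left 0)"
  proof (rule Lim_transform_eventually[OF tendsto_const])
    show "\<forall>\<^sub>F h in at_left 0. 0 = (flat_exp k (0 + h) - flat_exp k 0) / h"
      by (auto simp: eventually_at_left_field flat_exp_def intro!: exI[of _ "-1"])
  qed
  \<comment> \<open>With y = 1/h the right difference quotient at 0 is y^(k+1) / exp y, which tends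
    to 0.\<close>
  have "((\<lambda>h::real. inverse h ^ Suc k / exp (inverse h)) \<longlongrightarrow> 0) (at_right 0)"
    by (rule filterlim_compose[OF tendsto_power_div_exp_0 filterlim_inverse_at_top_right])
  then have 2: "((\<lambda>h. (flat_exp k (0 + h) - flat_exp k 0) / h) \<longlongrightarrow> 0) (at_right 0)"
  proof (rule Lim_transform_eventually)
    show "\<forall>\<^sub>F h in at_right 0. inverse h ^ Suc k / exp (inverse h) = (flat_exp k (0 + h) - flat_exp k 0) / h"
      by (auto simp: eventually_at_right_field flat_exp_def exp_minus field_simps power_inverse intro!: exI[of _ 1])
  qed
  have "(flat_exp k has_field_derivative 0) (at 0)"
    unfolding DERIV_def by (rule filterlim_split_at[OF 1 2])
  then show ?thesis
    by (simp add: equal flat_exp_def)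
next
  case greater
  have "((\<lambda>x. exp (- (1 / x)) / x ^ k) has_field_derivative
     (exp (- (1 / x)) / x ^ (k + 2) - real k * (exp (- (1 / x)) / x ^ Suc k))) (at x)"
  proof -
    \<comment> \<open>The truncated exponent \<open>k - Suc 0\<close> is harmless at
      \<open>k = 0\<close> because of the factor \<open>real k\<close>.\<close>
    have p: "real k * x ^ (k - Suc 0) = real k * x ^ k / x"
      using greater by (cases k) auto
    have "((\<lambda>x. exp (- (1 / x)) / x ^ k) has_field_derivative
      ((exp (- (1 / x)) * (1 / x ^ 2)) * x ^ k - exp (- (1 / x)) * (real k * x ^ (k - Suc 0))) / (x ^ k * x ^ k)) (at x)"
      using greater by (auto intro!: derivative_eq_intros simp: power2_eq_square)
    then show ?thesis
      unfolding p using greater by (rule_tac DERIV_cong) (auto simp: field_simps power2_eq_square)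
  qed
  then have "(flat_exp k has_field_derivative (exp (- (1 / x)) / x ^ (k + 2) - real k * (exp (- (1 / x)) / x ^ Suc k))) (at x)"
    by (rule has_field_derivative_transform_within_open[of _ _ _ "{0<..}"])
       (use greater in \<open>auto simp: flat_exp_def\<close>)
  then show ?thesis
    using greater by (simp add: flat_exp_def)
qed

lemma smooth_flat_exp: "smooth (\<lambda>x. complex_of_real (flat_exp k x))"
proof -
  have "times_diff n (\<lambda>x. complex_of_real (flat_exp k x))" for n
  proof (induction n arbitrary: k)
    case (Suc n)
    have "((\<lambda>x. complex_of_real (flat_exp k x)) has_vector_derivative
        (complex_of_real (flat_exp (k + 2) x) + (- of_nat k) * complex_of_real (flat_exp (Suc k) x))) (at x)" for x
      using has_vector_derivative_of_real[OF has_field_derivative_flat_exp[of k x]] by simp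
    then show ?case
      by (rule times_diff_SucI) (intro times_diff_add times_diff_mult times_diff_const Suc)
  qed simp
  then show ?thesis
    by (simp add: smooth_iff_times_diff)
qed

lemma antiderivative_exists:
  fixes f :: "real \<Rightarrow> 'a::euclidean_space"
  assumes "continuous_on UNIV f"
  shows "\<exists>F. \<forall>x. (F has_vector_derivative f x) (at x)"
proof (intro exI allI)
  fix x
  \<comment> \<open>The fundamental theorem is applied on a compact interval that contains the base
    point 0 and has \<open>x\<close> in its interior, so that the one-sided derivative becomes a
    full one.\<close>
  have "((\<lambda>u. LBINT y=ereal 0..ereal u. f y) has_vector_derivative f x) (at x within {-(\<bar>x\<bar>+1)..\<bar>x\<bar>+1})"
    by (rule interval_integral_FTC2) (auto intro: continuous_on_subset[OF assms])
  then have "((\<lambda>u. LBINT y=ereal 0..ereal u. f y) has_vector_derivative f x) (at x within {-(\<bar>x\<bar>+1)<..<\<bar>x\<bar>+1})"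
    by (rule has_vector_derivative_within_subset) auto
  then show "((\<lambda>u. LBINT y=ereal 0..ereal u. f y) has_vector_derivative f x) (at x)"
    by (subst (asm) has_vector_derivative_within_open) auto
qed

text \<open>The step is the normalized primitive of a smooth bump that is positive exactly on the
  open unit interval; the primitive is constant on either side of that interval.\<close>

lemma smooth_step_exists:
  "\<exists>S::real \<Rightarrow> real. smooth (\<lambda>x. complex_of_real (S x)) \<and> (\<forall>x\<le>0. S x = 0) \<and> (\<forall>x\<ge>1. S x = 1) \<and>
     (\<forall>x. 0 \<le> S x \<and> S x \<le> 1)"
proof -
  define b where "b x = flat_exp 0 x * flat_exp 0 (1 - x)" for x
  have sb: "smooth (\<lambda>x. complex_of_real (b x))"
    using smooth_mult[OF smooth_flat_exp[of 0] smooth_affine[OF smooth_flat_exp[of 0], of "-1" 1]]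
    by (simp add: b_def)
  have b0: "b x \<ge> 0" "x \<le> 0 \<or> x \<ge> 1 \<Longrightarrow> b x = 0" "0 < x \<Longrightarrow> x < 1 \<Longrightarrow> b x > 0" for x
    by (auto simp: b_def flat_exp_def)
  have "continuous_on UNIV (\<lambda>x. Re (complex_of_real (b x)))"
    by (intro continuous_intros smooth_continuous sb)
  then have "continuous_on UNIV b" by simp
  from antiderivative_exists[OF this] obtain F where F: "\<And>x. (F has_real_derivative b x) (at x)"
    by (auto simp: has_real_derivative_iff_has_vector_derivative)
  have mono: "F x \<le> F y" if "x \<le> y" for x y
    by (rule DERIV_nonneg_imp_nondecreasing[OF that]) (use F b0 in blast)
  have left: "F x = F 0" if "x \<le> 0" for x
  proof (rule antisym)
    show "F 0 \<le> F x"
      by (rule DERIV_nonpos_imp_nonincreasing[OF that]) (use F b0 in force)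
  qed (use mono that in auto)
  have right: "F x = F 1" if "x \<ge> 1" for x
  proof (rule antisym)
    show "F x \<le> F 1"
      by (rule DERIV_nonpos_imp_nonincreasing[OF that]) (use F b0 in force)
  qed (use mono that in auto)
  have less: "F 0 < F 1"
  proof (rule DERIV_pos_imp_increasing_open[of 0 1 F])
    show "continuous_on {0..1} F"
      using F by (meson DERIV_isCont continuous_at_imp_continuous_on)
    show "\<exists>y. (F has_real_derivative y) (at x) \<and> 0 < y" if "0 < x" "x < 1" for x
      using F b0(3)[OF that] by blast
  qed simp
  define S where "S x = (F x - F 0) / (F 1 - F 0)" for x
  have "(S has_real_derivative b x / (F 1 - F 0)) (at x)" for x
    unfolding S_def using less by (auto intro!: derivative_eq_intros F)
  from has_vector_derivative_of_real[OF this]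
  have "smooth (\<lambda>x. complex_of_real (S x))"
    by (rule smoothI) (use smooth_cmult[OF sb, of "1 / complex_of_real (F 1 - F 0)"] in simp)
  moreover have "F 0 \<le> F x \<and> F x \<le> F 1" for x
    using mono[of 0 x] mono[of x 1] left[of x] right[of x] less by linarith
  then have "0 \<le> S x \<and> S x \<le> 1" for x
    using less by (simp add: S_def)
  moreover have "S x = 0" if "x \<le> 0" for x
    unfolding S_def left[OF that] by simp
  moreover have "S x = 1" if "x \<ge> 1" for x
    unfolding S_def right[OF that] using less by simp
  ultimately show ?thesis
    by blast
qed

definition smooth_step :: "real \<Rightarrow> real" where
  "smooth_step = (SOME S. smooth (\<lambda>x. complex_of_real (S x)) \<and> (\<forall>x\<le>0. S x = 0) \<and> (\<forall>x\<ge>1. S x = 1) \<and>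
     (\<forall>x. 0 \<le> S x \<and> S x \<le> 1))"

lemma smooth_step:
  shows smooth_smooth_step: "smooth (\<lambda>x. complex_of_real (smooth_step x))"
    and smooth_step_0: "x \<le> 0 \<Longrightarrow> smooth_step x = 0"
    and smooth_step_1: "x \<ge> 1 \<Longrightarrow> smooth_step x = 1"
    and smooth_step_ge: "0 \<le> smooth_step x"
    and smooth_step_le: "smooth_step x \<le> 1"
  using someI_ex[OF smooth_step_exists] unfolding smooth_step_def by blast+

text \<open>The step itself has no compact support, so order 0 is separate; from order 1 on its
  derivatives live on the unit interval and are test functions.\<close>

lemma smooth_step_derivs_bounded:
  "\<exists>B>0. \<forall>x. cmod ((vderiv ^^ k) (\<lambda>x. complex_of_real (smooth_step x)) x) \<le> B"
proof (cases k)
  case 0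
  then show ?thesis
    by (auto intro!: exI[of _ 1] simp: smooth_step_ge smooth_step_le)
next
  case (Suc j)
  let ?S = "\<lambda>x. complex_of_real (smooth_step x)"
  have "vderiv ?S x = 0" if "x < 0" for x
    by (rule vderiv_eq_0[of "{..<0}" _ _ 0]) (use that in \<open>auto simp: smooth_step_0\<close>)
  moreover have "vderiv ?S x = 0" if "x > 1" for x
    by (rule vderiv_eq_0[of "{1<..}" _ _ 1]) (use that in \<open>auto simp: smooth_step_1\<close>)
  ultimately have "\<forall>x. 1 < \<bar>x\<bar> \<longrightarrow> vderiv ?S x = 0"
    by (auto simp: abs_if split: if_splits)
  then have "vderiv ?S \<in> test_functions"
    using smooth_vderiv[OF smooth_smooth_step] by (auto simp: test_functions_iff)
  then have "(vderiv ^^ j) (vderiv ?S) \<in> test_functions"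
    by (induction j) (auto simp: test_vderiv)
  then show ?thesis
    using Suc test_bounded by (metis funpow_Suc_right o_apply)
qed

text \<open>A plateau: for a <= b it vanishes outside (a, b+1) and equals 1 on [a+1, b]. As a
  difference of translates of one fixed step, it has derivative bounds independent of
  \<open>a\<close> and \<open>b\<close>, and adjacent cutoffs telescope under addition.\<close>

definition cutoff :: "real \<Rightarrow> real \<Rightarrow> real \<Rightarrow> complex" where
  "cutoff a b x = complex_of_real (smooth_step (x - a)) - complex_of_real (smooth_step (x - b))"

lemma cutoff_test: "cutoff a b \<in> test_functions"
proof -
  have "smooth (\<lambda>x. complex_of_real (smooth_step (x + (- a))) - complex_of_real (smooth_step (x + (- b))))"
    by (intro smooth_diff smooth_shift smooth_smooth_step)
  moreover have "cutoff a b x = 0" if "\<bar>x\<bar> > \<bar>a\<bar> + \<bar>b\<bar> + 1" for x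
    using that by (cases "x \<ge> 0") (auto simp: cutoff_def smooth_step_0 smooth_step_1)
  ultimately show ?thesis
    by (auto simp: test_functions_iff cutoff_def[abs_def])
qed

lemma cutoff_eq_0: "a \<le> b \<Longrightarrow> x \<le> a \<or> b + 1 \<le> x \<Longrightarrow> cutoff a b x = 0"
  by (auto simp: cutoff_def smooth_step_0 smooth_step_1)

lemma cutoff_eq_1: "a + 1 \<le> x \<Longrightarrow> x \<le> b \<Longrightarrow> cutoff a b x = 1"
  by (auto simp: cutoff_def smooth_step_0 smooth_step_1)

lemma cnj_cutoff: "cnj (cutoff a b x) = cutoff a b x"
  by (simp add: cutoff_def)

lemma cutoff_derivs_bounded: "\<exists>B>0. \<forall>a b x. cmod ((vderiv ^^ k) (cutoff a b) x) \<le> B"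
proof -
  let ?S = "\<lambda>x. complex_of_real (smooth_step x)"
  obtain B where B: "B > 0" "\<And>x. cmod ((vderiv ^^ k) ?S x) \<le> B"
    using smooth_step_derivs_bounded by blast
  have "(vderiv ^^ k) (cutoff a b) = (\<lambda>x. (vderiv ^^ k) ?S (x + (- a)) - (vderiv ^^ k) ?S (x + (- b)))" for a b
  proof -
    have "cutoff a b = (\<lambda>x. ?S (x + (- a)) - ?S (x + (- b)))"
      by (simp add: cutoff_def fun_eq_iff)
    then show ?thesis
      using funpow_vderiv_diff[OF smooth_shift smooth_shift, OF smooth_smooth_step smooth_smooth_step]
            funpow_vderiv_shift[OF smooth_smooth_step] by metis
  qed
  then have "cmod ((vderiv ^^ k) (cutoff a b) x) \<le> B + B" for a b x
    using norm_triangle_le_diff[OF add_mono[OF B(2) B(2)]] by simp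
  then show ?thesis
    using B by (intro exI[of _ "B + B"]) auto
qed

text \<open>Existence of an approximate unit keeps \<open>has_pairing\<close> from being vacuous and
  makes its value unique.\<close>

lemma approx_unit_cutoff: "approx_unit (\<lambda>n. cutoff (- real n - 1) (real n))"
  unfolding approx_unit_def
proof (intro conjI allI impI)
  fix K :: "real set" assume "compact K"
  then obtain R where R: "\<And>x. x \<in> K \<Longrightarrow> \<bar>x\<bar> \<le> R"
    using compact_imp_bounded[of K] by (auto simp: bounded_iff)
  show "\<forall>\<^sub>F n in sequentially. \<forall>x\<in>K. cutoff (- real n - 1) (real n) x = 1"
    using eventually_ge_at_top[of "nat \<lceil>R\<rceil>"]
  proof eventually_elim
    case (elim n)
    then have "R \<le> real n"
      by linarith
    then show ?case
      using R by (force intro!: cutoff_eq_1 simp: abs_le_iff)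
  qed
next
  fix k show "\<exists>B. \<forall>n x. cmod ((vderiv ^^ k) (cutoff (- real n - 1) (real n)) x) \<le> B"
    using cutoff_derivs_bounded[of k] by blast
qed (rule cutoff_test)

section \<open>Uniformly locally integrable weights\<close>

text \<open>Tonelli: s lies in [t, t+1] exactly if t lies in [s-1, s], so after the exchange each s
  sees the weight only through a unit window. Any \<open>h\<close> dominated by its forward unit
  windows of \<open>g\<close> can thus be integrated against \<open>w\<close>.\<close>

lemma nn_integral_unif_loc:
  fixes w g h :: "real \<Rightarrow> ennreal"
  assumes [measurable]: "w \<in> borel_measurable borel" "g \<in> borel_measurable borel"
    and M: "\<And>x. (\<integral>\<^sup>+t\<in>{x..x+1}. w t \<partial>lborel) \<le> M"
    and h: "\<And>t. h t \<le> (\<integral>\<^sup>+s\<in>{t..t+1}. g s \<partial>lborel)"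
  shows "(\<integral>\<^sup>+t. w t * h t \<partial>lborel) \<le> M * (\<integral>\<^sup>+s. g s \<partial>lborel)"
proof -
  have [measurable]: "Measurable.pred (borel \<Otimes>\<^sub>M borel) (\<lambda>x::real \<times> real. snd x \<in> {fst x..fst x + 1})"
    by simp
  have "(\<integral>\<^sup>+t. w t * h t \<partial>lborel) \<le> (\<integral>\<^sup>+t. w t * (\<integral>\<^sup>+s\<in>{t..t+1}. g s \<partial>lborel) \<partial>lborel)"
    by (intro nn_integral_mono mult_left_mono h) auto
  also have "\<dots> = (\<integral>\<^sup>+t. (\<integral>\<^sup>+s. w t * (g s * indicator {t..t+1} s) \<partial>lborel) \<partial>lborel)"
    by (subst nn_integral_cmult) auto
  also have "\<dots> = (\<integral>\<^sup>+s. (\<integral>\<^sup>+t. w t * (g s * indicator {t..t+1} s) \<partial>lborel) \<partial>lborel)"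
    by (rule lborel_pair.Fubini'[symmetric]) (simp add: split_beta' indicator_def, measurable)
  \<comment> \<open>The upper end is left as \<open>s-1+1\<close> so that the bound on windows of
    the weight applies literally at \<open>s-1\<close>.\<close>
  also have "\<dots> = (\<integral>\<^sup>+s. (\<integral>\<^sup>+t. g s * (w t * indicator {s-1..s-1+1} t) \<partial>lborel) \<partial>lborel)"
    by (intro nn_integral_cong) (auto simp: indicator_def mult.commute)
  also have "\<dots> = (\<integral>\<^sup>+s. g s * (\<integral>\<^sup>+t\<in>{s-1..s-1+1}. w t \<partial>lborel) \<partial>lborel)"
    by (subst nn_integral_cmult) auto
  also have "\<dots> \<le> (\<integral>\<^sup>+s. g s * M \<partial>lborel)"
    by (intro nn_integral_mono mult_left_mono M) auto
  also have "\<dots> = M * (\<integral>\<^sup>+s. g s \<partial>lborel)"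
    by (subst nn_integral_multc) (auto simp: mult.commute)
  finally show ?thesis .
qed

lemma nn_integral_exp_minus_abs: "(\<integral>\<^sup>+s. ennreal (exp (- \<bar>x - s\<bar>)) \<partial>lborel) \<le> 2"
proof -
  have "((\<lambda>s::real. - exp (- s)) \<longlongrightarrow> - 0) at_top"
    by (intro tendsto_intros filterlim_compose[OF exp_at_bot] filterlim_uminus_at_bot_at_top)
  then have 1: "(\<integral>\<^sup>+s. ennreal (exp (- s)) * indicator {0..} s \<partial>lborel) = 1"
    by (subst nn_integral_FTC_atLeast[where F="\<lambda>s. - exp (- s)" and T=0])
       (auto intro!: derivative_eq_intros)
  have 2: "(\<integral>\<^sup>+s. ennreal (exp s) * indicator {..0} s \<partial>lborel) = 1"
    using 1 by (subst nn_integral_real_affine[where c="-1" and t=0]) (auto simp: indicator_def)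
  have "(\<integral>\<^sup>+s. ennreal (exp (- \<bar>x - s\<bar>)) \<partial>lborel) = (\<integral>\<^sup>+s. ennreal (exp (- \<bar>s\<bar>)) \<partial>lborel)"
    by (subst nn_integral_real_affine[where c="-1" and t=x]) auto
  also have "\<dots> \<le> (\<integral>\<^sup>+s. ennreal (exp (- s)) * indicator {0..} s + ennreal (exp s) * indicator {..0} s \<partial>lborel)"
    by (intro nn_integral_mono) (auto simp: indicator_def)
  also have "\<dots> = 2"
    using 1 2 by (subst nn_integral_add) auto
  finally show ?thesis .
qed

text \<open>The exponential kernel changes at most by the factor exp 1 over unit distance, so it is
  dominated by its own unit windows; the remaining factor 2 bounds the total mass of the
  kernel.\<close>

lemma nn_integral_unif_loc_exp:
  fixes w :: "real \<Rightarrow> ennreal"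
  assumes [measurable]: "w \<in> borel_measurable borel"
    and M: "\<And>x. (\<integral>\<^sup>+t\<in>{x..x+1}. w t \<partial>lborel) \<le> M"
  shows "(\<integral>\<^sup>+t. w t * ennreal (exp (- \<bar>x - t\<bar>)) \<partial>lborel) \<le> M * ennreal (2 * exp 1)"
proof -
  have "(\<integral>\<^sup>+t. w t * ennreal (exp (- \<bar>x - t\<bar>)) \<partial>lborel)
      \<le> M * (\<integral>\<^sup>+s. ennreal (exp 1) * ennreal (exp (- \<bar>x - s\<bar>)) \<partial>lborel)"
  proof (rule nn_integral_unif_loc)
    fix t
    have "ennreal (exp (- \<bar>x - t\<bar>)) = (\<integral>\<^sup>+s\<in>{t..t+1}. ennreal (exp (- \<bar>x - t\<bar>)) \<partial>lborel)"
      by (subst nn_integral_cmult_indicator) auto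
    also have "\<dots> \<le> (\<integral>\<^sup>+s\<in>{t..t+1}. ennreal (exp 1) * ennreal (exp (- \<bar>x - s\<bar>)) \<partial>lborel)"
      by (intro nn_integral_mono)
         (auto simp: indicator_def ennreal_mult[symmetric] exp_add[symmetric] intro!: ennreal_leI)
    finally show "ennreal (exp (- \<bar>x - t\<bar>)) \<le> \<dots>" .
  qed (use M in auto)
  also have "\<dots> = M * (ennreal (exp 1) * (\<integral>\<^sup>+s. ennreal (exp (- \<bar>x - s\<bar>)) \<partial>lborel))"
    by (subst nn_integral_cmult) auto
  also have "\<dots> \<le> M * (ennreal (exp 1) * 2)"
    by (intro mult_left_mono nn_integral_exp_minus_abs) auto
  also have "ennreal (exp 1) * 2 = ennreal (2 * exp 1)"
    by (subst mult.commute) (simp add: ennreal_mult)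
  finally show ?thesis by simp
qed

text \<open>Borel representatives with a real bound in place of a supremum: products and
  compositions, as Fubini needs them, are well behaved for Borel but not for Lebesgue measurable
  functions.\<close>

definition borel_unif_loc :: "real \<Rightarrow> (real \<Rightarrow> complex) \<Rightarrow> (real \<Rightarrow> complex) \<Rightarrow> bool" where
  "borel_unif_loc M \<Gamma> \<gamma> \<longleftrightarrow> M \<ge> 0 \<and> \<Gamma> \<in> borel_measurable borel \<and> \<gamma> \<in> borel_measurable borel \<and>
     (\<forall>x. (\<integral>\<^sup>+t\<in>{x..x+1}. ennreal ((cmod (\<Gamma> t))\<^sup>2 + cmod (\<gamma> t)) \<partial>lborel) \<le> ennreal M)"

lemma completion_ex_borel_measurable_complex:
  fixes f :: "'a \<Rightarrow> complex"
  assumes [measurable]: "f \<in> borel_measurable (completion M)"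
  shows "\<exists>f'\<in>borel_measurable M. AE x in M. f x = f' x"
proof -
  obtain r where [measurable]: "r \<in> borel_measurable M" and r: "AE x in M. Re (f x) = r x"
    using completion_ex_borel_measurable_real[of "\<lambda>x. Re (f x)" M] by auto
  obtain i where [measurable]: "i \<in> borel_measurable M" and i: "AE x in M. Im (f x) = i x"
    using completion_ex_borel_measurable_real[of "\<lambda>x. Im (f x)" M] by auto
  have "AE x in M. f x = Complex (r x) (i x)"
    using r i by eventually_elim (simp add: complex_eq_iff)
  moreover have "(\<lambda>x. Complex (r x) (i x)) \<in> borel_measurable M"
    by (simp add: borel_measurable_complex_iff)
  ultimately show ?thesis
    by (rule bexI[of _ "\<lambda>x. Complex (r x) (i x)"])
qed

lemma dist_of_fun_lborel:
  assumes "f \<in> borel_measurable borel" "\<phi> \<in> borel_measurable borel"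
  shows "dist_of_fun f \<phi> = (LINT x|lborel. f x * \<phi> x)"
  unfolding dist_of_fun_def using assms by (intro integral_completion) simp

lemma dist_of_fun_AE:
  assumes "AE x in lborel. f x = f' x"
    and [measurable]: "f \<in> borel_measurable lebesgue" "f' \<in> borel_measurable borel" "\<phi> \<in> borel_measurable borel"
  shows "dist_of_fun f \<phi> = (LINT x|lborel. f' x * \<phi> x)"
proof -
  have [measurable]: "\<phi> \<in> borel_measurable lebesgue" "f' \<in> borel_measurable lebesgue"
    by (auto intro!: measurable_completion)
  have "AE x in lebesgue. f x = f' x"
    using assms(1) by (rule AE_completion)
  then have "dist_of_fun f \<phi> = (LINT x|lebesgue. f' x * \<phi> x)"
    unfolding dist_of_fun_def by (intro integral_cong_AE) auto
  then show ?thesis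
    by (simp add: integral_completion)
qed

text \<open>Changing both functions on a null set affects neither the window integrals nor the
  induced functionals.\<close>

lemma unif_loc_bound_imp_borel:
  assumes "unif_loc_bound \<Gamma> \<gamma>"
  obtains M \<Gamma>' \<gamma>' where "borel_unif_loc M \<Gamma>' \<gamma>'"
    "\<And>\<phi>. \<phi> \<in> borel_measurable borel \<Longrightarrow> dist_of_fun \<Gamma> \<phi> = (LINT x|lborel. \<Gamma>' x * \<phi> x)"
    "\<And>\<phi>. \<phi> \<in> borel_measurable borel \<Longrightarrow> dist_of_fun \<gamma> \<phi> = (LINT x|lborel. \<gamma>' x * \<phi> x)"
proof -
  let ?I = "\<lambda>x. \<integral>\<^sup>+t\<in>{x..x+1}. ennreal ((cmod (\<Gamma> t))\<^sup>2 + cmod (\<gamma> t)) \<partial>lebesgue"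
  have meas: "\<Gamma> \<in> borel_measurable lebesgue" "\<gamma> \<in> borel_measurable lebesgue"
    and fin: "(SUP x::real. ?I x) < \<infinity>"
    using assms unfolding unif_loc_bound_def by blast+
  obtain \<Gamma>' where G: "\<Gamma>' \<in> borel_measurable borel" "AE x in lborel. \<Gamma> x = \<Gamma>' x"
    using completion_ex_borel_measurable_complex[OF meas(1)] by auto
  obtain \<gamma>' where g: "\<gamma>' \<in> borel_measurable borel" "AE x in lborel. \<gamma> x = \<gamma>' x"
    using completion_ex_borel_measurable_complex[OF meas(2)] by auto
  obtain M where M: "M \<ge> 0" "(SUP x::real. ?I x) = ennreal M"
    using fin unfolding infinity_ennreal_def less_top_ennreal by blast
  have "(\<integral>\<^sup>+t\<in>{x..x+1}. ennreal ((cmod (\<Gamma>' t))\<^sup>2 + cmod (\<gamma>' t)) \<partial>lborel) = ?I x" for x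
    unfolding nn_integral_completion using G(2) g(2) by (intro nn_integral_cong_AE) auto
  moreover have "?I x \<le> ennreal M" for x
    unfolding M(2)[symmetric] by (rule SUP_upper) simp
  ultimately have "borel_unif_loc M \<Gamma>' \<gamma>'"
    using M(1) G(1) g(1) unfolding borel_unif_loc_def by simp
  then show thesis
    by (rule that) (rule dist_of_fun_AE[OF G(2) meas(1) G(1)], assumption,
      rule dist_of_fun_AE[OF g(2) meas(2) g(1)], assumption)
qed

lemma borel_unif_loc_imp_unif_loc_bound:
  assumes "borel_unif_loc M \<Gamma> \<gamma>"
  shows "unif_loc_bound \<Gamma> \<gamma>"
proof -
  have "(SUP x::real. \<integral>\<^sup>+t\<in>{x..x+1}. ennreal ((cmod (\<Gamma> t))\<^sup>2 + cmod (\<gamma> t)) \<partial>lebesgue) \<le> ennreal M"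
    unfolding nn_integral_completion using assms by (intro SUP_least) (auto simp: borel_unif_loc_def)
  also have "ennreal M < \<infinity>"
    by simp
  finally show ?thesis
    using assms unfolding unif_loc_bound_def borel_unif_loc_def
    by (intro conjI measurable_completion) simp_all
qed

lemma borel_unif_locD:
  assumes "borel_unif_loc M \<Gamma> \<gamma>"
  shows "(\<integral>\<^sup>+t\<in>{x..x+1}. ennreal ((cmod (\<Gamma> t))\<^sup>2) \<partial>lborel) \<le> ennreal M"
    and "(\<integral>\<^sup>+t\<in>{x..x+1}. ennreal (cmod (\<gamma> t)) \<partial>lborel) \<le> ennreal M"
    and "(\<integral>\<^sup>+t\<in>{x..x+1}. ennreal (cmod (\<Gamma> t)) \<partial>lborel) \<le> ennreal (M + 1)"
proof -
  have *: "(\<integral>\<^sup>+t\<in>{x..x+1}. ennreal ((cmod (\<Gamma> t))\<^sup>2 + cmod (\<gamma> t)) \<partial>lborel) \<le> ennreal M"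
    and [measurable]: "\<Gamma> \<in> borel_measurable borel" "\<gamma> \<in> borel_measurable borel" and "M \<ge> 0"
    using assms by (auto simp: borel_unif_loc_def)
  show 1: "(\<integral>\<^sup>+t\<in>{x..x+1}. ennreal ((cmod (\<Gamma> t))\<^sup>2) \<partial>lborel) \<le> ennreal M"
    by (rule order_trans[OF nn_integral_mono *]) (auto simp: indicator_def intro!: ennreal_leI)
  show "(\<integral>\<^sup>+t\<in>{x..x+1}. ennreal (cmod (\<gamma> t)) \<partial>lborel) \<le> ennreal M"
    by (rule order_trans[OF nn_integral_mono *]) (auto simp: indicator_def intro!: ennreal_leI)
  \<comment> \<open>This replaces Cauchy-Schwarz on a unit interval, whose length 1 turns the extra
    constant into the 1 of \<open>M + 1\<close>.\<close>
  have "ennreal c \<le> ennreal (c\<^sup>2) + 1" for c :: real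
  proof -
    have "c \<le> c\<^sup>2 + 1"
      using zero_le_power2[of "c - 1/2"] by (simp add: power2_eq_square algebra_simps)
    then have "ennreal c \<le> ennreal (c\<^sup>2 + 1)"
      by (rule ennreal_leI)
    then show ?thesis
      by (simp add: ennreal_plus)
  qed
  then have "(\<integral>\<^sup>+t\<in>{x..x+1}. ennreal (cmod (\<Gamma> t)) \<partial>lborel)
      \<le> (\<integral>\<^sup>+t. ennreal ((cmod (\<Gamma> t))\<^sup>2) * indicator {x..x+1} t + indicator {x..x+1} t \<partial>lborel)"
    by (intro nn_integral_mono) (auto simp: indicator_def)
  also have "\<dots> \<le> ennreal M + 1"
    using 1 by (subst nn_integral_add) (auto intro!: add_mono)
  also have "\<dots> = ennreal (M + 1)"
    using \<open>M \<ge> 0\<close> by (simp add: ennreal_plus)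
  finally show "(\<integral>\<^sup>+t\<in>{x..x+1}. ennreal (cmod (\<Gamma> t)) \<partial>lborel) \<le> ennreal (M + 1)" .
qed

section \<open>Energy estimates\<close>

text \<open>The squared L2 norm; no derivative is built in, so the Dirichlet energy of
  \<open>u\<close> is \<open>energy (vderiv u)\<close>.\<close>

definition energy :: "(real \<Rightarrow> complex) \<Rightarrow> real" where
  "energy u = (LINT x|lborel. (cmod (u x))\<^sup>2)"

lemma energy_nonneg: "energy u \<ge> 0"
  by (simp add: energy_def)

lemma test_sq_integrable:
  assumes "u \<in> test_functions"
  shows "integrable lborel (\<lambda>x. (cmod (u x))\<^sup>2)"
  using integrable_Re[OF test_integrable[OF test_norm_sq(1)[OF assms]]] by simp

lemma nn_integral_energy:
  assumes "u \<in> test_functions"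
  shows "(\<integral>\<^sup>+x. ennreal ((cmod (u x))\<^sup>2) \<partial>lborel) = ennreal (energy u)"
  unfolding energy_def by (intro nn_integral_eq_integral test_sq_integrable assms) simp

lemma L2_norm_sq:
  assumes "u \<in> borel_measurable borel"
  shows "(L2_norm u)\<^sup>2 = energy u"
proof -
  have [measurable]: "u \<in> borel_measurable borel" by fact
  have "L2_norm u = sqrt (energy u)"
    unfolding L2_norm_def energy_def by (simp add: integral_completion)
  then show ?thesis
    by (simp add: energy_nonneg)
qed

lemma L2_norm_sq_test: "u \<in> test_functions \<Longrightarrow> (L2_norm u)\<^sup>2 = energy u"
  by (intro L2_norm_sq smooth_measurable test_smooth)

lemma L2_norm_nonneg: "L2_norm u \<ge> 0"
  by (simp add: L2_norm_def)

lemma two_mult_le_weighted: "0 < e \<Longrightarrow> 2 * a * b \<le> e * a\<^sup>2 + b\<^sup>2 / (e::real)"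
  using zero_le_power2[of "e * a - b"] by (simp add: field_simps power2_eq_square)

lemma norm_sq_has_derivative:
  assumes "smooth u"
  shows "((\<lambda>x. (cmod (u x))\<^sup>2) has_real_derivative 2 * Re (cnj (u x) * vderiv u x)) (at x)"
proof -
  have "((\<lambda>x. Re (u x * cnj (u x))) has_vector_derivative Re (u x * cnj (vderiv u x) + vderiv u x * cnj (u x))) (at x)"
    by (intro bounded_linear.has_vector_derivative[OF bounded_linear_Re] has_vector_derivative_mult
         has_vector_derivative_cnj smooth_has_vderiv assms)
  moreover have "Re (u x * cnj (u x)) = (cmod (u x))\<^sup>2" for x
    by (simp add: complex_mult_cnj cmod_power2)
  ultimately show ?thesis
    by (simp add: has_real_derivative_iff_has_vector_derivative algebra_simps)
qed

text \<open>The integrand on the right dominates the absolute derivative of |u|^2. With a primitive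
  \<open>H\<close> of it, |u|^2 - H is nonincreasing and |u|^2 + H nondecreasing, which treats the
  two orders of \<open>x\<close> and \<open>y\<close> by monotonicity alone.\<close>

lemma norm_sq_le_norm_sq_plus:
  assumes u: "smooth u" and x: "x \<in> {a..b}" and y: "y \<in> {a..b}" and e: "\<epsilon> > 0"
  shows "ennreal ((cmod (u x))\<^sup>2) \<le> ennreal ((cmod (u y))\<^sup>2) +
    (\<integral>\<^sup>+s\<in>{a..b}. ennreal (\<epsilon> * (cmod (vderiv u s))\<^sup>2 + (cmod (u s))\<^sup>2 / \<epsilon>) \<partial>lborel)"
proof -
  define G where "G s = \<epsilon> * (cmod (vderiv u s))\<^sup>2 + (cmod (u s))\<^sup>2 / \<epsilon>" for s
  have G0: "G s \<ge> 0" for s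
    using e by (simp add: G_def)
  have cont: "continuous_on UNIV G"
    unfolding G_def using e by (intro continuous_intros smooth_continuous smooth_vderiv u) auto
  then obtain H where H: "\<And>x. (H has_real_derivative G x) (at x)"
    using antiderivative_exists[of G] by (auto simp: has_real_derivative_iff_has_vector_derivative)
  let ?f = "\<lambda>x. (cmod (u x))\<^sup>2"
  let ?f' = "\<lambda>x. 2 * Re (cnj (u x) * vderiv u x)"
  have f'G: "\<bar>?f' s\<bar> \<le> G s" for s
  proof -
    have "\<bar>?f' s\<bar> \<le> 2 * cmod (vderiv u s) * cmod (u s)"
      using abs_Re_le_cmod[of "cnj (u s) * vderiv u s"] by (simp add: norm_mult mult.commute)
    also have "\<dots> \<le> G s"
      unfolding G_def by (rule two_mult_le_weighted[OF e])
    finally show ?thesis .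
  qed
  have Hmono: "H s \<le> H t" if "s \<le> t" for s t
    by (rule DERIV_nonneg_imp_nondecreasing[OF that]) (use H G0 in blast)
  have "?f x - ?f y \<le> H b - H a"
  proof (cases "y \<le> x")
    case True
    have "?f x - H x \<le> ?f y - H y"
    proof (rule DERIV_nonpos_imp_nonincreasing[OF True])
      fix s
      have "((\<lambda>x. ?f x - H x) has_real_derivative ?f' s - G s) (at s)"
        by (intro DERIV_diff norm_sq_has_derivative u H)
      then show "\<exists>d. ((\<lambda>x. ?f x - H x) has_real_derivative d) (at s) \<and> d \<le> 0"
        using f'G[of s] by (intro exI[of _ "?f' s - G s"]) linarith
    qed
    then show ?thesis
      using Hmono[of a y] Hmono[of x b] x y by auto
  next
    case False
    then have "x \<le> y" by simp
    then have "?f x + H x \<le> ?f y + H y"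
    proof (rule DERIV_nonneg_imp_nondecreasing)
      fix s
      have "((\<lambda>x. ?f x + H x) has_real_derivative ?f' s + G s) (at s)"
        by (intro DERIV_add norm_sq_has_derivative u H)
      then show "\<exists>d. ((\<lambda>x. ?f x + H x) has_real_derivative d) (at s) \<and> d \<ge> 0"
        using f'G[of s] by (intro exI[of _ "?f' s + G s"]) linarith
    qed
    then show ?thesis
      using Hmono[of a x] Hmono[of y b] x y by auto
  qed
  moreover have "(\<integral>\<^sup>+s\<in>{a..b}. ennreal (G s) \<partial>lborel) = ennreal (H b - H a)"
    by (rule nn_integral_FTC_Icc)
       (use cont G0 H x in \<open>auto intro: borel_measurable_continuous_onI has_vector_derivative_at_within
          simp flip: has_real_derivative_iff_has_vector_derivative\<close>)
  ultimately have "ennreal (?f x) \<le> ennreal (?f y + (H b - H a))"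
    by (intro ennreal_leI) simp
  also have "\<dots> = ennreal (?f y) + ennreal (H b - H a)"
    using Hmono[of a b] x by (intro ennreal_plus) auto
  finally show ?thesis
    using \<open>(\<integral>\<^sup>+s\<in>{a..b}. ennreal (G s) \<partial>lborel) = ennreal (H b - H a)\<close> by (simp add: G_def)
qed

lemma nn_integral_weight_norm_sq_le:
  assumes [measurable]: "w \<in> borel_measurable borel"
    and M: "\<And>x. (\<integral>\<^sup>+t\<in>{x..x+1}. w t \<partial>lborel) \<le> M"
    and u: "u \<in> test_functions" and e: "\<epsilon> > 0"
  shows "(\<integral>\<^sup>+x. w x * ennreal ((cmod (u x))\<^sup>2) \<partial>lborel)
     \<le> M * ennreal (\<epsilon> * energy (vderiv u) + (1 + 1 / \<epsilon>) * energy u)"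
proof -
  have [measurable]: "u \<in> borel_measurable borel" "vderiv u \<in> borel_measurable borel"
    using u by (auto intro: smooth_measurable smooth_vderiv_measurable test_smooth)
  let ?G = "\<lambda>s. ennreal (\<epsilon> * (cmod (vderiv u s))\<^sup>2 + (cmod (u s))\<^sup>2 / \<epsilon>)"
  let ?g = "\<lambda>s. ennreal ((cmod (u s))\<^sup>2) + ?G s"
  have "(\<integral>\<^sup>+x. w x * ennreal ((cmod (u x))\<^sup>2) \<partial>lborel) \<le> M * (\<integral>\<^sup>+s. ?g s \<partial>lborel)"
  proof (rule nn_integral_unif_loc)
    fix x
    let ?c = "\<integral>\<^sup>+s\<in>{x..x+1}. ?G s \<partial>lborel"
    \<comment> \<open>A unit interval has mass 1, so the left side equals its own average in y, and
      so does the constant \<open>?c\<close>. Averaging contributes the 1 in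
      \<open>1 + 1 / \<epsilon>\<close>.\<close>
    have "ennreal ((cmod (u x))\<^sup>2) = (\<integral>\<^sup>+y\<in>{x..x+1}. ennreal ((cmod (u x))\<^sup>2) \<partial>lborel)"
      by (subst nn_integral_cmult_indicator) auto
    also have "\<dots> \<le> (\<integral>\<^sup>+y\<in>{x..x+1}. (ennreal ((cmod (u y))\<^sup>2) + ?c) \<partial>lborel)"
      using norm_sq_le_norm_sq_plus[OF test_smooth[OF u], of x x "x+1" _ \<epsilon>] e
      by (intro nn_integral_mono) (auto simp: indicator_def)
    also have "\<dots> = (\<integral>\<^sup>+y\<in>{x..x+1}. ennreal ((cmod (u y))\<^sup>2) \<partial>lborel) + ?c"
      by (simp add: distrib_right nn_integral_add nn_integral_cmult)
    also have "\<dots> = (\<integral>\<^sup>+s\<in>{x..x+1}. ?g s \<partial>lborel)"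
      by (simp add: distrib_right nn_integral_add)
    finally show "ennreal ((cmod (u x))\<^sup>2) \<le> \<dots>" .
  qed (use M in auto)
  also have "(\<integral>\<^sup>+s. ?g s \<partial>lborel) = (\<integral>\<^sup>+s. ennreal ((1 + 1 / \<epsilon>)) * ennreal ((cmod (u s))\<^sup>2) + ennreal \<epsilon> * ennreal ((cmod (vderiv u s))\<^sup>2) \<partial>lborel)"
    using e by (intro nn_integral_cong) (simp add: ennreal_plus[symmetric] ennreal_mult[symmetric] algebra_simps del: ennreal_plus)
  also have "\<dots> = ennreal ((1 + 1 / \<epsilon>)) * ennreal (energy u) + ennreal \<epsilon> * ennreal (energy (vderiv u))"
    by (simp add: nn_integral_add nn_integral_cmult nn_integral_energy u test_vderiv)
  also have "\<dots> = ennreal (\<epsilon> * energy (vderiv u) + (1 + 1 / \<epsilon>) * energy u)"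
    using e by (simp add: ennreal_plus[symmetric] ennreal_mult[symmetric] energy_nonneg algebra_simps del: ennreal_plus)
  finally show ?thesis .
qed

text \<open>This holds without integrability because the Bochner integral of a non-integrable
  function is 0; later estimates can therefore be done entirely with nonnegative integrals.\<close>

lemma norm_integral_le_nn_integral:
  fixes f :: "'a \<Rightarrow> 'b::{banach, second_countable_topology}"
  shows "ennreal (norm (integral\<^sup>L M f)) \<le> (\<integral>\<^sup>+x. ennreal (norm (f x)) \<partial>M)"
  by (cases "integrable M f") (auto intro: integral_norm_bound_ennreal simp: not_integrable_integral_eq)

lemma form_bound_of_representation:
  assumes G: "borel_unif_loc M \<Gamma> \<gamma>" and e: "\<epsilon> > 0"
  shows "\<exists>C>0. \<forall>u\<in>test_functions.
     cmod (- (LINT x|lborel. \<Gamma> x * vderiv (\<lambda>x. complex_of_real ((cmod (u x))\<^sup>2)) x)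
         + (LINT x|lborel. \<gamma> x * complex_of_real ((cmod (u x))\<^sup>2)))
       \<le> \<epsilon> * energy (vderiv u) + C * energy u"
proof -
  \<comment> \<open>\<open>K\<close> is the factor of the weighted integral left by the first
    application of the weighted inequality, times the uniform bound; \<delta> is chosen so that
    \<open>K * \<delta>\<close> takes at most the second half of \<epsilon>. The
    \<open>K + 1\<close> avoids division by zero.\<close>
  define K where "K = (2 / \<epsilon> + 1) * M"
  define \<delta> where "\<delta> = \<epsilon> / (2 * (K + 1))"
  have M: "M \<ge> 0" and [measurable]: "\<Gamma> \<in> borel_measurable borel" "\<gamma> \<in> borel_measurable borel"
    and w: "\<And>x. (\<integral>\<^sup>+t\<in>{x..x+1}. ennreal ((cmod (\<Gamma> t))\<^sup>2 + cmod (\<gamma> t)) \<partial>lborel) \<le> ennreal M"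
    using G by (auto simp: borel_unif_loc_def)
  have K: "K \<ge> 0"
    using M e by (simp add: K_def)
  have \<delta>: "\<delta> > 0" "K * \<delta> \<le> \<epsilon> / 2"
    using K e by (simp_all add: \<delta>_def field_simps)
  show ?thesis
  \<comment> \<open>The added 1 makes the constant strictly positive even when \<open>K\<close> is
    0.\<close>
  proof (intro exI[of _ "K * (1 + 1 / \<delta>) + 1"] conjI ballI)
    show "K * (1 + 1 / \<delta>) + 1 > 0"
      using K \<delta> by (intro add_nonneg_pos mult_nonneg_nonneg) auto
    fix u assume u: "u \<in> test_functions"
    let ?I = "LINT x|lborel. \<Gamma> x * vderiv (\<lambda>x. complex_of_real ((cmod (u x))\<^sup>2)) x"
    let ?J = "LINT x|lborel. \<gamma> x * complex_of_real ((cmod (u x))\<^sup>2)"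
    have [measurable]: "u \<in> borel_measurable borel" "vderiv u \<in> borel_measurable borel"
        "(\<lambda>x. cnj (u x)) \<in> borel_measurable borel"
      using u by (auto intro: smooth_measurable smooth_vderiv_measurable test_smooth smooth_cnj)
    let ?w = "\<lambda>x. ennreal ((cmod (\<Gamma> x))\<^sup>2 + cmod (\<gamma> x))"
    have "ennreal (cmod (- ?I + ?J)) \<le> ennreal (cmod ?I + cmod ?J)"
      using norm_triangle_ineq[of "- ?I" ?J] by (intro ennreal_leI) simp
    also have "\<dots> = ennreal (cmod ?I) + ennreal (cmod ?J)"
      by simp
    also have "\<dots> \<le> (\<integral>\<^sup>+x. ennreal (cmod (\<Gamma> x * vderiv (\<lambda>x. complex_of_real ((cmod (u x))\<^sup>2)) x)) \<partial>lborel) +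
        (\<integral>\<^sup>+x. ennreal (cmod (\<gamma> x * complex_of_real ((cmod (u x))\<^sup>2))) \<partial>lborel)"
      by (intro add_mono norm_integral_le_nn_integral)
    also have "\<dots> = (\<integral>\<^sup>+x. ennreal (cmod (\<Gamma> x * vderiv (\<lambda>x. complex_of_real ((cmod (u x))\<^sup>2)) x))
        + ennreal (cmod (\<gamma> x * complex_of_real ((cmod (u x))\<^sup>2))) \<partial>lborel)"
      unfolding test_norm_sq(2)[OF u] by (rule nn_integral_add[symmetric]) auto
    also have "\<dots> \<le> (\<integral>\<^sup>+x. ennreal (\<epsilon> / 2) * ennreal ((cmod (vderiv u x))\<^sup>2)
        + ennreal (2 / \<epsilon> + 1) * (?w x * ennreal ((cmod (u x))\<^sup>2)) \<partial>lborel)"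
    proof (intro nn_integral_mono)
      fix x
      let ?g = "cmod (\<Gamma> x)" and ?a = "cmod (u x)" and ?b = "cmod (vderiv u x)"
      have "\<bar>Re (cnj (u x) * vderiv u x)\<bar> \<le> ?a * ?b"
        using abs_Re_le_cmod[of "cnj (u x) * vderiv u x"] by (simp add: norm_mult)
      then have "?g * \<bar>2 * Re (cnj (u x) * vderiv u x)\<bar> \<le> ?g * (2 * (?a * ?b))"
        by (intro mult_left_mono) auto
      also have "\<dots> = 2 * ?b * (?g * ?a)"
        by simp
      \<comment> \<open>The derivative gets weight \<epsilon>/2, the first half of the budget; the
        rest is |u|^2 against the weight |\<Gamma>|^2.\<close>
      also have "\<dots> \<le> (\<epsilon> / 2) * ?b\<^sup>2 + (?g * ?a)\<^sup>2 / (\<epsilon> / 2)"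
        using e by (intro two_mult_le_weighted) simp
      finally have "?g * \<bar>2 * Re (cnj (u x) * vderiv u x)\<bar> + cmod (\<gamma> x) * ?a\<^sup>2
          \<le> (\<epsilon> / 2) * ?b\<^sup>2 + (2 / \<epsilon>) * ?g\<^sup>2 * ?a\<^sup>2 + cmod (\<gamma> x) * ?a\<^sup>2"
        by (simp add: power_mult_distrib)
      also have "\<dots> \<le> (\<epsilon> / 2) * ?b\<^sup>2 + (2 / \<epsilon> + 1) * ((?g\<^sup>2 + cmod (\<gamma> x)) * ?a\<^sup>2)"
        using e by (simp add: algebra_simps)
      finally have "ennreal (?g * \<bar>2 * Re (cnj (u x) * vderiv u x)\<bar> + cmod (\<gamma> x) * ?a\<^sup>2) \<le> 
          ennreal ((\<epsilon> / 2) * ?b\<^sup>2 + (2 / \<epsilon> + 1) * ((?g\<^sup>2 + cmod (\<gamma> x)) * ?a\<^sup>2))"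
        by (rule ennreal_leI)
      then show "ennreal (cmod (\<Gamma> x * vderiv (\<lambda>x. complex_of_real ((cmod (u x))\<^sup>2)) x))
        + ennreal (cmod (\<gamma> x * complex_of_real ((cmod (u x))\<^sup>2)))
        \<le> ennreal (\<epsilon> / 2) * ennreal (?b\<^sup>2) + ennreal (2 / \<epsilon> + 1) * (?w x * ennreal (?a\<^sup>2))"
        unfolding test_norm_sq(2)[OF u] using e
        by (simp only: norm_mult norm_of_real abs_power2 ennreal_plus[symmetric] ennreal_mult[symmetric]
             mult_nonneg_nonneg zero_le_power2 norm_ge_zero abs_ge_zero add_nonneg_nonneg divide_nonneg_nonneg
             order_less_imp_le zero_le_numeral zero_le_one)
    qed
    also have "\<dots> = ennreal (\<epsilon> / 2) * ennreal (energy (vderiv u))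
        + ennreal (2 / \<epsilon> + 1) * (\<integral>\<^sup>+x. ?w x * ennreal ((cmod (u x))\<^sup>2) \<partial>lborel)"
      by (simp add: nn_integral_add nn_integral_cmult nn_integral_energy u test_vderiv del: ennreal_plus)
    also have "\<dots> \<le> ennreal (\<epsilon> / 2) * ennreal (energy (vderiv u))
        + ennreal (2 / \<epsilon> + 1) * (ennreal M * ennreal (\<delta> * energy (vderiv u) + (1 + 1 / \<delta>) * energy u))"
      by (intro add_left_mono mult_left_mono nn_integral_weight_norm_sq_le u \<delta> w) auto
    also have "\<dots> = ennreal ((\<epsilon> / 2) * energy (vderiv u) + (2 / \<epsilon> + 1) * (M * (\<delta> * energy (vderiv u) + (1 + 1 / \<delta>) * energy u)))"
      using e M \<delta> by (simp add: ennreal_plus[symmetric] ennreal_mult[symmetric] energy_nonneg del: ennreal_plus)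
    finally have "cmod (- ?I + ?J) \<le> (\<epsilon> / 2) * energy (vderiv u) + (2 / \<epsilon> + 1) * (M * (\<delta> * energy (vderiv u) + (1 + 1 / \<delta>) * energy u))"
      by (subst (asm) ennreal_le_iff) (use e M \<delta> in \<open>auto intro!: add_nonneg_nonneg mult_nonneg_nonneg simp: energy_nonneg\<close>)
    also have "\<dots> = (\<epsilon> / 2) * energy (vderiv u) + K * \<delta> * energy (vderiv u) + K * (1 + 1 / \<delta>) * energy u"
      using e \<delta>(1) by (simp add: K_def field_simps)
    also have "\<dots> \<le> (\<epsilon> / 2) * energy (vderiv u) + (\<epsilon> / 2) * energy (vderiv u) + (K * (1 + 1 / \<delta>) + 1) * energy u"
      using \<delta> by (intro add_mono mult_right_mono energy_nonneg) auto
    finally show "cmod (- ?I + ?J) \<le> \<epsilon> * energy (vderiv u) + (K * (1 + 1 / \<delta>) + 1) * energy u"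
      by simp
  qed
qed

lemma inf_form_bounded_imp_form_bounded:
  assumes "inf_form_bounded Q"
  shows "form_bounded Q"
proof -
  obtain C where C: "C > 0" "\<And>u. u \<in> test_functions \<Longrightarrow>
      cmod (quad_form Q u) \<le> 1 * (L2_norm (vderiv u))\<^sup>2 + C * (L2_norm u)\<^sup>2"
    using assms unfolding inf_form_bounded_def by (metis zero_less_one)
  have "cmod (quad_form Q u) \<le> (1 + C) * (W12_norm u)\<^sup>2" if u: "u \<in> test_functions" for u
  proof -
    have "1 * (L2_norm (vderiv u))\<^sup>2 + C * (L2_norm u)\<^sup>2 \<le> (1 + C) * ((L2_norm (vderiv u))\<^sup>2 + (L2_norm u)\<^sup>2)"
      using C(1) by (simp add: algebra_simps)
    also have "\<dots> \<le> (1 + C) * (W12_norm u)\<^sup>2"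
      using C(1) by (intro mult_left_mono) (auto simp: W12_norm_def power2_sum L2_norm_nonneg)
    finally show ?thesis
      using C(2)[OF u] by linarith
  qed
  then show ?thesis
    unfolding form_bounded_def by blast
qed

lemma representation_imp_inf_form_bounded:
  assumes ul: "unif_loc_bound \<Gamma> \<gamma>"
    and Q: "\<forall>\<phi>\<in>test_functions. Q \<phi> = dist_deriv (dist_of_fun \<Gamma>) \<phi> + dist_of_fun \<gamma> \<phi>"
  shows "inf_form_bounded Q"
proof -
  obtain M \<Gamma>' \<gamma>' where b: "borel_unif_loc M \<Gamma>' \<gamma>'"
    "\<And>\<phi>. \<phi> \<in> borel_measurable borel \<Longrightarrow> dist_of_fun \<Gamma> \<phi> = (LINT x|lborel. \<Gamma>' x * \<phi> x)"
    "\<And>\<phi>. \<phi> \<in> borel_measurable borel \<Longrightarrow> dist_of_fun \<gamma> \<phi> = (LINT x|lborel. \<gamma>' x * \<phi> x)"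
    using unif_loc_bound_imp_borel[OF ul] by blast
  have "quad_form Q u = - (LINT x|lborel. \<Gamma>' x * vderiv (\<lambda>x. complex_of_real ((cmod (u x))\<^sup>2)) x)
         + (LINT x|lborel. \<gamma>' x * complex_of_real ((cmod (u x))\<^sup>2))" if u: "u \<in> test_functions" for u
    unfolding quad_form_def Q[rule_format, OF test_norm_sq(1)[OF u]] dist_deriv_def
    using test_norm_sq(1)[OF u]
    by (simp only: b smooth_measurable smooth_vderiv_measurable test_smooth)
  then show ?thesis
    unfolding inf_form_bounded_def using form_bound_of_representation[OF b(1)]
    by (simp add: L2_norm_sq_test test_vderiv)
qed

section \<open>Pairing with functions that need not have compact support\<close>

lemma distribution_add:
  "distribution Q \<Longrightarrow> \<phi> \<in> test_functions \<Longrightarrow> \<psi> \<in> test_functions \<Longrightarrow> Q (\<lambda>x. \<phi> x + \<psi> x) = Q \<phi> + Q \<psi>"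
  unfolding distribution_def by blast

lemma distribution_cmult:
  "distribution Q \<Longrightarrow> \<phi> \<in> test_functions \<Longrightarrow> Q (\<lambda>x. c * \<phi> x) = c * Q \<phi>"
  unfolding distribution_def by blast

lemma distribution_diff:
  "distribution Q \<Longrightarrow> \<phi> \<in> test_functions \<Longrightarrow> \<psi> \<in> test_functions \<Longrightarrow> Q (\<lambda>x. \<phi> x - \<psi> x) = Q \<phi> - Q \<psi>"
  using distribution_add[of Q \<phi> "\<lambda>x. (-1) * \<psi> x"] distribution_cmult[of Q \<psi> "-1"] test_cmult[of \<psi> "-1"]
  by simp

lemma distribution_zero: "distribution Q \<Longrightarrow> Q (\<lambda>x. 0) = 0"
  using distribution_cmult[of Q "\<lambda>x. 0" 0] test_zero by simp

lemma distribution_sum: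
  assumes "distribution Q" "\<And>i. i \<in> I \<Longrightarrow> f i \<in> test_functions"
  shows "Q (\<lambda>x. \<Sum>i\<in>I. f i x) = (\<Sum>i\<in>I. Q (f i))"
proof -
  have "(\<lambda>x. \<Sum>i\<in>I. f i x) \<in> test_functions \<and> Q (\<lambda>x. \<Sum>i\<in>I. f i x) = (\<Sum>i\<in>I. Q (f i))"
    using assms(2)
    by (induction I rule: infinite_finite_induct)
       (auto simp: test_zero distribution_zero[OF assms(1)] test_add distribution_add[OF assms(1)])
  then show ?thesis by blast
qed

lemma approx_unitD:
  assumes "approx_unit \<eta>"
  shows "\<eta> n \<in> test_functions"
    and "\<forall>\<^sub>F n in sequentially. \<forall>x. \<bar>x\<bar> \<le> R \<longrightarrow> \<eta> n x = 1"
    and "\<exists>B. \<forall>n x. cmod ((vderiv ^^ k) (\<eta> n) x) \<le> B"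
proof -
  have "compact {-R..R}" by simp
  then have "\<forall>\<^sub>F n in sequentially. \<forall>x\<in>{-R..R}. \<eta> n x = 1"
    using assms unfolding approx_unit_def by blast
  then show "\<forall>\<^sub>F n in sequentially. \<forall>x. \<bar>x\<bar> \<le> R \<longrightarrow> \<eta> n x = 1"
    by eventually_elim (auto simp: abs_le_iff)
  show "\<eta> n \<in> test_functions" "\<exists>B. \<forall>n x. cmod ((vderiv ^^ k) (\<eta> n) x) \<le> B"
    using assms unfolding approx_unit_def by blast+
qed

lemma approx_unit_tendsto:
  assumes "approx_unit \<eta>"
  shows "(\<lambda>n. \<eta> n x) \<longlonglongrightarrow> 1" "(\<lambda>n. vderiv (\<eta> n) x) \<longlonglongrightarrow> 0"
proof -
  \<comment> \<open>Radius |x| + 1 gives the value 1 on a whole neighbourhood of x, which is what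
    kills the derivative there as well.\<close>
  have *: "\<forall>\<^sub>F n in sequentially. \<forall>y. \<bar>y\<bar> \<le> \<bar>x\<bar> + 1 \<longrightarrow> \<eta> n y = 1"
    using approx_unitD(2)[OF assms] .
  then have "\<forall>\<^sub>F n in sequentially. \<eta> n x = 1"
    by eventually_elim simp
  then show "(\<lambda>n. \<eta> n x) \<longlonglongrightarrow> 1"
    by (rule tendsto_eventually)
  from * have "\<forall>\<^sub>F n in sequentially. vderiv (\<eta> n) x = 0"
  proof eventually_elim
    case (elim n)
    show ?case
      by (rule vderiv_eq_0[of "{y. \<bar>y\<bar> < \<bar>x\<bar> + 1}" _ _ 1])
         (use elim in \<open>auto intro!: open_Collect_less continuous_intros\<close>)
  qed
  then show "(\<lambda>n. vderiv (\<eta> n) x) \<longlonglongrightarrow> 0"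
    by (rule tendsto_eventually)
qed

lemma has_pairing_test:
  assumes "\<psi> \<in> test_functions"
  shows "has_pairing Q \<psi> (Q \<psi>)"
  unfolding has_pairing_def
proof (intro allI impI)
  fix \<eta> assume \<eta>: "approx_unit \<eta>"
  obtain R where R: "\<And>x. R < \<bar>x\<bar> \<Longrightarrow> \<psi> x = 0"
    using assms test_functionE by blast
  have "\<forall>\<^sub>F n in sequentially. Q (\<lambda>t. \<eta> n t * \<psi> t) = Q \<psi>"
    using approx_unitD(2)[OF \<eta>, of R]
  proof eventually_elim
    case (elim n)
    have "\<eta> n t * \<psi> t = \<psi> t" for t
      using elim R[of t] by (cases "R < \<bar>t\<bar>") auto
    then have "(\<lambda>t. \<eta> n t * \<psi> t) = \<psi>" ..
    then show ?case by simp
  qed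
  then show "(\<lambda>n. Q (\<lambda>t. \<eta> n t * \<psi> t)) \<longlonglongrightarrow> Q \<psi>"
    by (rule tendsto_eventually)
qed

text \<open>Both values are limits of the same sequence once the pairing is evaluated along the
  concrete approximate unit built from cutoffs.\<close>

lemma has_pairing_unique: "has_pairing Q \<psi> c \<Longrightarrow> has_pairing Q \<psi> d \<Longrightarrow> c = d"
  unfolding has_pairing_def using approx_unit_cutoff LIMSEQ_unique by blast

lemma has_pairing_diff:
  assumes "distribution Q" "smooth \<psi>1" "smooth \<psi>2" "has_pairing Q \<psi>1 c1" "has_pairing Q \<psi>2 c2"
  shows "has_pairing Q (\<lambda>t. \<psi>1 t - \<psi>2 t) (c1 - c2)"
  unfolding has_pairing_def
proof (intro allI impI)
  fix \<eta> assume \<eta>: "approx_unit \<eta>"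
  have "Q (\<lambda>t. \<eta> n t * (\<psi>1 t - \<psi>2 t)) = Q (\<lambda>t. \<eta> n t * \<psi>1 t) - Q (\<lambda>t. \<eta> n t * \<psi>2 t)" for n
    using distribution_diff[OF assms(1) test_mult_right[OF approx_unitD(1)[OF \<eta>] assms(2)]
       test_mult_right[OF approx_unitD(1)[OF \<eta>] assms(3)], of n n] by (simp add: algebra_simps)
  then show "(\<lambda>n. Q (\<lambda>t. \<eta> n t * (\<psi>1 t - \<psi>2 t))) \<longlonglongrightarrow> c1 - c2"
    using assms(4,5) \<eta> by (auto simp: has_pairing_def intro!: tendsto_diff)
qed

text \<open>Leibniz on \<eta> \<psi> gives a term with the derivative of \<eta>, which tends to 0
  pointwise and stays bounded. The uniform bounds on \<eta> and its derivative, times the three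
  integrable products, are the majorants for dominated convergence.\<close>

lemma has_pairing_representation:
  assumes [measurable]: "\<Gamma> \<in> borel_measurable borel" "\<gamma> \<in> borel_measurable borel"
    and Q: "\<And>\<phi>. \<phi> \<in> test_functions \<Longrightarrow> Q \<phi> = - (LINT x|lborel. \<Gamma> x * vderiv \<phi> x) + (LINT x|lborel. \<gamma> x * \<phi> x)"
    and \<psi>: "smooth \<psi>"
    and int: "integrable lborel (\<lambda>x. \<Gamma> x * \<psi> x)" "integrable lborel (\<lambda>x. \<Gamma> x * vderiv \<psi> x)"
      "integrable lborel (\<lambda>x. \<gamma> x * \<psi> x)"
  shows "has_pairing Q \<psi> (- (LINT x|lborel. \<Gamma> x * vderiv \<psi> x) + (LINT x|lborel. \<gamma> x * \<psi> x))"
  unfolding has_pairing_def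
proof (intro allI impI)
  fix \<eta> assume \<eta>: "approx_unit \<eta>"
  have test: "\<eta> n \<in> test_functions" for n
    using approx_unitD(1)[OF \<eta>] .
  have [measurable]: "\<psi> \<in> borel_measurable borel" "vderiv \<psi> \<in> borel_measurable borel"
     "\<eta> n \<in> borel_measurable borel" "vderiv (\<eta> n) \<in> borel_measurable borel" for n
    using \<psi> test_smooth[OF test] by (auto intro: smooth_measurable smooth_vderiv_measurable)
  obtain B0 where B0: "\<And>n x. cmod (\<eta> n x) \<le> B0"
    using approx_unitD(3)[OF \<eta>, of 0] by auto
  obtain B1 where B1: "\<And>n x. cmod (vderiv (\<eta> n) x) \<le> B1"
    using approx_unitD(3)[OF \<eta>, of 1] by auto
  let ?g = "\<lambda>n x. \<Gamma> x * (\<eta> n x * vderiv \<psi> x + vderiv (\<eta> n) x * \<psi> x)"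
  have "Q (\<lambda>t. \<eta> n t * \<psi> t) = - (LINT x|lborel. ?g n x) + (LINT x|lborel. \<gamma> x * (\<eta> n x * \<psi> x))" for n
    by (simp add: Q[OF test_mult_right[OF test \<psi>]] vderiv_mult test_smooth[OF test] \<psi>)
  moreover have "(\<lambda>n. LINT x|lborel. ?g n x) \<longlonglongrightarrow> (LINT x|lborel. \<Gamma> x * vderiv \<psi> x)"
  proof (rule integral_dominated_convergence[where w="\<lambda>x. B0 * cmod (\<Gamma> x * vderiv \<psi> x) + B1 * cmod (\<Gamma> x * \<psi> x)"])
    show "AE x in lborel. (\<lambda>n. ?g n x) \<longlonglongrightarrow> \<Gamma> x * vderiv \<psi> x"
    proof (rule AE_I2)
      fix x
      have "(\<lambda>n. ?g n x) \<longlonglongrightarrow> \<Gamma> x * (1 * vderiv \<psi> x + 0 * \<psi> x)"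
        by (intro tendsto_intros approx_unit_tendsto \<eta>)
      then show "(\<lambda>n. ?g n x) \<longlonglongrightarrow> \<Gamma> x * vderiv \<psi> x" by simp
    qed
    show "AE x in lborel. norm (?g n x) \<le> B0 * cmod (\<Gamma> x * vderiv \<psi> x) + B1 * cmod (\<Gamma> x * \<psi> x)" for n
    proof (rule AE_I2)
      fix x
      have "norm (?g n x) \<le> norm (\<eta> n x * (\<Gamma> x * vderiv \<psi> x)) + norm (vderiv (\<eta> n) x * (\<Gamma> x * \<psi> x))"
        by (rule order_trans[OF eq_refl norm_triangle_ineq]) (simp add: algebra_simps)
      also have "\<dots> \<le> B0 * cmod (\<Gamma> x * vderiv \<psi> x) + B1 * cmod (\<Gamma> x * \<psi> x)"
        unfolding norm_mult[of "\<eta> n x"] norm_mult[of "vderiv (\<eta> n) x"]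
        by (intro add_mono mult_right_mono B0 B1) auto
      finally show "norm (?g n x) \<le> \<dots>" .
    qed
    show "integrable lborel (\<lambda>x. B0 * cmod (\<Gamma> x * vderiv \<psi> x) + B1 * cmod (\<Gamma> x * \<psi> x))"
      using int by (intro Bochner_Integration.integrable_add integrable_mult_right integrable_norm)
  qed auto
  moreover have "(\<lambda>n. LINT x|lborel. \<gamma> x * (\<eta> n x * \<psi> x)) \<longlonglongrightarrow> (LINT x|lborel. \<gamma> x * \<psi> x)"
  proof (rule integral_dominated_convergence[where w="\<lambda>x. B0 * cmod (\<gamma> x * \<psi> x)"])
    show "AE x in lborel. (\<lambda>n. \<gamma> x * (\<eta> n x * \<psi> x)) \<longlonglongrightarrow> \<gamma> x * \<psi> x"
    proof (rule AE_I2)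
      fix x
      have "(\<lambda>n. \<gamma> x * (\<eta> n x * \<psi> x)) \<longlonglongrightarrow> \<gamma> x * (1 * \<psi> x)"
        by (intro tendsto_intros approx_unit_tendsto \<eta>)
      then show "(\<lambda>n. \<gamma> x * (\<eta> n x * \<psi> x)) \<longlonglongrightarrow> \<gamma> x * \<psi> x" by simp
    qed
    show "AE x in lborel. norm (\<gamma> x * (\<eta> n x * \<psi> x)) \<le> B0 * cmod (\<gamma> x * \<psi> x)" for n
    proof (rule AE_I2)
      fix x
      have "norm (\<gamma> x * (\<eta> n x * \<psi> x)) = norm (\<eta> n x) * norm (\<gamma> x * \<psi> x)"
        by (simp add: norm_mult)
      then show "norm (\<gamma> x * (\<eta> n x * \<psi> x)) \<le> B0 * cmod (\<gamma> x * \<psi> x)"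
        using mult_right_mono[OF B0, of "norm (\<gamma> x * \<psi> x)"] by simp
    qed
    show "integrable lborel (\<lambda>x. B0 * cmod (\<gamma> x * \<psi> x))"
      using int by (intro integrable_mult_right integrable_norm)
  qed auto
  ultimately show "(\<lambda>n. Q (\<lambda>t. \<eta> n t * \<psi> t)) \<longlonglongrightarrow> - (LINT x|lborel. \<Gamma> x * vderiv \<psi> x) + (LINT x|lborel. \<gamma> x * \<psi> x)"
    by (auto intro!: tendsto_intros)
qed

section \<open>Convolution with the exponential kernels\<close>

text \<open>The adjoint of convolution with \<open>k\<close>: integration runs over the first
  argument of the difference, and the result is a function of the variable on which the distribution
  acts.\<close>

definition kernel_transform :: "(real \<Rightarrow> real) \<Rightarrow> (real \<Rightarrow> complex) \<Rightarrow> real \<Rightarrow> complex" where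
  "kernel_transform k \<phi> t = (LINT x|lebesgue. complex_of_real (k (x - t)) * \<phi> x)"

abbreviation exp_kernel :: "real \<Rightarrow> real" where
  "exp_kernel \<equiv> (\<lambda>s. exp (- \<bar>s\<bar>))"

abbreviation sgn_exp_kernel :: "real \<Rightarrow> real" where
  "sgn_exp_kernel \<equiv> (\<lambda>s. sgn s * exp (- \<bar>s\<bar>))"

lemma kernel_transform_lborel:
  assumes [measurable]: "k \<in> borel_measurable borel" "\<phi> \<in> borel_measurable borel"
  shows "kernel_transform k \<phi> t = (LINT x|lborel. complex_of_real (k (x - t)) * \<phi> x)"
  unfolding kernel_transform_def by (rule integral_completion) simp

text \<open>Split at x = t, the kernel factors into exp t exp(-x) on the right and exp(-t) exp x on
  the left. Both transforms thus become explicit in primitives \<open>F\<close> and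
  \<open>G\<close>, with the same formula for all t in (-T, T), so no differentiation under the
  integral is needed.\<close>

lemma kernel_transform_exp:
  assumes smooth: "smooth \<phi>" and supp: "\<forall>x. R < \<bar>x\<bar> \<longrightarrow> \<phi> x = 0"
    and F: "\<And>x. (F has_vector_derivative complex_of_real (exp (- x)) * \<phi> x) (at x)"
    and G: "\<And>x. (G has_vector_derivative complex_of_real (exp x) * \<phi> x) (at x)"
    and t: "\<bar>t\<bar> < T" and R: "R \<le> T"
  shows "kernel_transform exp_kernel \<phi> t =
      complex_of_real (exp t) * (F T - F t) + complex_of_real (exp (- t)) * (G t - G (- T))"
    and "kernel_transform sgn_exp_kernel \<phi> t =
      complex_of_real (exp t) * (F T - F t) - complex_of_real (exp (- t)) * (G t - G (- T))"
proof -
  have [measurable]: "\<phi> \<in> borel_measurable borel"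
    using smooth by (rule smooth_measurable)
  let ?r = "\<lambda>x. indicator {t..T} x *\<^sub>R (complex_of_real (exp (- x)) * \<phi> x)"
  let ?l = "\<lambda>x. indicator {-T..t} x *\<^sub>R (complex_of_real (exp x) * \<phi> x)"
  have r: "has_bochner_integral lborel ?r (F T - F t)"
    using t F by (intro has_bochner_integral_FTC_Icc continuous_intros smooth_continuous smooth)
      (auto intro: has_vector_derivative_at_within)
  have l: "has_bochner_integral lborel ?l (G t - G (- T))"
    using t G by (intro has_bochner_integral_FTC_Icc continuous_intros smooth_continuous smooth)
      (auto intro: has_vector_derivative_at_within)
  \<comment> \<open>Both closed indicators contain t, so the pointwise identity can fail at x =
    t.\<close>
  have ae: "AE x in lborel. x \<noteq> t"
    by (rule AE_lborel_singleton)
  have e: "complex_of_real (exp (- \<bar>x - t\<bar>)) * \<phi> x = complex_of_real (exp t) * ?r x + complex_of_real (exp (- t)) * ?l x \<and>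
     complex_of_real (sgn (x - t) * exp (- \<bar>x - t\<bar>)) * \<phi> x = complex_of_real (exp t) * ?r x - complex_of_real (exp (- t)) * ?l x"
    if "x \<noteq> t" for x
  proof (cases "\<bar>x\<bar> \<le> T")
    case True
    then show ?thesis
      using that t
      by (cases "t < x") (auto simp: indicator_def exp_diff exp_minus field_simps)
  next
    case False
    then show ?thesis
      using supp R by auto
  qed
  have i1: "has_bochner_integral lborel (\<lambda>x. complex_of_real (exp t) * ?r x + complex_of_real (exp (- t)) * ?l x)
      (complex_of_real (exp t) * (F T - F t) + complex_of_real (exp (- t)) * (G t - G (- T)))"
    by (intro has_bochner_integral_add has_bochner_integral_mult_right r l)
  have k1: "kernel_transform exp_kernel \<phi> t = (LINT x|lborel. complex_of_real (exp t) * ?r x + complex_of_real (exp (- t)) * ?l x)"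
  proof (subst kernel_transform_lborel, simp, simp, rule integral_cong_AE)
    show "AE x in lborel. complex_of_real (exp (- \<bar>x - t\<bar>)) * \<phi> x = complex_of_real (exp t) * ?r x + complex_of_real (exp (- t)) * ?l x"
      using ae by eventually_elim (use e in blast)
  qed auto
  show "kernel_transform exp_kernel \<phi> t =
      complex_of_real (exp t) * (F T - F t) + complex_of_real (exp (- t)) * (G t - G (- T))"
    unfolding k1 by (rule has_bochner_integral_integral_eq[OF i1])
  have i2: "has_bochner_integral lborel (\<lambda>x. complex_of_real (exp t) * ?r x - complex_of_real (exp (- t)) * ?l x)
      (complex_of_real (exp t) * (F T - F t) - complex_of_real (exp (- t)) * (G t - G (- T)))"
    by (intro has_bochner_integral_diff has_bochner_integral_mult_right r l)
  have k2: "kernel_transform sgn_exp_kernel \<phi> t = (LINT x|lborel. complex_of_real (exp t) * ?r x - complex_of_real (exp (- t)) * ?l x)"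
  proof (subst kernel_transform_lborel, simp, simp, rule integral_cong_AE)
    show "AE x in lborel. complex_of_real (sgn (x - t) * exp (- \<bar>x - t\<bar>)) * \<phi> x = complex_of_real (exp t) * ?r x - complex_of_real (exp (- t)) * ?l x"
      using ae by eventually_elim (use e in blast)
  qed auto
  show "kernel_transform sgn_exp_kernel \<phi> t =
      complex_of_real (exp t) * (F T - F t) - complex_of_real (exp (- t)) * (G t - G (- T))"
    unfolding k2 by (rule has_bochner_integral_integral_eq[OF i2])
qed

text \<open>Differentiating the split formula, the moving endpoint contributes -\<phi> t from the
  right half and +\<phi> t from the left half. These cancel for the even kernel and combine to -2
  \<phi> t for the odd one. The third identity is the corresponding integration by parts.\<close>

lemma kernel_transform_properties:
  assumes "\<phi> \<in> test_functions"
  shows has_vderiv_exp_transform: "(kernel_transform exp_kernel \<phi> has_vector_derivative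
      kernel_transform sgn_exp_kernel \<phi> t) (at t)"
    and has_vderiv_sgn_exp_transform: "(kernel_transform sgn_exp_kernel \<phi> has_vector_derivative
      kernel_transform exp_kernel \<phi> t - 2 * \<phi> t) (at t)"
    and sgn_exp_transform_vderiv: "kernel_transform sgn_exp_kernel (vderiv \<phi>) t = kernel_transform exp_kernel \<phi> t - 2 * \<phi> t"
proof -
  have sm: "smooth \<phi>"
    using assms by (rule test_smooth)
  obtain R1 where R1: "\<forall>x. R1 < \<bar>x\<bar> \<longrightarrow> \<phi> x = 0"
    using assms test_functionE by blast
  obtain R2 where R2: "\<forall>x. R2 < \<bar>x\<bar> \<longrightarrow> vderiv \<phi> x = 0"
    using test_vderiv[OF assms] test_functionE by blast
  have "continuous_on UNIV (\<lambda>x. complex_of_real (exp (- x)) * \<phi> x)"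
    by (intro continuous_intros smooth_continuous sm)
  from antiderivative_exists[OF this] obtain F
    where F: "\<And>x. (F has_vector_derivative complex_of_real (exp (- x)) * \<phi> x) (at x)"
    by blast
  have "continuous_on UNIV (\<lambda>x. complex_of_real (exp x) * \<phi> x)"
    by (intro continuous_intros smooth_continuous sm)
  from antiderivative_exists[OF this] obtain G
    where G: "\<And>x. (G has_vector_derivative complex_of_real (exp x) * \<phi> x) (at x)"
    by blast
  \<comment> \<open>Large enough to contain t and the supports of \<phi> and its derivative, so that
    boundary terms at T and -T vanish.\<close>
  define T where "T = \<bar>R1\<bar> + \<bar>R2\<bar> + \<bar>t\<bar> + 1"
  have T: "R1 \<le> T" "R2 \<le> T" "\<bar>t\<bar> < T" "\<phi> T = 0" "\<phi> (- T) = 0"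
    using R1[rule_format, of T] R1[rule_format, of "- T"] by (auto simp: T_def)
  note rep = kernel_transform_exp[where R=R1, OF sm R1 F G _ T(1)]
  have open_T: "open {s::real. \<bar>s\<bar> < T}"
    by (intro open_Collect_less continuous_intros)
  have [simp]: "complex_of_real (exp t) * complex_of_real (exp (- t)) = 1"
    "complex_of_real (exp (- t)) * complex_of_real (exp t) = 1"
    by (simp_all flip: of_real_mult exp_add)
  have d1: "((\<lambda>t. complex_of_real (exp t) * (F T - F t)) has_vector_derivative
       complex_of_real (exp t) * (F T - F t) - \<phi> t) (at t)"
  proof -
    have "((\<lambda>t. complex_of_real (exp t) * (F T - F t)) has_vector_derivative
        complex_of_real (exp t) * (0 - complex_of_real (exp (- t)) * \<phi> t) + complex_of_real (exp t) * (F T - F t)) (at t)"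
      by (intro has_vector_derivative_mult has_vector_derivative_diff has_vector_derivative_of_real
          has_vector_derivative_const F DERIV_exp)
    then show ?thesis
      by (simp flip: mult.assoc)
  qed
  have d2: "((\<lambda>t. complex_of_real (exp (- t)) * (G t - G (- T))) has_vector_derivative
       - (complex_of_real (exp (- t)) * (G t - G (- T))) + \<phi> t) (at t)"
  proof -
    have "((\<lambda>t. exp (- t)) has_real_derivative - exp (- t)) (at t)"
      by (auto intro!: derivative_eq_intros)
    then have "((\<lambda>t. complex_of_real (exp (- t)) * (G t - G (- T))) has_vector_derivative
        complex_of_real (exp (- t)) * (complex_of_real (exp t) * \<phi> t - 0) + complex_of_real (- exp (- t)) * (G t - G (- T))) (at t)"
      by (intro has_vector_derivative_mult has_vector_derivative_diff has_vector_derivative_of_real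
          has_vector_derivative_const G)
    then show ?thesis
      by (simp flip: mult.assoc)
  qed
  have "((\<lambda>t. complex_of_real (exp t) * (F T - F t) + complex_of_real (exp (- t)) * (G t - G (- T))) has_vector_derivative
     kernel_transform sgn_exp_kernel \<phi> t) (at t)"
    using has_vector_derivative_add[OF d1 d2] rep(2)[OF T(3)] by simp
  then show "(kernel_transform exp_kernel \<phi> has_vector_derivative kernel_transform sgn_exp_kernel \<phi> t) (at t)"
    by (rule has_vector_derivative_transform_within_open[OF _ open_T]) (use T rep in auto)
  have "((\<lambda>t. complex_of_real (exp t) * (F T - F t) - complex_of_real (exp (- t)) * (G t - G (- T))) has_vector_derivative
     kernel_transform exp_kernel \<phi> t - 2 * \<phi> t) (at t)"
    by (rule has_vector_derivative_eq_rhs[OF has_vector_derivative_diff[OF d1 d2]]) (simp add: rep(1)[OF T(3)])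
  then show "(kernel_transform sgn_exp_kernel \<phi> has_vector_derivative kernel_transform exp_kernel \<phi> t - 2 * \<phi> t) (at t)"
    by (rule has_vector_derivative_transform_within_open[OF _ open_T]) (use T rep in auto)
  \<comment> \<open>Integration by parts at the level of primitives: a primitive for \<phi>' is made
    from one for \<phi>, so the explicit formula can be reused for
    \<open>vderiv \<phi>\<close>.\<close>
  have F': "((\<lambda>x. complex_of_real (exp (- x)) * \<phi> x + F x) has_vector_derivative complex_of_real (exp (- x)) * vderiv \<phi> x) (at x)" for x
  proof -
    have "((\<lambda>t. exp (- t)) has_real_derivative - exp (- x)) (at x)"
      by (auto intro!: derivative_eq_intros)
    then have "((\<lambda>x. complex_of_real (exp (- x)) * \<phi> x + F x) has_vector_derivative
       (complex_of_real (exp (- x)) * vderiv \<phi> x + complex_of_real (- exp (- x)) * \<phi> x) + complex_of_real (exp (- x)) * \<phi> x) (at x)"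
      by (intro has_vector_derivative_mult has_vector_derivative_add has_vector_derivative_of_real
          smooth_has_vderiv sm F)
    then show ?thesis by simp
  qed
  have G': "((\<lambda>x. complex_of_real (exp x) * \<phi> x - G x) has_vector_derivative complex_of_real (exp x) * vderiv \<phi> x) (at x)" for x
  proof -
    have "((\<lambda>x. complex_of_real (exp x) * \<phi> x - G x) has_vector_derivative
       (complex_of_real (exp x) * vderiv \<phi> x + complex_of_real (exp x) * \<phi> x) - complex_of_real (exp x) * \<phi> x) (at x)"
      by (intro has_vector_derivative_mult has_vector_derivative_diff has_vector_derivative_of_real
          smooth_has_vderiv sm G DERIV_exp)
    then show ?thesis by simp
  qed
  show "kernel_transform sgn_exp_kernel (vderiv \<phi>) t = kernel_transform exp_kernel \<phi> t - 2 * \<phi> t"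
    unfolding kernel_transform_exp(2)[where R=R2, OF smooth_vderiv[OF sm] R2 F' G' T(3) T(2)] rep(1)[OF T(3)]
    by (simp add: T ring_distribs flip: mult.assoc)
qed

lemma vderiv_exp_transform:
  "\<phi> \<in> test_functions \<Longrightarrow> vderiv (kernel_transform exp_kernel \<phi>) = kernel_transform sgn_exp_kernel \<phi>"
  by (rule vderivI) (rule has_vderiv_exp_transform)

lemma vderiv_sgn_exp_transform:
  "\<phi> \<in> test_functions \<Longrightarrow> vderiv (kernel_transform sgn_exp_kernel \<phi>) = (\<lambda>t. kernel_transform exp_kernel \<phi> t - 2 * \<phi> t)"
  by (rule vderivI) (rule has_vderiv_sgn_exp_transform)

text \<open>The derivative of each transform involves the other, so the induction treats both
  simultaneously.\<close>

lemma smooth_kernel_transform: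
  assumes "\<phi> \<in> test_functions"
  shows "smooth (kernel_transform exp_kernel \<phi>)" and "smooth (kernel_transform sgn_exp_kernel \<phi>)"
proof -
  have *: "times_diff n (kernel_transform exp_kernel \<phi>) \<and> times_diff n (kernel_transform sgn_exp_kernel \<phi>)" for n
  proof (induction n)
    case (Suc n)
    have "times_diff n (\<lambda>t. kernel_transform exp_kernel \<phi> t + (- 2) * \<phi> t)"
      using Suc test_smooth[OF assms] by (intro times_diff_add times_diff_mult times_diff_const) (auto simp: smooth_iff_times_diff)
    then show ?case
      using times_diff_SucI[OF has_vderiv_exp_transform[OF assms], of n]
        times_diff_SucI[OF has_vderiv_sgn_exp_transform[OF assms], of n] Suc by simp
  qed simp
  then show "smooth (kernel_transform exp_kernel \<phi>)" "smooth (kernel_transform sgn_exp_kernel \<phi>)"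
    by (auto simp: smooth_iff_times_diff)
qed

lemma has_convolution_iff:
  "has_convolution k Q T \<longleftrightarrow> (\<forall>\<phi>\<in>test_functions. has_pairing Q (kernel_transform k \<phi>) (T \<phi>))"
  by (simp add: has_convolution_def kernel_transform_def[abs_def])

text \<open>The pointwise convolution of \<open>f\<close> and \<open>k\<close>; Fubini makes it dual
  to \<open>kernel_transform\<close>.\<close>

definition kernel_potential :: "(real \<Rightarrow> real) \<Rightarrow> (real \<Rightarrow> complex) \<Rightarrow> real \<Rightarrow> complex" where
  "kernel_potential k f x = (LINT t|lborel. f t * complex_of_real (k (x - t)))"

context
  fixes f :: "real \<Rightarrow> complex" and k :: "real \<Rightarrow> real" and M :: real
  assumes f [measurable]: "f \<in> borel_measurable borel"
    and k [measurable]: "k \<in> borel_measurable borel"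
    and k_le: "\<And>s. \<bar>k s\<bar> \<le> exp (- \<bar>s\<bar>)"
    and M: "\<And>x. (\<integral>\<^sup>+t\<in>{x..x+1}. ennreal (cmod (f t)) \<partial>lborel) \<le> ennreal M" "M \<ge> 0"
begin

lemma nn_integral_kernel_le:
  "(\<integral>\<^sup>+t. ennreal (cmod (f t * complex_of_real (k (x - t)))) \<partial>lborel) \<le> ennreal (M * (2 * exp 1))"
proof -
  have "(\<integral>\<^sup>+t. ennreal (cmod (f t * complex_of_real (k (x - t)))) \<partial>lborel)
      \<le> (\<integral>\<^sup>+t. ennreal (cmod (f t)) * ennreal (exp (- \<bar>x - t\<bar>)) \<partial>lborel)"
    by (intro nn_integral_mono)
       (simp add: norm_mult k_le mult_left_mono ennreal_leI flip: ennreal_mult)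
  also have "\<dots> \<le> ennreal M * ennreal (2 * exp 1)"
    by (rule nn_integral_unif_loc_exp) (use M in auto)
  finally show ?thesis
    using M(2) by (simp add: ennreal_mult)
qed

text \<open>Convolution with an exponentially decaying kernel turns uniform local integrability into
  a global bound; such bounded terms are harmless in the uniform local condition.\<close>

lemma cmod_kernel_potential_le: "cmod (kernel_potential k f x) \<le> M * (2 * exp 1)"
proof -
  have "ennreal (cmod (kernel_potential k f x)) \<le> ennreal (M * (2 * exp 1))"
    unfolding kernel_potential_def
    by (rule order_trans[OF norm_integral_le_nn_integral nn_integral_kernel_le])
  then show ?thesis
    using M(2) by (simp add: ennreal_le_iff)
qed

lemma kernel_potential_measurable: "kernel_potential k f \<in> borel_measurable borel"
proof -
  have "(\<lambda>x. LINT t|lborel. f t * complex_of_real (k (x - t))) \<in> borel_measurable lborel"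
    by (rule sigma_finite_measure.borel_measurable_lebesgue_integral[OF sigma_finite_lborel]) measurable
  then show ?thesis
    by (simp add: kernel_potential_def[abs_def])
qed

context
  fixes \<phi> :: "real \<Rightarrow> complex"
  assumes \<phi>: "\<phi> \<in> test_functions"
begin

text \<open>The order of integration matters: \<open>f\<close> need not be globally integrable, so t
  is integrated first against the kernel, which gives a bound uniform in x, and only then the
  integrability of \<phi> is used.\<close>

lemma kernel_pair_integrable:
  "integrable (lborel \<Otimes>\<^sub>M lborel) (\<lambda>(t, x). f t * (complex_of_real (k (x - t)) * \<phi> x))"
proof (rule integrableI_bounded)
  have [measurable]: "\<phi> \<in> borel_measurable borel"
    by (intro smooth_measurable test_smooth \<phi>)
  show "(\<lambda>(t, x). f t * (complex_of_real (k (x - t)) * \<phi> x)) \<in> borel_measurable (lborel \<Otimes>\<^sub>M lborel)"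
    by measurable
  have "(\<integral>\<^sup>+z. ennreal (norm (case z of (t, x) \<Rightarrow> f t * (complex_of_real (k (x - t)) * \<phi> x))) \<partial>(lborel \<Otimes>\<^sub>M lborel))
      = (\<integral>\<^sup>+x. \<integral>\<^sup>+t. ennreal (norm (f t * (complex_of_real (k (x - t)) * \<phi> x))) \<partial>lborel \<partial>lborel)"
    by (subst lborel_pair.nn_integral_snd[symmetric]) auto
  also have "\<dots> = (\<integral>\<^sup>+x. \<integral>\<^sup>+t. ennreal (cmod (\<phi> x)) * ennreal (cmod (f t * complex_of_real (k (x - t)))) \<partial>lborel \<partial>lborel)"
    by (intro nn_integral_cong) (simp add: norm_mult ennreal_mult[symmetric] mult.assoc mult.left_commute mult.commute)
  also have "\<dots> = (\<integral>\<^sup>+x. ennreal (cmod (\<phi> x)) * (\<integral>\<^sup>+t. ennreal (cmod (f t * complex_of_real (k (x - t)))) \<partial>lborel) \<partial>lborel)"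
    by (intro nn_integral_cong nn_integral_cmult) auto
  also have "\<dots> \<le> (\<integral>\<^sup>+x. ennreal (cmod (\<phi> x)) * ennreal (M * (2 * exp 1)) \<partial>lborel)"
    by (intro nn_integral_mono mult_left_mono nn_integral_kernel_le) auto
  also have "\<dots> = (\<integral>\<^sup>+x. ennreal (norm (\<phi> x)) \<partial>lborel) * ennreal (M * (2 * exp 1))"
    by (rule nn_integral_multc) auto
  also have "\<dots> < \<infinity>"
    using test_integrable[OF \<phi>] by (simp add: integrable_iff_bounded ennreal_mult_less_top)
  finally show "(\<integral>\<^sup>+z. ennreal (norm (case z of (t, x) \<Rightarrow> f t * (complex_of_real (k (x - t)) * \<phi> x))) \<partial>(lborel \<Otimes>\<^sub>M lborel)) < \<infinity>" .
qed

lemma integral_kernel_swap: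
  shows integrable_mult_kernel_transform: "integrable lborel (\<lambda>t. f t * kernel_transform k \<phi> t)"
    and integrable_kernel_potential_mult: "integrable lborel (\<lambda>x. kernel_potential k f x * \<phi> x)"
    and integral_mult_kernel_transform:
      "(LINT t|lborel. f t * kernel_transform k \<phi> t) = (LINT x|lborel. kernel_potential k f x * \<phi> x)"
proof -
  have [measurable]: "\<phi> \<in> borel_measurable borel"
    by (intro smooth_measurable test_smooth \<phi>)
  have 1: "(LINT x|lborel. f t * (complex_of_real (k (x - t)) * \<phi> x)) = f t * kernel_transform k \<phi> t" for t
    by (simp add: kernel_transform_lborel)
  have 2: "(LINT t|lborel. f t * (complex_of_real (k (x - t)) * \<phi> x)) = kernel_potential k f x * \<phi> x" for x
    by (simp add: kernel_potential_def flip: mult.assoc)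
  show "integrable lborel (\<lambda>t. f t * kernel_transform k \<phi> t)"
    using lborel_pair.integrable_fst'[OF kernel_pair_integrable] by (simp only: prod.case 1)
  show "integrable lborel (\<lambda>x. kernel_potential k f x * \<phi> x)"
    using lborel_pair.integrable_snd[OF kernel_pair_integrable] by (simp only: prod.case 2)
  show "(LINT t|lborel. f t * kernel_transform k \<phi> t) = (LINT x|lborel. kernel_potential k f x * \<phi> x)"
    using lborel_pair.Fubini_integral[OF kernel_pair_integrable] by (simp only: prod.case 1 2)
qed

end

end

text \<open>A test function is dominated by a multiple of exp(-|x|), so the weighted exponential
  bound already covers it. The factor exp R compensates the decay on the support.\<close>

lemma unif_loc_mult_test_integrable:
  assumes f [measurable]: "f \<in> borel_measurable borel"
    and M: "\<And>x. (\<integral>\<^sup>+t\<in>{x..x+1}. ennreal (cmod (f t)) \<partial>lborel) \<le> ennreal M"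
    and \<phi>: "\<phi> \<in> test_functions"
  shows "integrable lborel (\<lambda>x. f x * \<phi> x)"
proof (rule integrableI_bounded)
  have [measurable]: "\<phi> \<in> borel_measurable borel"
    by (intro smooth_measurable test_smooth \<phi>)
  show "(\<lambda>x. f x * \<phi> x) \<in> borel_measurable lborel" by simp
  obtain B where B: "B > 0" "\<And>x. cmod (\<phi> x) \<le> B"
    using test_bounded[OF \<phi>] by blast
  obtain R where R: "\<And>x. R < \<bar>x\<bar> \<Longrightarrow> \<phi> x = 0"
    using test_functionE[OF \<phi>] by blast
  have decay: "cmod (\<phi> x) \<le> B * exp R * exp (- \<bar>0 - x\<bar>)" for x
  proof (cases "R < \<bar>x\<bar>")
    case False
    then have "B * 1 \<le> B * exp (R - \<bar>x\<bar>)"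
      using B(1) by (intro mult_left_mono) auto
    moreover have "exp (R - \<bar>x\<bar>) = exp R * exp (- \<bar>0 - x\<bar>)"
      by (simp flip: exp_add)
    ultimately show ?thesis
      using B(2)[of x] by (simp add: mult.assoc)
  qed (use B R in auto)
  have "(\<integral>\<^sup>+x. ennreal (norm (f x * \<phi> x)) \<partial>lborel)
     \<le> (\<integral>\<^sup>+x. ennreal (B * exp R) * (ennreal (cmod (f x)) * ennreal (exp (- \<bar>0 - x\<bar>))) \<partial>lborel)"
    using B(1) mult_left_mono[OF decay norm_ge_zero]
    by (intro nn_integral_mono) (auto simp: norm_mult ennreal_mult[symmetric] mult.left_commute intro!: ennreal_leI)
  also have "\<dots> = ennreal (B * exp R) * (\<integral>\<^sup>+x. ennreal (cmod (f x)) * ennreal (exp (- \<bar>0 - x\<bar>)) \<partial>lborel)"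
    by (rule nn_integral_cmult) simp
  also have "\<dots> \<le> ennreal (B * exp R) * (ennreal M * ennreal (2 * exp 1))"
    by (intro mult_left_mono nn_integral_unif_loc_exp M) auto
  also have "\<dots> < \<infinity>"
    by (simp add: ennreal_mult_less_top)
  finally show "(\<integral>\<^sup>+x. ennreal (norm (f x * \<phi> x)) \<partial>lborel) < \<infinity>" .
qed

section \<open>Equivalence of the two representations\<close>

lemma representation_imp_convolution:
  assumes ul: "unif_loc_bound \<Gamma>0 \<gamma>0"
    and Q0: "\<forall>\<phi>\<in>test_functions. Q \<phi> = dist_deriv (dist_of_fun \<Gamma>0) \<phi> + dist_of_fun \<gamma>0 \<phi>"
  shows "\<exists>\<Gamma> \<gamma>. unif_loc_bound \<Gamma> \<gamma> \<and>
        has_convolution sgn_exp_kernel Q (dist_of_fun \<Gamma>) \<and> has_convolution exp_kernel Q (dist_of_fun \<gamma>)"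
proof -
  obtain M \<Gamma> \<gamma> where b: "borel_unif_loc M \<Gamma> \<gamma>"
    and b2: "\<And>\<phi>. \<phi> \<in> borel_measurable borel \<Longrightarrow> dist_of_fun \<Gamma>0 \<phi> = (LINT x|lborel. \<Gamma> x * \<phi> x)"
    "\<And>\<phi>. \<phi> \<in> borel_measurable borel \<Longrightarrow> dist_of_fun \<gamma>0 \<phi> = (LINT x|lborel. \<gamma> x * \<phi> x)"
    using unif_loc_bound_imp_borel[OF ul] by blast
  have M: "M \<ge> 0" "M + 1 \<ge> 0" and m [measurable]: "\<Gamma> \<in> borel_measurable borel" "\<gamma> \<in> borel_measurable borel"
    using b by (auto simp: borel_unif_loc_def)
  have Q: "Q \<phi> = - (LINT x|lborel. \<Gamma> x * vderiv \<phi> x) + (LINT x|lborel. \<gamma> x * \<phi> x)" if "\<phi> \<in> test_functions" for \<phi>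
    using that Q0 by (simp add: dist_deriv_def b2 smooth_measurable smooth_vderiv_measurable test_smooth)
  have k0: "exp_kernel \<in> borel_measurable borel" "\<And>s. \<bar>exp_kernel s\<bar> \<le> exp (- \<bar>s\<bar>)"
    and k1: "sgn_exp_kernel \<in> borel_measurable borel" "\<And>s. \<bar>sgn_exp_kernel s\<bar> \<le> exp (- \<bar>s\<bar>)"
    by (auto simp: abs_mult sgn_real_def)
  note DG = borel_unif_locD(3)[OF b] and Dg = borel_unif_locD(2)[OF b]
  note G0 = m(1) k0 DG M(2) and G1 = m(1) k1 DG M(2) and g0 = m(2) k0 Dg M(1) and g1 = m(2) k1 Dg M(1)
  let ?P0 = "kernel_potential exp_kernel" and ?P1 = "kernel_potential sgn_exp_kernel"
  have [measurable]: "?P0 \<Gamma> \<in> borel_measurable borel" "?P1 \<Gamma> \<in> borel_measurable borel"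
      "?P0 \<gamma> \<in> borel_measurable borel" "?P1 \<gamma> \<in> borel_measurable borel"
    using kernel_potential_measurable[OF G0] kernel_potential_measurable[OF G1]
      kernel_potential_measurable[OF g0] kernel_potential_measurable[OF g1] by blast+
  \<comment> \<open>The two summands bound the potentials of \<Gamma> and of \<gamma>; the first
    carries \<open>M + 1\<close> because \<Gamma> is controlled in L1 only through its
    square.\<close>
  define c where "c = (M + 1) * (2 * exp 1) + M * (2 * exp 1)"
  have c0: "c \<ge> 0" using M by (simp add: c_def)
  \<comment> \<open>Read off from pairing Q = \<Gamma>' + \<gamma> (here the distributional
    derivative) with the two transforms of \<phi>: differentiation swaps the kernels, and the extra
    -2 \<phi> from the odd kernel produces the term 2 \<Gamma>.\<close>
  define \<Gamma>' where "\<Gamma>' x = 2 * \<Gamma> x + (?P1 \<gamma> x - ?P0 \<Gamma> x)" for x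
  define \<gamma>' where "\<gamma>' x = ?P0 \<gamma> x - ?P1 \<Gamma> x" for x
  have [measurable]: "\<Gamma>' \<in> borel_measurable borel" "\<gamma>' \<in> borel_measurable borel"
    by (simp_all add: \<Gamma>'_def[abs_def] \<gamma>'_def[abs_def])
  have le1: "cmod (?P1 \<gamma> x - ?P0 \<Gamma> x) \<le> c" for x
    using norm_triangle_ineq4[of "?P1 \<gamma> x" "?P0 \<Gamma> x"] cmod_kernel_potential_le[OF g1, of x] cmod_kernel_potential_le[OF G0, of x]
    by (simp add: c_def)
  have le2: "cmod (\<gamma>' x) \<le> c" for x
    using norm_triangle_ineq4[of "?P0 \<gamma> x" "?P1 \<Gamma> x"] cmod_kernel_potential_le[OF g0, of x] cmod_kernel_potential_le[OF G1, of x]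
    by (simp add: c_def \<gamma>'_def)
  \<comment> \<open>From (2a + c)^2 <= 2 (2a)^2 + 2 c^2, hence the factor 8.\<close>
  have le: "(cmod (\<Gamma>' x))\<^sup>2 + cmod (\<gamma>' x) \<le> 8 * (cmod (\<Gamma> x))\<^sup>2 + (2 * c\<^sup>2 + c)" for x
  proof -
    have "cmod (\<Gamma>' x) \<le> 2 * cmod (\<Gamma> x) + c"
      using norm_triangle_ineq[of "2 * \<Gamma> x" "?P1 \<gamma> x - ?P0 \<Gamma> x"] le1[of x] by (simp add: \<Gamma>'_def norm_mult)
    then have "(cmod (\<Gamma>' x))\<^sup>2 \<le> (2 * cmod (\<Gamma> x) + c)\<^sup>2"
      by (intro power_mono) auto
    also have "\<dots> \<le> 8 * (cmod (\<Gamma> x))\<^sup>2 + 2 * c\<^sup>2"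
      using zero_le_power2[of "2 * cmod (\<Gamma> x) - c"] by (simp add: power2_eq_square algebra_simps)
    finally show ?thesis
      using le2[of x] by linarith
  qed
  have "borel_unif_loc (8 * M + (2 * c\<^sup>2 + c)) \<Gamma>' \<gamma>'"
    unfolding borel_unif_loc_def
  proof (intro conjI allI)
    fix x
    have "(\<integral>\<^sup>+t\<in>{x..x+1}. ennreal ((cmod (\<Gamma>' t))\<^sup>2 + cmod (\<gamma>' t)) \<partial>lborel)
      \<le> (\<integral>\<^sup>+t. ennreal 8 * (ennreal ((cmod (\<Gamma> t))\<^sup>2) * indicator {x..x+1} t) + ennreal (2 * c\<^sup>2 + c) * indicator {x..x+1} t \<partial>lborel)"
    proof (intro nn_integral_mono)
      fix t
      have "ennreal ((cmod (\<Gamma>' t))\<^sup>2 + cmod (\<gamma>' t)) \<le> ennreal (8 * (cmod (\<Gamma> t))\<^sup>2 + (2 * c\<^sup>2 + c))"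
        by (rule ennreal_leI[OF le])
      also have "\<dots> = ennreal 8 * ennreal ((cmod (\<Gamma> t))\<^sup>2) + ennreal (2 * c\<^sup>2 + c)"
        using c0 by (subst ennreal_plus) (auto simp: ennreal_mult simp del: ennreal_numeral)
      finally show "ennreal ((cmod (\<Gamma>' t))\<^sup>2 + cmod (\<gamma>' t)) * indicator {x..x+1} t
         \<le> ennreal 8 * (ennreal ((cmod (\<Gamma> t))\<^sup>2) * indicator {x..x+1} t) + ennreal (2 * c\<^sup>2 + c) * indicator {x..x+1} t"
        by (auto simp: indicator_def)
    qed
    also have "\<dots> = ennreal 8 * (\<integral>\<^sup>+t\<in>{x..x+1}. ennreal ((cmod (\<Gamma> t))\<^sup>2) \<partial>lborel) + ennreal (2 * c\<^sup>2 + c)"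
      by (simp add: nn_integral_add nn_integral_cmult)
    also have "\<dots> \<le> ennreal 8 * ennreal M + ennreal (2 * c\<^sup>2 + c)"
      by (intro add_right_mono mult_left_mono borel_unif_locD(1)[OF b]) auto
    also have "\<dots> = ennreal (8 * M + (2 * c\<^sup>2 + c))"
      using M c0 by (simp add: ennreal_plus ennreal_mult)
    finally show "(\<integral>\<^sup>+t\<in>{x..x+1}. ennreal ((cmod (\<Gamma>' t))\<^sup>2 + cmod (\<gamma>' t)) \<partial>lborel) \<le> ennreal (8 * M + (2 * c\<^sup>2 + c))" .
  qed (use M c0 in auto)
  then have "unif_loc_bound \<Gamma>' \<gamma>'"
    by (rule borel_unif_loc_imp_unif_loc_bound)
  moreover have "has_pairing Q (kernel_transform exp_kernel \<phi>) (dist_of_fun \<gamma>' \<phi>)" if \<phi>: "\<phi> \<in> test_functions" for \<phi>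
  proof -
    note S = integral_kernel_swap
    have "has_pairing Q (kernel_transform exp_kernel \<phi>)
       (- (LINT x|lborel. \<Gamma> x * vderiv (kernel_transform exp_kernel \<phi>) x) + (LINT x|lborel. \<gamma> x * kernel_transform exp_kernel \<phi> x))"
      by (rule has_pairing_representation[OF m Q])
         (simp_all add: vderiv_exp_transform \<phi> smooth_kernel_transform S(1)[OF G0 \<phi>] S(1)[OF G1 \<phi>] S(1)[OF g0 \<phi>])
    also have "- (LINT x|lborel. \<Gamma> x * vderiv (kernel_transform exp_kernel \<phi>) x) + (LINT x|lborel. \<gamma> x * kernel_transform exp_kernel \<phi> x)
       = (LINT x|lborel. ?P0 \<gamma> x * \<phi> x) - (LINT x|lborel. ?P1 \<Gamma> x * \<phi> x)"
      by (simp add: vderiv_exp_transform \<phi> S(3)[OF g0 \<phi>] S(3)[OF G1 \<phi>])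
    also have "\<dots> = (LINT x|lborel. ?P0 \<gamma> x * \<phi> x - ?P1 \<Gamma> x * \<phi> x)"
      by (rule Bochner_Integration.integral_diff[symmetric]) (rule S(2)[OF g0 \<phi>] S(2)[OF G1 \<phi>])+
    also have "\<dots> = dist_of_fun \<gamma>' \<phi>"
      by (simp add: dist_of_fun_lborel smooth_measurable test_smooth \<phi> \<gamma>'_def left_diff_distrib)
    finally show ?thesis .
  qed
  moreover have "has_pairing Q (kernel_transform sgn_exp_kernel \<phi>) (dist_of_fun \<Gamma>' \<phi>)" if \<phi>: "\<phi> \<in> test_functions" for \<phi>
  proof -
    note S = integral_kernel_swap
    have i: "integrable lborel (\<lambda>x. 2 * (\<Gamma> x * \<phi> x))"
      by (intro integrable_mult_right unif_loc_mult_test_integrable[OF m(1) DG \<phi>])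
    have eq: "\<Gamma> x * vderiv (kernel_transform sgn_exp_kernel \<phi>) x = \<Gamma> x * kernel_transform exp_kernel \<phi> x - 2 * (\<Gamma> x * \<phi> x)" for x
      by (simp add: vderiv_sgn_exp_transform \<phi> algebra_simps)
    have i': "integrable lborel (\<lambda>x. \<Gamma> x * vderiv (kernel_transform sgn_exp_kernel \<phi>) x)"
      unfolding eq by (intro Bochner_Integration.integrable_diff i S(1)[OF G0 \<phi>])
    have "has_pairing Q (kernel_transform sgn_exp_kernel \<phi>)
       (- (LINT x|lborel. \<Gamma> x * vderiv (kernel_transform sgn_exp_kernel \<phi>) x) + (LINT x|lborel. \<gamma> x * kernel_transform sgn_exp_kernel \<phi> x))"
      by (rule has_pairing_representation[OF m Q])
         (simp_all only: \<phi> smooth_kernel_transform S(1)[OF G1 \<phi>] S(1)[OF g1 \<phi>] i')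
    also have "(LINT x|lborel. \<Gamma> x * vderiv (kernel_transform sgn_exp_kernel \<phi>) x)
       = (LINT x|lborel. ?P0 \<Gamma> x * \<phi> x) - (LINT x|lborel. 2 * (\<Gamma> x * \<phi> x))"
      unfolding eq by (simp only: Bochner_Integration.integral_diff[OF S(1)[OF G0 \<phi>] i] S(3)[OF G0 \<phi>])
    also have "- ((LINT x|lborel. ?P0 \<Gamma> x * \<phi> x) - (LINT x|lborel. 2 * (\<Gamma> x * \<phi> x))) + (LINT x|lborel. \<gamma> x * kernel_transform sgn_exp_kernel \<phi> x)
       = (LINT x|lborel. 2 * (\<Gamma> x * \<phi> x)) + ((LINT x|lborel. ?P1 \<gamma> x * \<phi> x) - (LINT x|lborel. ?P0 \<Gamma> x * \<phi> x))"
      by (simp only: S(3)[OF g1 \<phi>]) simp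
    also have "\<dots> = (LINT x|lborel. 2 * (\<Gamma> x * \<phi> x) + (?P1 \<gamma> x * \<phi> x - ?P0 \<Gamma> x * \<phi> x))"
      by (simp only: Bochner_Integration.integral_diff[OF S(2)[OF g1 \<phi>] S(2)[OF G0 \<phi>]]
         Bochner_Integration.integral_add[OF i Bochner_Integration.integrable_diff[OF S(2)[OF g1 \<phi>] S(2)[OF G0 \<phi>]]])
    also have "\<dots> = dist_of_fun \<Gamma>' \<phi>"
      by (simp add: dist_of_fun_lborel smooth_measurable test_smooth \<phi> \<Gamma>'_def algebra_simps)
    finally show ?thesis .
  qed
  ultimately show ?thesis
    unfolding has_convolution_iff by blast
qed

text \<open>The odd convolution is tested with the derivative of \<phi>. Its transform is the even
  transform of \<phi> minus 2 \<phi>, where the latter is an honest test function, so uniqueness of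
  pairings solves for \<open>Q \<phi>\<close>.\<close>

lemma convolution_imp_representation:
  assumes Q: "distribution Q" and ul: "unif_loc_bound \<Gamma> \<gamma>"
    and c1: "has_convolution sgn_exp_kernel Q (dist_of_fun \<Gamma>)"
    and c0: "has_convolution exp_kernel Q (dist_of_fun \<gamma>)"
  shows "\<exists>\<Gamma> \<gamma>. unif_loc_bound \<Gamma> \<gamma> \<and>
        (\<forall>\<phi>\<in>test_functions. Q \<phi> = dist_deriv (dist_of_fun \<Gamma>) \<phi> + dist_of_fun \<gamma> \<phi>)"
proof (intro exI conjI ballI)
  have half: "dist_of_fun (\<lambda>x. f x / 2) \<phi> = dist_of_fun f \<phi> / 2" for f \<phi>
    by (simp add: dist_of_fun_def)
  have [measurable]: "\<Gamma> \<in> borel_measurable lebesgue" "\<gamma> \<in> borel_measurable lebesgue"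
    using ul unfolding unif_loc_bound_def by blast+
  have "(SUP x::real. \<integral>\<^sup>+t\<in>{x..x+1}. ennreal ((cmod (\<Gamma> t / 2))\<^sup>2 + cmod (\<gamma> t / 2)) \<partial>lebesgue)
      \<le> (SUP x::real. \<integral>\<^sup>+t\<in>{x..x+1}. ennreal ((cmod (\<Gamma> t))\<^sup>2 + cmod (\<gamma> t)) \<partial>lebesgue)"
    by (intro SUP_mono' nn_integral_mono mult_right_mono ennreal_leI add_mono)
       (auto simp: norm_divide power_divide)
  then show "unif_loc_bound (\<lambda>x. \<Gamma> x / 2) (\<lambda>x. \<gamma> x / 2)"
    using ul unfolding unif_loc_bound_def by (auto intro: le_less_trans)
  fix \<phi> assume \<phi>: "\<phi> \<in> test_functions"
  have "has_pairing Q (kernel_transform sgn_exp_kernel (vderiv \<phi>)) (dist_of_fun \<Gamma> (vderiv \<phi>))"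
    using c1 test_vderiv[OF \<phi>] by (simp add: has_convolution_iff)
  moreover have "kernel_transform sgn_exp_kernel (vderiv \<phi>) = (\<lambda>t. kernel_transform exp_kernel \<phi> t - 2 * \<phi> t)"
    by (rule ext) (rule sgn_exp_transform_vderiv[OF \<phi>])
  moreover have "has_pairing Q (\<lambda>t. kernel_transform exp_kernel \<phi> t - 2 * \<phi> t) (dist_of_fun \<gamma> \<phi> - 2 * Q \<phi>)"
  proof (rule has_pairing_diff[OF Q])
    show "has_pairing Q (kernel_transform exp_kernel \<phi>) (dist_of_fun \<gamma> \<phi>)"
      using c0 \<phi> by (simp add: has_convolution_iff)
    show "has_pairing Q (\<lambda>t. 2 * \<phi> t) (2 * Q \<phi>)"
      using has_pairing_test[OF test_cmult[OF \<phi>]] by (simp add: distribution_cmult[OF Q \<phi>, symmetric])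
  qed (auto intro: smooth_kernel_transform smooth_cmult test_smooth \<phi>)
  ultimately have "dist_of_fun \<Gamma> (vderiv \<phi>) = dist_of_fun \<gamma> \<phi> - 2 * Q \<phi>"
    using has_pairing_unique by metis
  then show "Q \<phi> = dist_deriv (dist_of_fun (\<lambda>x. \<Gamma> x / 2)) \<phi> + dist_of_fun (\<lambda>x. \<gamma> x / 2) \<phi>"
    by (simp add: dist_deriv_def half field_simps)
qed

section \<open>Representation of bounded functionals by square integrable functions\<close>

text \<open>Completeness of L2 with a rate: fast decay of the differences gives pointwise
  convergence almost everywhere, and Fatou transfers the rate to the limit.\<close>

lemma L2_complete:
  fixes f :: "nat \<Rightarrow> real \<Rightarrow> complex"
  assumes [measurable]: "\<And>k. f k \<in> borel_measurable borel"
    and Cauchy: "\<And>k m. k \<le> m \<Longrightarrow> (\<integral>\<^sup>+x. ennreal ((cmod (f m x - f k x))\<^sup>2) \<partial>lborel) \<le> ennreal ((1/8) ^ k)"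
  shows "\<exists>g\<in>borel_measurable borel. \<forall>k. (\<integral>\<^sup>+x. ennreal ((cmod (g x - f k x))\<^sup>2) \<partial>lborel) \<le> ennreal ((1/8) ^ k)"
proof -
  \<comment> \<open>The weight 2^k still leaves a convergent series of integrals, since 2/8 = 1/4.
    Almost everywhere the weighted squares are then bounded, so the differences themselves decay
    like (1/sqrt 2)^k; no triangle inequality in L2 is used.\<close>
  define d where "d k x = 2 ^ k * (cmod (f (Suc k) x - f k x))\<^sup>2" for k x
  have [measurable]: "d k \<in> borel_measurable borel" for k
    by (simp add: d_def[abs_def])
  have d0: "d k x \<ge> 0" for k x
    by (simp add: d_def)
  have "(\<integral>\<^sup>+x. (\<Sum>k. ennreal (d k x)) \<partial>lborel) = (\<Sum>k. \<integral>\<^sup>+x. ennreal (d k x) \<partial>lborel)"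
    by (rule nn_integral_suminf) simp
  also have "\<dots> \<le> (\<Sum>k. ennreal ((1/4) ^ k))"
  proof (intro suminf_le summableI)
    fix k
    have "(\<integral>\<^sup>+x. ennreal (d k x) \<partial>lborel) = ennreal (2 ^ k) * (\<integral>\<^sup>+x. ennreal ((cmod (f (Suc k) x - f k x))\<^sup>2) \<partial>lborel)"
      unfolding d_def by (subst nn_integral_cmult[symmetric]) (auto simp: ennreal_mult)
    also have "\<dots> \<le> ennreal (2 ^ k) * ennreal ((1/8) ^ k)"
      by (intro mult_left_mono Cauchy) auto
    also have "\<dots> = ennreal ((1/4) ^ k)"
      by (simp add: ennreal_mult[symmetric] power_mult_distrib[symmetric])
    finally show "(\<integral>\<^sup>+x. ennreal (d k x) \<partial>lborel) \<le> ennreal ((1/4) ^ k)" .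
  qed
  also have "\<dots> < \<infinity>"
    by (subst suminf_ennreal2) (auto simp: summable_geometric)
  finally have "AE x in lborel. (\<Sum>k. ennreal (d k x)) \<noteq> \<infinity>"
    by (intro nn_integral_PInf_AE) auto
  then have conv: "AE x in lborel. convergent (\<lambda>k. f k x)"
  proof eventually_elim
    case (elim x)
    then have "summable (\<lambda>k. d k x)"
      using d0 by (intro summable_suminf_not_top) auto
    then have "bounded (range (\<lambda>k. d k x))"
      using summable_LIMSEQ_zero convergentI convergent_imp_bounded by blast
    then obtain C where C: "\<And>k. \<bar>d k x\<bar> \<le> C"
      unfolding bounded_iff by (auto simp: image_iff)
    have "C \<ge> 0"
      using C[of 0] by linarith
    have le: "norm (f (Suc k) x - f k x) \<le> sqrt C * sqrt (1/2) ^ k" for k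
    proof (rule power2_le_imp_le)
      have "2 ^ k * (cmod (f (Suc k) x - f k x))\<^sup>2 \<le> C"
        using C[of k] by (simp add: d_def)
      moreover have "(sqrt (1/2) ^ k)\<^sup>2 = (1/2 :: real) ^ k"
        by (subst power_mult[symmetric], subst mult.commute, subst power_mult) simp
      ultimately show "(norm (f (Suc k) x - f k x))\<^sup>2 \<le> (sqrt C * sqrt (1/2) ^ k)\<^sup>2"
        using \<open>C \<ge> 0\<close> by (simp only: power_mult_distrib real_sqrt_pow2) (simp add: power_divide field_simps)
    qed (use \<open>C \<ge> 0\<close> in auto)
    have "summable (\<lambda>k. sqrt C * sqrt (1/2) ^ k)"
      by (intro summable_mult summable_geometric) (simp add: real_sqrt_divide)
    then have "summable (\<lambda>k. f (Suc k) x - f k x)"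
      by (rule summable_comparison_test'[where N=0]) (rule le)
    then have "convergent (\<lambda>n. \<Sum>k<n. f (Suc k) x - f k x)"
      by (simp add: summable_iff_convergent)
    then have "convergent (\<lambda>n. f n x - f 0 x)"
      by (simp add: sum_lessThan_telescope[of "\<lambda>k. f k x"])
    then show ?case
      by (simp add: convergent_diff_const_right_iff)
  qed
  \<comment> \<open>On the null set of divergence \<open>lim\<close> is an arbitrary value, which
    the integrals below do not see.\<close>
  let ?g = "\<lambda>x. lim (\<lambda>k. f k x)"
  show ?thesis
  proof (intro bexI[of _ ?g] allI)
    fix k
    have "AE x in lborel. ennreal ((cmod (?g x - f k x))\<^sup>2) = liminf (\<lambda>m. ennreal ((cmod (f m x - f k x))\<^sup>2))"
      using conv
    proof eventually_elim
      case (elim x)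
      then have "(\<lambda>m. ennreal ((cmod (f m x - f k x))\<^sup>2)) \<longlonglongrightarrow> ennreal ((cmod (?g x - f k x))\<^sup>2)"
        by (intro tendsto_intros tendsto_ennrealI) (simp add: convergent_LIMSEQ_iff)
      then show ?case
        by (rule lim_imp_Liminf[OF sequentially_bot, symmetric])
    qed
    then have "(\<integral>\<^sup>+x. ennreal ((cmod (?g x - f k x))\<^sup>2) \<partial>lborel) = (\<integral>\<^sup>+x. liminf (\<lambda>m. ennreal ((cmod (f m x - f k x))\<^sup>2)) \<partial>lborel)"
      by (rule nn_integral_cong_AE)
    also have "\<dots> \<le> liminf (\<lambda>m. \<integral>\<^sup>+x. ennreal ((cmod (f m x - f k x))\<^sup>2) \<partial>lborel)"
      by (rule nn_integral_liminf) simp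
    also have "\<dots> \<le> limsup (\<lambda>m. \<integral>\<^sup>+x. ennreal ((cmod (f m x - f k x))\<^sup>2) \<partial>lborel)"
      by (rule Liminf_le_Limsup) simp
    also have "\<dots> \<le> ennreal ((1/8) ^ k)"
      by (rule Limsup_bounded) (auto intro!: eventually_sequentiallyI[of k] Cauchy)
    finally show "(\<integral>\<^sup>+x. ennreal ((cmod (?g x - f k x))\<^sup>2) \<partial>lborel) \<le> ennreal ((1/8) ^ k)" .
  qed simp
qed

text \<open>Cauchy-Schwarz in additive form: the free parameter \<open>e\<close> stands in for the
  optimization. The choice e = 1 already gives integrability.\<close>

lemma L2_mult_test:
  assumes [measurable]: "h \<in> borel_measurable borel"
    and h: "(\<integral>\<^sup>+x. ennreal ((cmod (h x))\<^sup>2) \<partial>lborel) \<le> ennreal K" and "K \<ge> 0"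
    and \<phi>: "\<phi> \<in> test_functions"
  shows L2_mult_test_integrable: "integrable lborel (\<lambda>x. h x * \<phi> x)"
    and L2_mult_test_le: "0 < e \<Longrightarrow> 2 * cmod (LINT x|lborel. h x * \<phi> x) \<le> e * energy \<phi> + K / e"
proof -
  have [measurable]: "\<phi> \<in> borel_measurable borel"
    by (intro smooth_measurable test_smooth \<phi>)
  have le: "(\<integral>\<^sup>+x. ennreal (2 * norm (h x * \<phi> x)) \<partial>lborel) \<le> ennreal (e * energy \<phi> + K / e)" if e: "e > 0" for e
  proof -
    have "(\<integral>\<^sup>+x. ennreal (2 * norm (h x * \<phi> x)) \<partial>lborel)
      \<le> (\<integral>\<^sup>+x. ennreal e * ennreal ((cmod (\<phi> x))\<^sup>2) + ennreal (1 / e) * ennreal ((cmod (h x))\<^sup>2) \<partial>lborel)"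
    proof (intro nn_integral_mono)
      fix x
      have "2 * norm (h x * \<phi> x) \<le> e * (cmod (\<phi> x))\<^sup>2 + (cmod (h x))\<^sup>2 / e"
        using two_mult_le_weighted[OF e, of "cmod (\<phi> x)" "cmod (h x)"] by (simp add: norm_mult mult_ac)
      then have "ennreal (2 * norm (h x * \<phi> x)) \<le> ennreal (e * (cmod (\<phi> x))\<^sup>2 + (cmod (h x))\<^sup>2 / e)"
        by (rule ennreal_leI)
      then show "ennreal (2 * norm (h x * \<phi> x)) \<le> ennreal e * ennreal ((cmod (\<phi> x))\<^sup>2) + ennreal (1 / e) * ennreal ((cmod (h x))\<^sup>2)"
        using e by (simp add: ennreal_plus ennreal_mult[symmetric])
    qed
    also have "\<dots> = ennreal e * ennreal (energy \<phi>) + ennreal (1 / e) * (\<integral>\<^sup>+x. ennreal ((cmod (h x))\<^sup>2) \<partial>lborel)"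
      by (simp add: nn_integral_add nn_integral_cmult nn_integral_energy \<phi>)
    also have "\<dots> \<le> ennreal e * ennreal (energy \<phi>) + ennreal (1 / e) * ennreal K"
      by (intro add_left_mono mult_left_mono h) auto
    also have "\<dots> = ennreal (e * energy \<phi> + K / e)"
      using e \<open>K \<ge> 0\<close> by (simp add: ennreal_plus ennreal_mult[symmetric] energy_nonneg)
    finally show ?thesis .
  qed
  have "(\<integral>\<^sup>+x. ennreal (norm (2 * (h x * \<phi> x))) \<partial>lborel) \<le> ennreal (1 * energy \<phi> + K / 1)"
    using le[of 1] by (simp add: norm_mult)
  also have "\<dots> < \<infinity>" by simp
  finally have "integrable lborel (\<lambda>x. 2 * (h x * \<phi> x))"
    by (intro integrableI_bounded) auto
  from integrable_mult_right[of "1/2", OF this] show "integrable lborel (\<lambda>x. h x * \<phi> x)"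
    by simp
  assume e: "0 < e"
  have "ennreal (2 * cmod (LINT x|lborel. h x * \<phi> x)) = ennreal (norm (LINT x|lborel. 2 * (h x * \<phi> x)))"
    by (simp add: norm_mult)
  also have "\<dots> \<le> (\<integral>\<^sup>+x. ennreal (norm (2 * (h x * \<phi> x))) \<partial>lborel)"
    by (rule norm_integral_le_nn_integral)
  also have "\<dots> \<le> ennreal (e * energy \<phi> + K / e)"
    using le[OF e] by (simp add: norm_mult)
  finally show "2 * cmod (LINT x|lborel. h x * \<phi> x) \<le> e * energy \<phi> + K / e"
    using e \<open>K \<ge> 0\<close> by (subst (asm) ennreal_le_iff) (auto simp: energy_nonneg)
qed

section \<open>The energy as a quadratic form, and the minimization\<close>

lemma energy_cmult: "energy (\<lambda>x. c * u x) = (cmod c)\<^sup>2 * energy u"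
  by (simp add: energy_def norm_mult power_mult_distrib)

lemma energy_add:
  assumes u: "u \<in> test_functions" and v: "v \<in> test_functions"
  shows "energy (\<lambda>x. u x + v x) = energy u + 2 * Re (LINT x|lborel. cnj (u x) * v x) + energy v"
proof -
  have i: "integrable lborel (\<lambda>x. cnj (u x) * v x)"
    by (intro test_integrable test_mult_left smooth_cnj test_smooth u v)
  have eq: "(cmod (u x + v x))\<^sup>2 = (cmod (u x))\<^sup>2 + 2 * Re (cnj (u x) * v x) + (cmod (v x))\<^sup>2" for x
    unfolding cmod_power2 by (simp add: power2_eq_square algebra_simps)
  show ?thesis
    unfolding energy_def eq using i test_sq_integrable[OF u] test_sq_integrable[OF v]
    by (simp del: times_complex.sel)
qed

lemma energy_parallelogram:
  assumes u: "u \<in> test_functions" and v: "v \<in> test_functions"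
  shows "energy (\<lambda>x. u x - v x) + energy (\<lambda>x. u x + v x) = 2 * energy u + 2 * energy v"
  using energy_add[OF u v] energy_add[OF u test_cmult[OF v, of "-1"]] energy_cmult[of "-1" v]
  by simp

lemma energy_add_le:
  assumes "u \<in> test_functions" "v \<in> test_functions"
  shows "energy (\<lambda>x. u x + v x) \<le> 2 * energy u + 2 * energy v"
  using energy_parallelogram[OF assms] energy_nonneg[of "\<lambda>x. u x - v x"] by linarith

text \<open>Evaluating at s = -D / (E + 1) gives a negative value unless D is 0; adding 1 to E
  covers the degenerate case E = 0.\<close>

lemma quadratic_nonneg_imp_zero:
  fixes D E :: real
  assumes "\<And>s. 2 * s * D + s\<^sup>2 * E \<ge> 0" "E \<ge> 0"
  shows "D = 0"
proof -
  define r where "r = D / (E + 1)"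
  have D: "D = r * (E + 1)"
    using assms(2) by (simp add: r_def)
  have "r\<^sup>2 * (E + 2) \<le> 0"
    using assms(1)[of "- r"] by (simp add: D power2_eq_square algebra_simps)
  then show ?thesis
    using assms(2) by (simp add: D mult_le_0_iff)
qed

text \<open>The Riesz representation for the functional \<open>\<phi>' \<mapsto> L \<phi>\<close>: a minimizing sequence of
  \<open>\<phi> \<mapsto> energy \<phi>' - 2 Re (L \<phi>)\<close> is Cauchy in the energy norm by the parallelogram law, and the
  Euler equation identifies its limit.\<close>

lemma riesz_representation_vderiv:
  fixes L :: "(real \<Rightarrow> complex) \<Rightarrow> complex"
  assumes V: "V \<subseteq> test_functions"
    and V0: "(\<lambda>x. 0) \<in> V"
    and V_add: "\<And>\<phi> \<psi>. \<phi> \<in> V \<Longrightarrow> \<psi> \<in> V \<Longrightarrow> (\<lambda>x. \<phi> x + \<psi> x) \<in> V"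
    and V_cmult: "\<And>c \<phi>. \<phi> \<in> V \<Longrightarrow> (\<lambda>x. c * \<phi> x) \<in> V"
    and L_add: "\<And>\<phi> \<psi>. \<phi> \<in> V \<Longrightarrow> \<psi> \<in> V \<Longrightarrow> L (\<lambda>x. \<phi> x + \<psi> x) = L \<phi> + L \<psi>"
    and L_cmult: "\<And>c \<phi>. \<phi> \<in> V \<Longrightarrow> L (\<lambda>x. c * \<phi> x) = c * L \<phi>"
    and K: "K \<ge> 0" "\<And>\<phi>. \<phi> \<in> V \<Longrightarrow> 2 * cmod (L \<phi>) \<le> energy (vderiv \<phi>) / 2 + K"
  shows "\<exists>h\<in>borel_measurable borel. (\<integral>\<^sup>+x. ennreal ((cmod (h x))\<^sup>2) \<partial>lborel) \<le> ennreal (4 * K + 6) \<and>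
    (\<forall>\<phi>\<in>V. L \<phi> = (LINT x|lborel. h x * vderiv \<phi> x))"
proof -
  define J where "J \<phi> = energy (vderiv \<phi>) - 2 * Re (L \<phi>)" for \<phi>
  have test: "\<phi> \<in> test_functions" "smooth \<phi>" "vderiv \<phi> \<in> test_functions" if "\<phi> \<in> V" for \<phi>
    using that V test_smooth test_vderiv by auto
  \<comment> \<open>The coefficient 1/2 in the bound for \<open>L\<close> leaves half of the energy:
    \<open>J\<close> is bounded below, and near-minimizers have bounded energy.\<close>
  have J_ge: "energy (vderiv \<phi>) / 2 - K \<le> J \<phi>" if "\<phi> \<in> V" for \<phi>
    using K(2)[OF that] complex_Re_le_cmod[of "L \<phi>"] by (simp add: J_def)
  have "J \<phi> \<ge> - K" if "\<phi> \<in> V" for \<phi>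
    using J_ge[OF that] energy_nonneg[of "vderiv \<phi>"] by linarith
  then have bdd: "bdd_below (J ` V)"
    by (auto intro: bdd_belowI[of _ "- K"])
  define m where "m = Inf (J ` V)"
  have m_le: "m \<le> J \<phi>" if "\<phi> \<in> V" for \<phi>
    unfolding m_def using bdd that by (intro cInf_lower) auto
  have "L (\<lambda>x. 0) = 0"
    using L_cmult[OF V0, of 0] by simp
  moreover have "vderiv (\<lambda>x. 0) = (\<lambda>x. 0)"
    by (rule vderivI) simp
  ultimately have "J (\<lambda>x. 0) = 0"
    by (simp add: J_def energy_def)
  then have m0: "m \<le> 0"
    using m_le[OF V0] by simp
  \<comment> \<open>The parallelogram law turns tolerances into 2 tol_j + 2 tol_k, at most 4 tol_k
    for j >= k; a quarter of (1/8)^k thus gives exactly the rate required by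
    \<open>L2_complete\<close>.\<close>
  have "\<exists>\<phi>\<in>V. J \<phi> < m + (1/8) ^ k / 4" for k
  proof -
    have "\<exists>y\<in>J ` V. y < m + (1/8) ^ k / 4"
      unfolding m_def using V0 bdd by (subst cInf_less_iff[symmetric]) auto
    then show ?thesis by blast
  qed
  then obtain p where p: "\<And>k. p k \<in> V" "\<And>k. J (p k) < m + (1/8) ^ k / 4"
    by metis
  have J_add: "J (\<lambda>x. \<phi> x + complex_of_real s * \<psi> x) =
      J \<phi> + 2 * s * (Re (LINT x|lborel. cnj (vderiv \<phi> x) * vderiv \<psi> x) - Re (L \<psi>)) + s\<^sup>2 * energy (vderiv \<psi>)"
    if "\<phi> \<in> V" "\<psi> \<in> V" for \<phi> \<psi> s
  proof -
    have "vderiv (\<lambda>x. \<phi> x + complex_of_real s * \<psi> x) = (\<lambda>x. vderiv \<phi> x + complex_of_real s * vderiv \<psi> x)"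
      using that by (simp add: vderiv_add vderiv_cmult smooth_cmult test)
    moreover have "(LINT x|lborel. cnj (vderiv \<phi> x) * (complex_of_real s * vderiv \<psi> x)) =
        complex_of_real s * (LINT x|lborel. cnj (vderiv \<phi> x) * vderiv \<psi> x)"
      by (subst integral_mult_right_zero[symmetric]) (simp add: mult.left_commute)
    ultimately show ?thesis
      using that by (simp add: J_def energy_add energy_cmult test test_cmult L_add L_cmult V_cmult algebra_simps)
  qed
  have Cauchy: "energy (\<lambda>x. vderiv (p j) x - vderiv (p k) x) \<le> (1/8) ^ k" if "k \<le> j" for j k
  proof -
    let ?a = "p j" and ?b = "p k"
    \<comment> \<open>The midpoint: its value of \<open>J\<close> is at least the infimum
      \<open>m\<close>, which forces two near-minimizers together.\<close>
    let ?c = "\<lambda>x. (1/2) * (?a x + ?b x)"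
    have c: "?c \<in> V"
      by (intro V_cmult V_add p)
    have "vderiv ?c = (\<lambda>x. (1/2) * vderiv (\<lambda>x. ?a x + ?b x) x)"
      by (intro vderiv_cmult smooth_add test p)
    also have "vderiv (\<lambda>x. ?a x + ?b x) = (\<lambda>x. vderiv ?a x + vderiv ?b x)"
      by (intro vderiv_add test p)
    finally have "vderiv ?c = (\<lambda>x. (1/2) * (vderiv ?a x + vderiv ?b x))" .
    then have "4 * energy (vderiv ?c) = energy (\<lambda>x. vderiv ?a x + vderiv ?b x)"
      by (simp only: energy_cmult) (simp add: power_divide)
    moreover have "2 * Re (L ?c) = Re (L ?a) + Re (L ?b)"
      unfolding L_cmult[OF V_add[OF p(1) p(1)]] L_add[OF p(1) p(1)] by simp
    moreover have "energy (\<lambda>x. vderiv ?a x - vderiv ?b x) + energy (\<lambda>x. vderiv ?a x + vderiv ?b x)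
       = 2 * energy (vderiv ?a) + 2 * energy (vderiv ?b)"
      by (intro energy_parallelogram test p)
    moreover have "e = 2 * (a - 2 * r) + 2 * (b - 2 * s) - 4 * (c - 2 * t)"
      if "4 * c = e'" "2 * t = r + s" "e + e' = 2 * a + 2 * b" for a b c e e' r s t :: real
    proof -
      have "e = 2 * a + 2 * b - 4 * c"
        using that(1,3) by linarith
      moreover have "8 * t = 4 * r + 4 * s"
        using that(2) by linarith
      ultimately show ?thesis
        by (simp add: algebra_simps)
    qed
    ultimately have "energy (\<lambda>x. vderiv ?a x - vderiv ?b x) = 2 * J ?a + 2 * J ?b - 4 * J ?c"
      unfolding J_def by blast
    also have "\<dots> \<le> 2 * (m + (1/8) ^ j / 4) + 2 * (m + (1/8) ^ k / 4) - 4 * m"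
      using p(2)[of j] p(2)[of k] m_le[OF c] by (intro diff_mono add_mono mult_left_mono) auto
    also have "\<dots> \<le> (1/8) ^ k"
    proof -
      have "x \<le> y \<Longrightarrow> 2 * (m + x / 4) + 2 * (m + y / 4) - 4 * m \<le> y" for x y :: real
        by (simp add: field_simps)
      moreover have "(1/8::real) ^ j \<le> (1/8) ^ k"
        using that by (intro power_decreasing) auto
      ultimately show ?thesis
        by blast
    qed
    finally show ?thesis .
  qed
  have meas [measurable]: "vderiv (p k) \<in> borel_measurable borel" for k
    by (intro smooth_vderiv_measurable test p)
  have "\<exists>g\<in>borel_measurable borel. \<forall>k. (\<integral>\<^sup>+x. ennreal ((cmod (g x - vderiv (p k) x))\<^sup>2) \<partial>lborel) \<le> ennreal ((1/8) ^ k)"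
  proof (rule L2_complete)
    fix k j :: nat assume "k \<le> j"
    then show "(\<integral>\<^sup>+x. ennreal ((cmod (vderiv (p j) x - vderiv (p k) x))\<^sup>2) \<partial>lborel) \<le> ennreal ((1/8) ^ k)"
      unfolding nn_integral_energy[OF test_diff[OF test(3)[OF p(1)[of j]] test(3)[OF p(1)[of k]]]]
      by (intro ennreal_leI Cauchy)
  qed (rule meas)
  then obtain g where [measurable]: "g \<in> borel_measurable borel"
    and g: "\<And>k. (\<integral>\<^sup>+x. ennreal ((cmod (g x - vderiv (p k) x))\<^sup>2) \<partial>lborel) \<le> ennreal ((1/8) ^ k)"
    by blast
  have cnj_meas [measurable]: "cnj \<in> borel_measurable borel"
    by (intro borel_measurable_continuous_onI continuous_intros)
  \<comment> \<open>The expansion of the energy pairs sesquilinearly, while the representation must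
    be linear without conjugation; the conjugate is therefore moved into \<open>h\<close>.\<close>
  define h where "h x = cnj (g x)" for x
  have h_meas [measurable]: "h \<in> borel_measurable borel"
    unfolding h_def[abs_def] by (rule measurable_compose[OF _ cnj_meas]) simp
  have h_p: "(\<integral>\<^sup>+x. ennreal ((cmod (h x - cnj (vderiv (p k) x)))\<^sup>2) \<partial>lborel) \<le> ennreal ((1/8) ^ k)" for k
    using g[of k] by (simp add: h_def flip: complex_cnj_diff)
  have h_le: "(\<integral>\<^sup>+x. ennreal ((cmod (h x))\<^sup>2) \<partial>lborel) \<le> ennreal (4 * K + 6)"
  proof -
    have "(\<integral>\<^sup>+x. ennreal ((cmod (h x))\<^sup>2) \<partial>lborel) \<le>
      (\<integral>\<^sup>+x. ennreal 2 * ennreal ((cmod (g x - vderiv (p 0) x))\<^sup>2) + ennreal 2 * ennreal ((cmod (vderiv (p 0) x))\<^sup>2) \<partial>lborel)"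
    proof (intro nn_integral_mono)
      fix x
      let ?a = "cmod (g x - vderiv (p 0) x)" and ?b = "cmod (vderiv (p 0) x)"
      have "cmod (h x) \<le> ?a + ?b"
        using norm_triangle_ineq[of "g x - vderiv (p 0) x" "vderiv (p 0) x"] by (simp add: h_def)
      then have "(cmod (h x))\<^sup>2 \<le> (?a + ?b)\<^sup>2"
        by (intro power_mono) auto
      also have "\<dots> \<le> 2 * ?a\<^sup>2 + 2 * ?b\<^sup>2"
        using zero_le_power2[of "?a - ?b"] by (simp add: power2_eq_square algebra_simps)
      finally have "ennreal ((cmod (h x))\<^sup>2) \<le> ennreal (2 * ?a\<^sup>2 + 2 * ?b\<^sup>2)"
        by (rule ennreal_leI)
      then show "ennreal ((cmod (h x))\<^sup>2) \<le> ennreal 2 * ennreal (?a\<^sup>2) + ennreal 2 * ennreal (?b\<^sup>2)"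
        by (simp add: ennreal_plus ennreal_mult)
    qed
    also have "\<dots> = ennreal 2 * (\<integral>\<^sup>+x. ennreal ((cmod (g x - vderiv (p 0) x))\<^sup>2) \<partial>lborel) + ennreal 2 * ennreal (energy (vderiv (p 0)))"
      by (simp add: nn_integral_add nn_integral_cmult nn_integral_energy test p)
    \<comment> \<open>\<open>J (p 0)\<close> is below m + 1/4, so coercivity bounds the energy of
      its derivative by 2K + 2; together with distance at most 1 to the limit this gives 2 + 2 (2K +
      2) = 4K + 6.\<close>
    also have "\<dots> \<le> ennreal 2 * ennreal 1 + ennreal 2 * ennreal (2 * K + 2)"
    proof (intro add_mono mult_left_mono ennreal_leI)
      show "energy (vderiv (p 0)) \<le> 2 * K + 2"
        using J_ge[OF p(1)[of 0]] p(2)[of 0] m0 by simp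
    qed (use g[of 0] in auto)
    also have "\<dots> = ennreal (4 * K + 6)"
      using K(1) by (simp add: ennreal_mult[symmetric] ennreal_plus[symmetric] del: ennreal_numeral ennreal_1 ennreal_plus)
    finally show ?thesis .
  qed
  have Re_eq: "Re (L \<psi>) = Re (LINT x|lborel. h x * vderiv \<psi> x)" if \<psi>: "\<psi> \<in> V" for \<psi>
  proof -
    define D where "D k = Re (LINT x|lborel. cnj (vderiv (p k) x) * vderiv \<psi> x) - Re (L \<psi>)" for k
    have lim: "D \<longlonglongrightarrow> Re (LINT x|lborel. h x * vderiv \<psi> x) - Re (L \<psi>)"
    proof (rule LIM_zero_cancel, rule Lim_null_comparison)
      show "\<forall>\<^sub>F k in sequentially. norm (D k - (Re (LINT x|lborel. h x * vderiv \<psi> x) - Re (L \<psi>)))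
          \<le> (1/2) ^ k * energy (vderiv \<psi>) + (1/4) ^ k"
      proof (intro always_eventually allI)
        fix k
        have m': "(\<lambda>x. h x - cnj (vderiv (p k) x)) \<in> borel_measurable borel"
          by (intro borel_measurable_diff h_meas measurable_compose[OF meas cnj_meas])
        have i: "integrable lborel (\<lambda>x. cnj (vderiv (p k) x) * vderiv \<psi> x)"
          by (intro test_integrable test_mult_left smooth_cnj smooth_vderiv test p \<psi>)
        have i': "integrable lborel (\<lambda>x. h x * vderiv \<psi> x)"
          by (rule L2_mult_test_integrable[OF h_meas h_le]) (use K test \<psi> in auto)
        let ?z = "LINT x|lborel. (h x - cnj (vderiv (p k) x)) * vderiv \<psi> x"
        have "?z = (LINT x|lborel. h x * vderiv \<psi> x) - (LINT x|lborel. cnj (vderiv (p k) x) * vderiv \<psi> x)"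
          using i i' by (simp add: left_diff_distrib)
        then have "norm (D k - (Re (LINT x|lborel. h x * vderiv \<psi> x) - Re (L \<psi>))) \<le> cmod ?z"
          using abs_Re_le_cmod[of ?z] by (simp add: D_def)
        also have "\<dots> \<le> 2 * cmod ?z" by simp
        \<comment> \<open>Weight e = (1/2)^k balances the error (1/8)^k against the fixed energy of
          \<psi>, so that both terms vanish in the limit.\<close>
        also have "\<dots> \<le> (1/2) ^ k * energy (vderiv \<psi>) + (1/8) ^ k / (1/2) ^ k"
          by (rule L2_mult_test_le[OF m' h_p]) (use test \<psi> in auto)
        also have "(1/8) ^ k / (1/2) ^ k = ((1/4) ^ k :: real)"
          by (simp flip: power_divide)
        finally show "norm (D k - (Re (LINT x|lborel. h x * vderiv \<psi> x) - Re (L \<psi>)))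
          \<le> (1/2) ^ k * energy (vderiv \<psi>) + (1/4) ^ k" .
      qed
      have "(\<lambda>k. (1/2) ^ k * energy (vderiv \<psi>) + (1/4) ^ k) \<longlonglongrightarrow> 0 * energy (vderiv \<psi>) + 0"
        by (intro tendsto_intros LIMSEQ_power_zero) auto
      then show "(\<lambda>k. (1/2) ^ k * energy (vderiv \<psi>) + (1/4) ^ k) \<longlonglongrightarrow> 0" by simp
    qed
    \<comment> \<open>Minimality up to (1/8)^k / 4 in direction s \<psi> becomes a nonnegative
      quadratic in s as k grows; its linear coefficient, the Euler equation, must vanish.\<close>
    have "2 * s * (Re (LINT x|lborel. h x * vderiv \<psi> x) - Re (L \<psi>)) + s\<^sup>2 * energy (vderiv \<psi>) \<ge> 0" for s
    proof (rule LIMSEQ_le)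
      show "(\<lambda>k. 2 * s * D k + s\<^sup>2 * energy (vderiv \<psi>)) \<longlonglongrightarrow>
          2 * s * (Re (LINT x|lborel. h x * vderiv \<psi> x) - Re (L \<psi>)) + s\<^sup>2 * energy (vderiv \<psi>)"
        by (intro tendsto_intros lim)
      have "(\<lambda>k. - ((1/8) ^ k / 4)) \<longlonglongrightarrow> - (0 / 4 :: real)"
        by (intro tendsto_intros LIMSEQ_power_zero) auto
      then show "(\<lambda>k. - ((1/8) ^ k / 4)) \<longlonglongrightarrow> (0 :: real)" by simp
      have "- ((1/8) ^ k / 4) \<le> 2 * s * D k + s\<^sup>2 * energy (vderiv \<psi>)" for k
        using m_le[OF V_add[OF p(1)[of k] V_cmult[OF \<psi>, of "complex_of_real s"]]] p(2)[of k]
        unfolding J_add[OF p(1) \<psi>] D_def by simp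
      then show "\<exists>N. \<forall>k\<ge>N. - ((1/8) ^ k / 4) \<le> 2 * s * D k + s\<^sup>2 * energy (vderiv \<psi>)"
        by blast
    qed
    from quadratic_nonneg_imp_zero[OF this energy_nonneg] show ?thesis
      by simp
  qed
  have "L \<psi> = (LINT x|lborel. h x * vderiv \<psi> x)" if \<psi>: "\<psi> \<in> V" for \<psi>
  proof (rule complex_eqI)
    show "Re (L \<psi>) = Re (LINT x|lborel. h x * vderiv \<psi> x)"
      by (rule Re_eq[OF \<psi>])
    \<comment> \<open>The real part at -i \<psi> is the imaginary part at \<psi>, since both sides
      are complex linear.\<close>
    have "(LINT x|lborel. h x * (- \<i> * vderiv \<psi> x)) = - \<i> * (LINT x|lborel. h x * vderiv \<psi> x)"
      by (subst integral_mult_right_zero[symmetric]) (simp add: mult.left_commute)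
    moreover have "vderiv (\<lambda>x. - \<i> * \<psi> x) = (\<lambda>x. - \<i> * vderiv \<psi> x)"
      by (rule vderiv_cmult) (rule test[OF \<psi>])
    ultimately show "Im (L \<psi>) = Im (LINT x|lborel. h x * vderiv \<psi> x)"
      using Re_eq[OF V_cmult[OF \<psi>, of "- \<i>"]] by (simp only: L_cmult[OF \<psi>]) simp
  qed
  then show ?thesis
    using h_meas h_le by blast
qed

section \<open>Form bounded distributions\<close>

text \<open>Length 2 is that of the support of a cutoff \<open>cutoff a (a + 1)\<close>, the pieces
  of the later partition of unity.\<close>

definition window :: "real \<Rightarrow> (real \<Rightarrow> complex) set" where
  "window a = {\<phi> \<in> test_functions. \<forall>x. x \<notin> {a..a+2} \<longrightarrow> \<phi> x = 0}"

lemma energy_le: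
  assumes u: "u \<in> test_functions" and B: "\<And>x. (cmod (u x))\<^sup>2 \<le> B"
    and supp: "\<And>x. x \<notin> {a..b} \<Longrightarrow> u x = 0" and "a \<le> b"
  shows "energy u \<le> B * (b - a)"
proof -
  have "B \<ge> 0"
    using B[of 0] zero_le_power2[of "cmod (u 0)"] by linarith
  have "ennreal (energy u) \<le> (\<integral>\<^sup>+x. ennreal B * indicator {a..b} x \<partial>lborel)"
    unfolding nn_integral_energy[OF u, symmetric]
    by (intro nn_integral_mono) (use B supp in \<open>auto simp: indicator_def intro!: ennreal_leI\<close>)
  also have "\<dots> = ennreal (B * (b - a))"
    using \<open>a \<le> b\<close> \<open>B \<ge> 0\<close> by (simp add: nn_integral_cmult_indicator ennreal_mult)
  finally show ?thesis
    using \<open>a \<le> b\<close> \<open>B \<ge> 0\<close> by (simp add: ennreal_le_iff)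
qed

text \<open>The pointwise bound with weight 4, integrated over length 2, gives E <= 8 E' + E/2;
  absorbing E/2 yields the 16.\<close>

lemma poincare_window:
  assumes "\<phi> \<in> window a"
  shows "energy \<phi> \<le> 16 * energy (vderiv \<phi>)"
proof -
  have \<phi>: "\<phi> \<in> test_functions" and supp: "\<And>x. x \<notin> {a..a+2} \<Longrightarrow> \<phi> x = 0"
    using assms by (auto simp: window_def)
  have [measurable]: "\<phi> \<in> borel_measurable borel" "vderiv \<phi> \<in> borel_measurable borel"
    using \<phi> by (auto intro: smooth_measurable smooth_vderiv_measurable test_smooth)
  have "(cmod (\<phi> x))\<^sup>2 \<le> 4 * energy (vderiv \<phi>) + energy \<phi> / 4" for x
  proof (cases "x \<in> {a..a+2}")
    case True
    \<comment> \<open>The comparison point a - 1 lies outside the closed window, where \<phi>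
      vanishes by definition.\<close>
    have "ennreal ((cmod (\<phi> x))\<^sup>2) \<le> ennreal ((cmod (\<phi> (a - 1)))\<^sup>2) +
      (\<integral>\<^sup>+s\<in>{a-1..a+2}. ennreal (4 * (cmod (vderiv \<phi> s))\<^sup>2 + (cmod (\<phi> s))\<^sup>2 / 4) \<partial>lborel)"
      using True by (intro norm_sq_le_norm_sq_plus test_smooth \<phi>) auto
    also have "\<dots> \<le> (\<integral>\<^sup>+s. ennreal 4 * ennreal ((cmod (vderiv \<phi> s))\<^sup>2) + ennreal (1/4) * ennreal ((cmod (\<phi> s))\<^sup>2) \<partial>lborel)"
      using supp[of "a - 1"]
      by (auto intro!: nn_integral_mono simp: indicator_def ennreal_plus[symmetric] ennreal_mult[symmetric]
           simp del: ennreal_plus ennreal_numeral)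
    also have "\<dots> = ennreal 4 * ennreal (energy (vderiv \<phi>)) + ennreal (1/4) * ennreal (energy \<phi>)"
      using \<phi> by (simp add: nn_integral_add nn_integral_cmult nn_integral_energy test_vderiv del: ennreal_numeral)
    also have "\<dots> = ennreal (4 * energy (vderiv \<phi>) + energy \<phi> / 4)"
      by (simp add: ennreal_plus[symmetric] ennreal_mult[symmetric] energy_nonneg del: ennreal_plus ennreal_numeral)
    finally show ?thesis
      by (subst (asm) ennreal_le_iff) (auto simp: energy_nonneg)
  qed (simp add: supp energy_nonneg)
  then have "energy \<phi> \<le> (4 * energy (vderiv \<phi>) + energy \<phi> / 4) * (a + 2 - a)"
    by (intro energy_le \<phi> supp) auto
  then show ?thesis
    by simp
qed

lemma energy_cutoff_bounded:
  "\<exists>K\<ge>0. \<forall>a. energy (cutoff a (a + 3)) + energy (vderiv (cutoff a (a + 3))) \<le> K"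
proof -
  obtain B0 where B0: "B0 > 0" "\<And>a b x. cmod (cutoff a b x) \<le> B0"
    using cutoff_derivs_bounded[of 0] by auto
  obtain B1 where B1: "B1 > 0" "\<And>a b x. cmod (vderiv (cutoff a b) x) \<le> B1"
    using cutoff_derivs_bounded[of 1] by auto
  have "energy (cutoff a (a + 3)) \<le> B0\<^sup>2 * (a + 4 - a)" for a
    by (intro energy_le cutoff_test power_mono B0) (auto intro: cutoff_eq_0)
  moreover have "energy (vderiv (cutoff a (a + 3))) \<le> B1\<^sup>2 * (a + 4 - a)" for a
  proof (intro energy_le test_vderiv cutoff_test power_mono B1)
    fix x assume "x \<notin> {a..a + 4}"
    then show "vderiv (cutoff a (a + 3)) x = 0"
      by (intro vderiv_eq_0[of "- {a..a+4}" _ _ 0]) (auto intro!: cutoff_eq_0)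
  qed auto
  ultimately have "energy (cutoff a (a + 3)) + energy (vderiv (cutoff a (a + 3))) \<le> B0\<^sup>2 * 4 + B1\<^sup>2 * 4" for a
    by (simp add: add_mono)
  then show ?thesis
    by (intro exI[of _ "B0\<^sup>2 * 4 + B1\<^sup>2 * 4"]) auto
qed

text \<open>Polarizing against a cutoff that is 1 on the window recovers \<open>Q \<phi>\<close>
  from four values of the form. The result is affine in the energy, and rescaling \<phi> trades a
  small coefficient for a large constant.\<close>

lemma form_bounded_window_bound:
  assumes Q: "distribution Q" and fb: "form_bounded Q"
  shows "\<exists>K\<ge>0. \<forall>a. \<forall>\<phi>\<in>window a. 2 * cmod (Q \<phi>) \<le> energy (vderiv \<phi>) / 2 + K"
proof -
  define N where "N u = energy u + energy (vderiv u)" for u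
  have N0: "N u \<ge> 0" for u
    by (simp add: N_def energy_nonneg)
  obtain C0 where C0: "\<And>u. u \<in> test_functions \<Longrightarrow> cmod (quad_form Q u) \<le> C0 * (W12_norm u)\<^sup>2"
    using fb unfolding form_bounded_def by blast
  \<comment> \<open>The factor 2 pays for passing from the square of a sum in
    \<open>W12_norm\<close> to the sum of squares \<open>N\<close>.\<close>
  define C where "C = 2 * \<bar>C0\<bar>"
  have C: "cmod (quad_form Q u) \<le> C * N u" "C \<ge> 0" if u: "u \<in> test_functions" for u
  proof -
    have "cmod (quad_form Q u) \<le> \<bar>C0\<bar> * (W12_norm u)\<^sup>2"
      by (rule order_trans[OF C0[OF u] mult_right_mono]) auto
    also have "\<dots> \<le> \<bar>C0\<bar> * (2 * N u)"
    proof (rule mult_left_mono)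
      show "(W12_norm u)\<^sup>2 \<le> 2 * N u"
      using zero_le_power2[of "L2_norm u - L2_norm (vderiv u)"] u
      by (simp add: W12_norm_def N_def power2_sum power2_diff L2_norm_sq_test test_vderiv)
    qed simp
    finally show "cmod (quad_form Q u) \<le> C * N u" "C \<ge> 0"
      by (simp_all add: C_def)
  qed
  have C_nonneg: "C \<ge> 0"
    by (simp add: C_def)
  obtain K0 where K0: "K0 \<ge> 0" "\<And>a. N (cutoff a (a + 3)) \<le> K0"
    using energy_cutoff_bounded unfolding N_def by blast
  have N_add: "N (\<lambda>x. u x + c * v x) \<le> 2 * N u + 2 * N v"
    if u: "u \<in> test_functions" and v: "v \<in> test_functions" and c: "cmod c = 1" for u v c
  proof -
    have "vderiv (\<lambda>x. u x + c * v x) = (\<lambda>x. vderiv u x + c * vderiv v x)"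
      using u v by (simp add: vderiv_add vderiv_cmult smooth_cmult test_smooth)
    moreover have "energy (\<lambda>x. u x + c * v x) \<le> 2 * energy u + 2 * energy (\<lambda>x. c * v x)"
      by (intro energy_add_le test_cmult u v)
    moreover have "energy (\<lambda>x. vderiv u x + c * vderiv v x) \<le> 2 * energy (vderiv u) + 2 * energy (\<lambda>x. c * vderiv v x)"
      by (intro energy_add_le test_cmult test_vderiv u v)
    ultimately show ?thesis
      by (simp add: N_def energy_cmult c)
  qed
  \<comment> \<open>17 is the Poincare constant 16 plus 1 for the derivative itself;
    \<open>K0\<close> bounds the cutoff.\<close>
  define A where "A = 2 * C * (17 + K0)"
  have A0: "A \<ge> 0"
    using C_nonneg K0 by (simp add: A_def)
  have bound1: "cmod (Q \<phi>) \<le> A * (energy (vderiv \<phi>) + 1)" if "\<phi> \<in> window a" for a \<phi>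
  proof -
    have \<phi>: "\<phi> \<in> test_functions" and supp: "\<And>x. x \<notin> {a..a+2} \<Longrightarrow> \<phi> x = 0"
      using that by (auto simp: window_def)
    \<comment> \<open>Equal to 1 on [a, a+2], the whole window, hence
      \<open>\<phi> x * ?w x = \<phi> x\<close>.\<close>
    let ?w = "cutoff (a - 1) (a - 1 + 3)"
    let ?u = "\<lambda>c x. \<phi> x + c * ?w x"
    let ?s = "\<lambda>c x. complex_of_real ((cmod (?u c x))\<^sup>2)"
    have test: "?u c \<in> test_functions" for c
      by (intro test_add test_cmult cutoff_test \<phi>)
    have s_test: "?s c \<in> test_functions" for c
      by (rule test_norm_sq(1)[OF test])
    have prod: "\<phi> x * ?w x = \<phi> x" for x
    proof (cases "x \<in> {a..a+2}")
      case True
      then have "?w x = 1"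
        by (intro cutoff_eq_1) auto
      then show ?thesis by simp
    qed (simp add: supp)
    \<comment> \<open>Complex polarization for the product of \<phi> and the conjugate of
      \<open>?w\<close>; the cutoff is real, so its conjugate disappears.\<close>
    have polar: "4 * \<phi> x = ((?s 1 x + (-1) * ?s (-1) x) + \<i> * ?s \<i> x) + (- \<i>) * ?s (- \<i>) x" for x
    proof -
      have sq: "complex_of_real ((cmod z)\<^sup>2) = z * cnj z" for z
        by (simp add: complex_mult_cnj cmod_power2)
      have "((?s 1 x + (-1) * ?s (-1) x) + \<i> * ?s \<i> x) + (- \<i>) * ?s (- \<i>) x = 4 * (\<phi> x * ?w x)"
        unfolding sq by (simp add: cnj_cutoff algebra_simps)
      also have "\<dots> = 4 * \<phi> x"
        by (simp only: prod)
      finally show ?thesis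
        by (rule sym)
    qed
    have "4 * Q \<phi> = Q (\<lambda>x. ((?s 1 x + (-1) * ?s (-1) x) + \<i> * ?s \<i> x) + (- \<i>) * ?s (- \<i>) x)"
      by (simp only: distribution_cmult[OF Q \<phi>, symmetric] polar)
    also have "\<dots> = ((Q (?s 1) + (-1) * Q (?s (-1))) + \<i> * Q (?s \<i>)) + (- \<i>) * Q (?s (- \<i>))"
      by (simp only: distribution_add[OF Q] distribution_cmult[OF Q] test_add test_cmult s_test)
    finally have "4 * cmod (Q \<phi>) = cmod (((Q (?s 1) + (-1) * Q (?s (-1))) + \<i> * Q (?s \<i>)) + (- \<i>) * Q (?s (- \<i>)))"
      by (metis norm_mult norm_numeral)
    also have "\<dots> \<le> ((cmod (Q (?s 1)) + cmod ((-1) * Q (?s (-1)))) + cmod (\<i> * Q (?s \<i>))) + cmod ((- \<i>) * Q (?s (- \<i>)))"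
      by (intro norm_triangle_le add_mono order_refl)
    also have "\<dots> = cmod (Q (?s 1)) + cmod (Q (?s (-1))) + cmod (Q (?s \<i>)) + cmod (Q (?s (- \<i>)))"
      by (simp add: norm_mult)
    also have "\<dots> \<le> C * (2 * N \<phi> + 2 * N ?w) + C * (2 * N \<phi> + 2 * N ?w) + C * (2 * N \<phi> + 2 * N ?w) + C * (2 * N \<phi> + 2 * N ?w)"
    proof -
      have le: "cmod (Q (?s c)) \<le> C * (2 * N \<phi> + 2 * N ?w)" if "cmod c = 1" for c
        using C(1)[OF test[of c]] mult_left_mono[OF N_add[OF \<phi> cutoff_test that] C_nonneg]
        unfolding quad_form_def by (rule order_trans)
      show ?thesis
        by (intro add_mono le) simp_all
    qed
    finally have "cmod (Q \<phi>) \<le> 2 * C * (N \<phi> + N ?w)"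
      by (simp add: algebra_simps)
    also have "\<dots> \<le> 2 * C * (17 * energy (vderiv \<phi>) + K0)"
      using poincare_window[OF that] K0(2)[of "a - 1"] C_nonneg
      by (intro mult_left_mono add_mono) (auto simp: N_def)
    also have "\<dots> \<le> 2 * C * ((17 + K0) * (energy (vderiv \<phi>) + 1))"
      using C_nonneg K0 energy_nonneg[of "vderiv \<phi>"] by (intro mult_left_mono) (auto simp: algebra_simps)
    finally show ?thesis
      by (simp add: A_def mult.assoc)
  qed
  \<comment> \<open>Applying the affine bound to r \<phi> and dividing by r gives coefficient A r
    and constant A / r. The choice of r brings 2 A r down to 1/2, the coercivity demanded by the
    Riesz argument.\<close>
  define r where "r = 1 / (4 * A + 1)"
  have r: "r > 0" "2 * A * r \<le> 1 / 2"
    using A0 by (simp_all add: r_def field_simps)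
  show ?thesis
  proof (intro exI[of _ "2 * A / r"] conjI allI ballI)
    show "2 * A / r \<ge> 0"
      using A0 r by simp
    fix a \<phi> assume \<phi>: "\<phi> \<in> window a"
    then have test: "\<phi> \<in> test_functions"
      by (simp add: window_def)
    have "(\<lambda>x. complex_of_real r * \<phi> x) \<in> window a"
      using \<phi> by (auto simp: window_def test_cmult)
    from bound1[OF this] have "r * cmod (Q \<phi>) \<le> A * (r\<^sup>2 * energy (vderiv \<phi>) + 1)"
      using r by (simp add: distribution_cmult[OF Q test] norm_mult vderiv_cmult[OF test_smooth[OF test]] energy_cmult)
    then have "cmod (Q \<phi>) \<le> A * r * energy (vderiv \<phi>) + A / r"
      using r(1) by (simp add: field_simps power2_eq_square)
    then have "2 * cmod (Q \<phi>) \<le> 2 * (A * r * energy (vderiv \<phi>) + A / r)"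
      by simp
    also have "\<dots> = (2 * A * r) * energy (vderiv \<phi>) + 2 * A / r"
      by (simp add: distrib_left mult.assoc)
    also have "\<dots> \<le> (1 / 2) * energy (vderiv \<phi>) + 2 * A / r"
      by (intro add_mono mult_right_mono r energy_nonneg) auto
    finally show "2 * cmod (Q \<phi>) \<le> energy (vderiv \<phi>) / 2 + 2 * A / r"
      by simp
  qed
qed

lemma form_bounded_local_representation:
  assumes Q: "distribution Q" and fb: "form_bounded Q"
  shows "\<exists>K\<ge>0. \<forall>a. \<exists>h\<in>borel_measurable borel. (\<integral>\<^sup>+x. ennreal ((cmod (h x))\<^sup>2) \<partial>lborel) \<le> ennreal K \<and>
    (\<forall>\<phi>\<in>window a. Q \<phi> = (LINT x|lborel. h x * vderiv \<phi> x))"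
proof -
  obtain K where K: "K \<ge> 0" "\<And>a \<phi>. \<phi> \<in> window a \<Longrightarrow> 2 * cmod (Q \<phi>) \<le> energy (vderiv \<phi>) / 2 + K"
    using form_bounded_window_bound[OF assms] by blast
  have "\<exists>h\<in>borel_measurable borel. (\<integral>\<^sup>+x. ennreal ((cmod (h x))\<^sup>2) \<partial>lborel) \<le> ennreal (4 * K + 6) \<and>
    (\<forall>\<phi>\<in>window a. Q \<phi> = (LINT x|lborel. h x * vderiv \<phi> x))" for a
    by (rule riesz_representation_vderiv)
       (use K in \<open>auto simp: window_def test_zero test_add test_cmult distribution_add[OF Q] distribution_cmult[OF Q]\<close>)
  then show ?thesis
    using K(1) by (intro exI[of _ "4 * K + 6"]) auto
qed

section \<open>Gluing the local representations\<close>

text \<open>A smooth partition of unity by integer translates; sums over consecutive indices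
  telescope to one long cutoff.\<close>

definition bump :: "int \<Rightarrow> real \<Rightarrow> complex" where
  "bump i = cutoff (of_int i) (of_int i + 1)"

lemma bump_test: "bump i \<in> test_functions"
  by (simp add: bump_def cutoff_test)

text \<open>The support of the i-th bump lies in [i, i+2]. Three indices are kept because an integer
  x touches the closed intervals of x-2, x-1 and x.\<close>

lemma bump_support:
  assumes "i \<notin> {\<lfloor>x\<rfloor> - 2..\<lfloor>x\<rfloor>}"
  shows "bump i x = 0" "vderiv (bump i) x = 0"
proof -
  have out: "bump i y = 0" if "y \<notin> {of_int i..of_int i + 2}" for y
    using that by (auto simp: bump_def intro!: cutoff_eq_0)
  have "x \<notin> {of_int i..of_int i + 2}"
    using assms by (auto simp: le_floor_iff floor_le_iff) linarith+
  then show "bump i x = 0" "vderiv (bump i) x = 0"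
    by (auto intro!: out vderiv_eq_0[of "- {of_int i..of_int i + 2}" _ _ 0])
qed

lemma sum_bump: "(\<Sum>i\<in>{- int n..int n}. bump i x) = cutoff (- real n) (real n + 1) x"
proof (induction n)
  case (Suc n)
  have "{- int (Suc n)..int (Suc n)} = insert (- int (Suc n)) (insert (int (Suc n)) {- int n..int n})"
    by auto
  then have "(\<Sum>i\<in>{- int (Suc n)..int (Suc n)}. bump i x) = bump (- int (Suc n)) x + (bump (int (Suc n)) x + (\<Sum>i\<in>{- int n..int n}. bump i x))"
    by simp
  also have "\<dots> = cutoff (- real (Suc n)) (real (Suc n) + 1) x"
    unfolding Suc by (simp add: bump_def cutoff_def algebra_simps)
  finally show ?case .
qed (simp add: bump_def)

text \<open>On each piece \<open>Q\<close> pairs \<open>h i\<close> with the derivative of bump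
  times \<phi>. Leibniz separates the part with \<phi>', which forms -\<Gamma>, from the part with
  the derivative of the bump, which forms \<gamma>; the sign matches
  \<open>dist_deriv\<close>.\<close>

lemma form_bounded_imp_representation:
  assumes Q: "distribution Q" and fb: "form_bounded Q"
  shows "\<exists>\<Gamma> \<gamma>. unif_loc_bound \<Gamma> \<gamma> \<and>
        (\<forall>\<phi>\<in>test_functions. Q \<phi> = dist_deriv (dist_of_fun \<Gamma>) \<phi> + dist_of_fun \<gamma> \<phi>)"
proof -
  obtain K where K: "K \<ge> 0" and "\<And>a. \<exists>h\<in>borel_measurable borel. (\<integral>\<^sup>+x. ennreal ((cmod (h x))\<^sup>2) \<partial>lborel) \<le> ennreal K \<and>
    (\<forall>\<phi>\<in>window a. Q \<phi> = (LINT x|lborel. h x * vderiv \<phi> x))"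
    using form_bounded_local_representation[OF assms] by blast
  then obtain h' where h': "\<And>a. h' a \<in> borel_measurable borel" "\<And>a. (\<integral>\<^sup>+x. ennreal ((cmod (h' a x))\<^sup>2) \<partial>lborel) \<le> ennreal K"
    "\<And>a \<phi>. \<phi> \<in> window a \<Longrightarrow> Q \<phi> = (LINT x|lborel. h' a x * vderiv \<phi> x)"
    by metis
  define h where "h i = h' (of_int i)" for i :: int
  have h_meas [measurable]: "h i \<in> borel_measurable borel"
    and h_le: "(\<integral>\<^sup>+x. ennreal ((cmod (h i x))\<^sup>2) \<partial>lborel) \<le> ennreal K"
    and h_rep: "\<And>\<phi>. \<phi> \<in> window (of_int i) \<Longrightarrow> Q \<phi> = (LINT x|lborel. h i x * vderiv \<phi> x)" for i
    using h' by (simp_all add: h_def)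
  obtain B0 where B0: "B0 > 0" "\<And>a b x. cmod (cutoff a b x) \<le> B0"
    using cutoff_derivs_bounded[of 0] by auto
  obtain B1 where B1: "B1 > 0" "\<And>a b x. cmod (vderiv (cutoff a b) x) \<le> B1"
    using cutoff_derivs_bounded[of 1] by auto
  have bump_meas [measurable]: "bump i \<in> borel_measurable borel" "vderiv (bump i) \<in> borel_measurable borel" for i
    by (auto intro: smooth_measurable smooth_vderiv_measurable test_smooth bump_test)
  \<comment> \<open>Only bumps that can be nonzero at x are summed, so the sum is finite at every
    point although infinitely many \<open>h i\<close> are involved.\<close>
  define \<Gamma> where "\<Gamma> x = - (\<Sum>i\<in>{\<lfloor>x\<rfloor> - 2..\<lfloor>x\<rfloor>}. h i x * bump i x)" for x
  define \<gamma> where "\<gamma> x = (\<Sum>i\<in>{\<lfloor>x\<rfloor> - 2..\<lfloor>x\<rfloor>}. h i x * vderiv (bump i) x)" for x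
  \<comment> \<open>The index range depends on x only through its floor; the sum is measurable for
    each fixed integer, and there are countably many.\<close>
  have fl: "floor \<in> measurable (borel :: real measure) (count_space UNIV)"
    by (rule measurable_real_floor)
  have \<Gamma>_meas [measurable]: "\<Gamma> \<in> borel_measurable borel"
    unfolding \<Gamma>_def
    by (rule measurable_compose_countable[where f="\<lambda>m x. - (\<Sum>i\<in>{m - 2..m}. h i x * bump i x)", OF _ fl]) measurable
  have \<gamma>_meas [measurable]: "\<gamma> \<in> borel_measurable borel"
    unfolding \<gamma>_def
    by (rule measurable_compose_countable[where f="\<lambda>m x. \<Sum>i\<in>{m - 2..m}. h i x * vderiv (bump i) x", OF _ fl]) measurable
  define P where "P = 4 * B0\<^sup>2 + B1"
  have P: "P \<ge> 0" using B0 B1 by (simp add: P_def)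
  have bul: "borel_unif_loc (4 * P * K + 4 * B1) \<Gamma> \<gamma>"
    unfolding borel_unif_loc_def
  proof (intro conjI allI)
    fix x :: real
    \<comment> \<open>Over a unit interval the floor takes at most two values, so four indices
      suffice for all t in it; this is the 4 in the constants.\<close>
    let ?J = "{\<lfloor>x\<rfloor> - 2..\<lfloor>x\<rfloor> + 1}"
    have pt: "(cmod (\<Gamma> t))\<^sup>2 + cmod (\<gamma> t) \<le> P * (\<Sum>i\<in>?J. (cmod (h i t))\<^sup>2) + 4 * B1" if t: "t \<in> {x..x+1}" for t
    proof -
      have sub: "{\<lfloor>t\<rfloor> - 2..\<lfloor>t\<rfloor>} \<subseteq> ?J"
      proof -
        have "\<lfloor>x\<rfloor> \<le> \<lfloor>t\<rfloor>" "\<lfloor>t\<rfloor> \<le> \<lfloor>x\<rfloor> + 1"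
          using t floor_mono[of x t] floor_mono[of t "x + 1"] by auto
        then show ?thesis by auto
      qed
      have le: "cmod (\<Sum>i\<in>{\<lfloor>t\<rfloor> - 2..\<lfloor>t\<rfloor>}. h i t * b i) \<le> B * (\<Sum>i\<in>?J. cmod (h i t))"
        if "\<And>i. cmod (b i) \<le> B" "B > 0" for b :: "int \<Rightarrow> complex" and B
      proof -
        have "cmod (\<Sum>i\<in>{\<lfloor>t\<rfloor> - 2..\<lfloor>t\<rfloor>}. h i t * b i) \<le> (\<Sum>i\<in>{\<lfloor>t\<rfloor> - 2..\<lfloor>t\<rfloor>}. B * cmod (h i t))"
          by (rule sum_norm_le) (simp add: norm_mult mult.commute mult_right_mono that)
        also have "\<dots> \<le> (\<Sum>i\<in>?J. B * cmod (h i t))"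
          using that(2) by (intro sum_mono2 sub) auto
        finally show ?thesis
          by (simp add: sum_distrib_left)
      qed
      have "cmod (\<Gamma> t) \<le> B0 * (\<Sum>i\<in>?J. cmod (h i t))"
        unfolding \<Gamma>_def norm_minus_cancel by (rule le) (auto simp: bump_def B0)
      then have "(cmod (\<Gamma> t))\<^sup>2 \<le> (B0 * (\<Sum>i\<in>?J. cmod (h i t)))\<^sup>2"
        by (intro power_mono) auto
      also have "\<dots> \<le> B0\<^sup>2 * ((\<Sum>i\<in>?J. (cmod (h i t))\<^sup>2) * real (card ?J))"
        unfolding power_mult_distrib by (intro mult_left_mono sum_squared_le_sum_of_squares) auto
      finally have 1: "(cmod (\<Gamma> t))\<^sup>2 \<le> 4 * B0\<^sup>2 * (\<Sum>i\<in>?J. (cmod (h i t))\<^sup>2)"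
        by simp
      have "cmod (\<gamma> t) \<le> B1 * (\<Sum>i\<in>?J. cmod (h i t))"
        unfolding \<gamma>_def by (rule le) (auto simp: bump_def B1)
      also have "\<dots> \<le> B1 * (\<Sum>i\<in>?J. (cmod (h i t))\<^sup>2 + 1)"
      proof (intro mult_left_mono sum_mono)
        show "cmod (h i t) \<le> (cmod (h i t))\<^sup>2 + 1" for i
          using zero_le_power2[of "cmod (h i t) - 1/2"] by (simp add: power2_eq_square algebra_simps)
      qed (use B1 in auto)
      finally have "cmod (\<gamma> t) \<le> B1 * (\<Sum>i\<in>?J. (cmod (h i t))\<^sup>2) + 4 * B1"
        by (simp add: sum.distrib algebra_simps)
      with 1 show ?thesis
        by (simp add: P_def distrib_right)
    qed
    have "(\<integral>\<^sup>+t\<in>{x..x+1}. ennreal ((cmod (\<Gamma> t))\<^sup>2 + cmod (\<gamma> t)) \<partial>lborel)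
       \<le> (\<integral>\<^sup>+t. ennreal P * (\<Sum>i\<in>?J. ennreal ((cmod (h i t))\<^sup>2)) + ennreal (4 * B1) * indicator {x..x+1} t \<partial>lborel)"
    proof (intro nn_integral_mono)
      fix t
      show "ennreal ((cmod (\<Gamma> t))\<^sup>2 + cmod (\<gamma> t)) * indicator {x..x+1} t
        \<le> ennreal P * (\<Sum>i\<in>?J. ennreal ((cmod (h i t))\<^sup>2)) + ennreal (4 * B1) * indicator {x..x+1} t"
      proof (cases "t \<in> {x..x+1}")
        case True
        have "ennreal ((cmod (\<Gamma> t))\<^sup>2 + cmod (\<gamma> t)) \<le> ennreal (P * (\<Sum>i\<in>?J. (cmod (h i t))\<^sup>2) + 4 * B1)"
          by (rule ennreal_leI[OF pt[OF True]])
        also have "\<dots> = ennreal P * (\<Sum>i\<in>?J. ennreal ((cmod (h i t))\<^sup>2)) + ennreal (4 * B1)"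
          using P B1 by (subst ennreal_plus) (auto simp: ennreal_mult sum_nonneg intro!: mult_nonneg_nonneg)
        finally show ?thesis
          using True by simp
      qed simp
    qed
    also have "\<dots> = ennreal P * (\<Sum>i\<in>?J. \<integral>\<^sup>+t. ennreal ((cmod (h i t))\<^sup>2) \<partial>lborel) + ennreal (4 * B1)"
      by (simp add: nn_integral_add nn_integral_cmult nn_integral_sum del: sum_ennreal)
    also have "\<dots> \<le> ennreal P * (\<Sum>i\<in>?J. ennreal K) + ennreal (4 * B1)"
      by (intro add_right_mono mult_left_mono sum_mono h_le) auto
    also have "(\<Sum>i\<in>?J. ennreal K) = ennreal (4 * K)"
      using K by (subst sum_ennreal) auto
    also have "ennreal P * ennreal (4 * K) + ennreal (4 * B1) = ennreal (4 * P * K + 4 * B1)"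
      using P K B1 by (simp add: ennreal_mult[symmetric] ennreal_plus[symmetric] mult_ac del: ennreal_plus)
    finally show "(\<integral>\<^sup>+t\<in>{x..x+1}. ennreal ((cmod (\<Gamma> t))\<^sup>2 + cmod (\<gamma> t)) \<partial>lborel) \<le> ennreal (4 * P * K + 4 * B1)" .
  qed (use P K B1 in auto)
  have "Q \<phi> = dist_deriv (dist_of_fun \<Gamma>) \<phi> + dist_of_fun \<gamma> \<phi>" if \<phi>: "\<phi> \<in> test_functions" for \<phi>
  proof -
    obtain R where R: "R > 0" "\<And>x. R < \<bar>x\<bar> \<Longrightarrow> \<phi> x = 0"
      using test_functionE[OF \<phi>] by blast
    obtain R' where R': "R' > 0" "\<And>x. R' < \<bar>x\<bar> \<Longrightarrow> vderiv \<phi> x = 0"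
      using test_functionE[OF test_vderiv[OF \<phi>]] by blast
    \<comment> \<open>Large enough that the summed bumps equal 1 on the support of \<phi>, and that
      all indices active at points of size at most R + R' lie in \<open>?I\<close>.\<close>
    define n where "n = nat \<lceil>R + R'\<rceil> + 4"
    let ?I = "{- int n..int n}"
    have n: "R + R' + 3 \<le> real n"
      unfolding n_def by linarith
    have bt: "(\<lambda>x. bump i x * \<phi> x) \<in> test_functions" for i
      by (intro test_mult_left test_smooth bump_test \<phi>)
    have bw: "(\<lambda>x. bump i x * \<phi> x) \<in> window (of_int i)" for i
      using bt by (auto simp: window_def bump_def cutoff_eq_0)
    have vd: "vderiv (\<lambda>x. bump i x * \<phi> x) = (\<lambda>x. bump i x * vderiv \<phi> x + vderiv (bump i) x * \<phi> x)" for i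
      by (intro vderiv_mult test_smooth bump_test \<phi>)
    have "\<phi> x = (\<Sum>i\<in>?I. bump i x * \<phi> x)" for x
    proof (cases "R < \<bar>x\<bar>")
      case False
      then have "cutoff (- real n) (real n + 1) x = 1"
        using n R R' by (intro cutoff_eq_1) auto
      then show ?thesis
        by (simp add: sum_distrib_right[symmetric] sum_bump)
    qed (simp add: R)
    then have "Q \<phi> = Q (\<lambda>x. \<Sum>i\<in>?I. bump i x * \<phi> x)"
      by presburger
    also have "\<dots> = (\<Sum>i\<in>?I. Q (\<lambda>x. bump i x * \<phi> x))"
      by (rule distribution_sum[OF Q bt])
    also have "\<dots> = (\<Sum>i\<in>?I. LINT x|lborel. h i x * vderiv (\<lambda>x. bump i x * \<phi> x) x)"
      by (intro sum.cong refl h_rep bw)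
    also have "\<dots> = (LINT x|lborel. (\<Sum>i\<in>?I. h i x * vderiv (\<lambda>x. bump i x * \<phi> x) x))"
      by (rule Bochner_Integration.integral_sum[symmetric])
         (rule L2_mult_test_integrable[OF h_meas h_le K test_vderiv[OF bt]])
    also have "\<dots> = (LINT x|lborel. \<gamma> x * \<phi> x - \<Gamma> x * vderiv \<phi> x)"
    proof (intro Bochner_Integration.integral_cong refl)
      fix x
      \<comment> \<open>The two index ranges are interchangeable only near the supports; elsewhere
        the factor \<phi> or its derivative is 0, which the case splits below exploit.\<close>
      have sum_eq: "(\<Sum>i\<in>?I. h i x * b i) = (\<Sum>i\<in>{\<lfloor>x\<rfloor> - 2..\<lfloor>x\<rfloor>}. h i x * b i)"
        if "\<bar>x\<bar> \<le> R + R'" "\<And>i. i \<notin> {\<lfloor>x\<rfloor> - 2..\<lfloor>x\<rfloor>} \<Longrightarrow> b i = 0" for b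
      proof (rule sum.mono_neutral_right)
        have "- int n \<le> \<lfloor>x\<rfloor> - 2" "\<lfloor>x\<rfloor> \<le> int n"
          using n that(1) by linarith+
        then show "{\<lfloor>x\<rfloor> - 2..\<lfloor>x\<rfloor>} \<subseteq> ?I"
          by auto
      qed (use that(2) in auto)
      have a: "(\<Sum>i\<in>?I. h i x * bump i x) * vderiv \<phi> x = - \<Gamma> x * vderiv \<phi> x"
      proof (cases "R' < \<bar>x\<bar>")
        case False
        then show ?thesis
          using R by (subst sum_eq) (auto simp: \<Gamma>_def bump_support)
      qed (simp add: R')
      have b: "(\<Sum>i\<in>?I. h i x * vderiv (bump i) x) * \<phi> x = \<gamma> x * \<phi> x"
      proof (cases "R < \<bar>x\<bar>")
        case False
        then show ?thesis
          using R' by (subst sum_eq) (auto simp: \<gamma>_def bump_support)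
      qed (simp add: R)
      have "(\<Sum>i\<in>?I. h i x * vderiv (\<lambda>x. bump i x * \<phi> x) x) =
          (\<Sum>i\<in>?I. h i x * bump i x) * vderiv \<phi> x + (\<Sum>i\<in>?I. h i x * vderiv (bump i) x) * \<phi> x"
        unfolding vd sum_distrib_right sum.distrib[symmetric] by (intro sum.cong refl) (simp add: algebra_simps)
      then show "(\<Sum>i\<in>?I. h i x * vderiv (\<lambda>x. bump i x * \<phi> x) x) = \<gamma> x * \<phi> x - \<Gamma> x * vderiv \<phi> x"
        unfolding a b by simp
    qed
    also have "\<dots> = (LINT x|lborel. \<gamma> x * \<phi> x) - (LINT x|lborel. \<Gamma> x * vderiv \<phi> x)"
      by (intro Bochner_Integration.integral_diff
          unif_loc_mult_test_integrable[OF \<gamma>_meas borel_unif_locD(2)[OF bul]]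
          unif_loc_mult_test_integrable[OF \<Gamma>_meas borel_unif_locD(3)[OF bul]] test_vderiv \<phi>)
    also have "\<dots> = dist_deriv (dist_of_fun \<Gamma>) \<phi> + dist_of_fun \<gamma> \<phi>"
      using test_smooth[OF \<phi>]
      by (simp add: dist_deriv_def dist_of_fun_lborel smooth_measurable smooth_vderiv_measurable)
    finally show ?thesis .
  qed
  with borel_unif_loc_imp_unif_loc_bound[OF bul] show ?thesis
    by blast
qed

theorem mainTheorem3:
  fixes Q :: "(real \<Rightarrow> complex) \<Rightarrow> complex"
  assumes "distribution Q"
  shows "(inf_form_bounded Q \<longleftrightarrow> form_bounded Q) \<and>
    (form_bounded Q \<longleftrightarrow>
      (\<exists>\<Gamma> \<gamma>. unif_loc_bound \<Gamma> \<gamma> \<and>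
        (\<forall>\<phi>\<in>test_functions. Q \<phi> = dist_deriv (dist_of_fun \<Gamma>) \<phi> + dist_of_fun \<gamma> \<phi>))) \<and>
    ((\<exists>\<Gamma> \<gamma>. unif_loc_bound \<Gamma> \<gamma> \<and>
        (\<forall>\<phi>\<in>test_functions. Q \<phi> = dist_deriv (dist_of_fun \<Gamma>) \<phi> + dist_of_fun \<gamma> \<phi>)) \<longleftrightarrow>
      (\<exists>\<Gamma> \<gamma>. unif_loc_bound \<Gamma> \<gamma> \<and>
        has_convolution (\<lambda>s. sgn s * exp (- \<bar>s\<bar>)) Q (dist_of_fun \<Gamma>) \<and>
        has_convolution (\<lambda>s. exp (- \<bar>s\<bar>)) Q (dist_of_fun \<gamma>)))"
proof (intro conjI iffI)
  show "inf_form_bounded Q \<Longrightarrow> form_bounded Q"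
    by (rule inf_form_bounded_imp_form_bounded)
  show "form_bounded Q \<Longrightarrow> \<exists>\<Gamma> \<gamma>. unif_loc_bound \<Gamma> \<gamma> \<and>
        (\<forall>\<phi>\<in>test_functions. Q \<phi> = dist_deriv (dist_of_fun \<Gamma>) \<phi> + dist_of_fun \<gamma> \<phi>)"
    by (rule form_bounded_imp_representation[OF assms])
  \<comment> \<open>The improvement from a single constant to arbitrarily small \<epsilon> passes
    through the representation just obtained.\<close>
  then show "form_bounded Q \<Longrightarrow> inf_form_bounded Q"
    using representation_imp_inf_form_bounded by blast
qed (use representation_imp_inf_form_bounded inf_form_bounded_imp_form_bounded
      representation_imp_convolution convolution_imp_representation[OF assms] in blast)+

end
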